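(* For every precubical set $K$, the map of Moore flows $\mathbb M^{\mathcal G}(|K|^t_{reg})\to\mathbb M^{\mathcal G}(|K|_{reg})$ induced by the natural inclusion $|K|^t_{reg}\to|K|_{reg}$ is a weak equivalence of the h-model structure of Moore flows.
   Context: $\mathbf{Top}$: $\Delta$-generated spaces; mapping spaces carry the $\Delta$-kelleyfication of the compact-open topology. Precubical sets: presheaves on the box category $\square$; $K_0$ vertices; $|K|_{geom}=\mathrm{colim}_{\square[n]\to K}[0,1]^n$; $|c|_{geom}:[0,1]^n\to|K|_{geom}$ for $c\in K_n$. A $d$-path of $[0,1]^n$ is a continuous map $[0,\ell]\to[0,1]^n$ nondecreasing in each coordinate, tame if its endpoints are in $\{0,1\}^n$; a $d$-path of $K$ is a Moore composition $(|c_1|_{geom}\circ\gamma_1)*\cdots*(|c_p|_{geom}\circ\gamma_p)$ of such, tame if the $\gamma_i$ can be chosen tame. Regular: constant on no interval $[a,b]$ with $a<b$. $\mathcal G(\ell_1,\ell_2)$: nondecreasing homeomorphisms $[0,\ell_1]\to[0,\ell_2]$. Multipointed $d$-spaces: triples $(|X|,X^0,\mathbb P^{top}X)$ (space, states, paths $[0,1]\to|X|$ between states closed under $\mathcal G(1,1)$-reparametrization and normalized composition). $|K|^t_{reg}$: underlying $|K|_{geom}$, states $K_0$, execution paths the nonconstant tame regular $d$-paths $[0,1]\to|K|_{geom}$ between vertices. $|K|_{reg}$: same, with all nonconstant regular $d$-paths $[0,1]\to|K|_{geom}$ between vertices. Moore flows: states $X^0$, $\mathcal G$-spaces (enriched functors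 $\mathcal G^{op}\to\mathbf{Top}$) $\mathbb P_{\alpha,\beta}X$, associative compositions $\mathbb P_{\alpha,\beta}X\otimes\mathbb P_{\beta,\gamma}X\to\mathbb P_{\alpha,\gamma}X$ for the tensor $(D\otimes E)(\ell)=\int^{(\ell_1,\ell_2)}\mathcal G(\ell,\ell_1+\ell_2)\times D(\ell_1)\times E(\ell_2)$; $\mathbb P^\ell_{\alpha,\beta}X=\mathbb P_{\alpha,\beta}X(\ell)$. $\mathbb M^{\mathcal G}(X)$: states $X^0$, $\mathbb P^\ell_{\alpha,\beta}=\{\gamma(t/\ell)\mid\gamma\in\mathbb P^{top}_{\alpha,\beta}X\}$, $\mathcal G$ acting by precomposition, Moore composition. A map $f$ of Moore flows is a weak equivalence of the h-model structure iff $f^0$ is a bijection and each $\mathbb P^\ell_{\alpha,\beta}X\to\mathbb P^\ell_{f\alpha,f\beta}Y$ is a homotopy equivalence. *)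

theory Defs
  imports "HOL-Analysis.Analysis" "HOL-Homology.Simplices" "HOL-Library.FuncSet"
begin

section \<open>Precubical sets\<close>

text \<open>A precubical set (presheaf on the box category) is given by sets of n-cells K n and
face maps d n i a : K n -> K (n-1) for 0-based indices i < n and a :: bool (a = True is the
face at 1), satisfying the precubical identities.\<close>

definition precubical_set :: "(nat \<Rightarrow> 'c set) \<Rightarrow> (nat \<Rightarrow> nat \<Rightarrow> bool \<Rightarrow> 'c \<Rightarrow> 'c) \<Rightarrow> bool" where
  "precubical_set K d \<longleftrightarrow>
     (\<forall>n i a x. x \<in> K (Suc n) \<and> i \<le> n \<longrightarrow> d (Suc n) i a x \<in> K n) \<and>
     (\<forall>n i j a b x. x \<in> K (Suc (Suc n)) \<and> i < j \<and> j \<le> Suc n \<longrightarrow>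
        d (Suc n) i a (d (Suc (Suc n)) j b x) = d (Suc n) (j - 1) b (d (Suc (Suc n)) i a x))"

section \<open>Topological cubes\<close>

definition cube :: "nat \<Rightarrow> (nat \<Rightarrow> real) set" where
  "cube n = {u. (\<forall>k<n. 0 \<le> u k \<and> u k \<le> 1) \<and> (\<forall>k\<ge>n. u k = 0)}"

definition cube_top :: "nat \<Rightarrow> (nat \<Rightarrow> real) topology" where
  "cube_top n = subtopology (powertop_real UNIV) (cube n)"

text \<open>Coface map [0,1]^(m-1) -> [0,1]^m inserting the value a at coordinate i.\<close>
definition cface :: "nat \<Rightarrow> nat \<Rightarrow> bool \<Rightarrow> (nat \<Rightarrow> real) \<Rightarrow> (nat \<Rightarrow> real)" where
  "cface m i a u = (\<lambda>k. if k < i then u k else if k = i then (if a then 1 else 0)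
                         else if k < m then u (k - 1) else 0)"

section \<open>Geometric realization\<close>

type_synonym 'c elt = "nat \<times> 'c \<times> (nat \<Rightarrow> real)"
type_synonym 'c point = "'c elt set"

definition real_elts :: "(nat \<Rightarrow> 'c set) \<Rightarrow> 'c elt set" where
  "real_elts K = {(n, c, u). c \<in> K n \<and> u \<in> cube n}"

definition real_rel :: "(nat \<Rightarrow> 'c set) \<Rightarrow> (nat \<Rightarrow> nat \<Rightarrow> bool \<Rightarrow> 'c \<Rightarrow> 'c) \<Rightarrow> ('c elt \<times> 'c elt) set" where
  "real_rel K d = {((n, d (Suc n) i a c, u), (Suc n, c, cface (Suc n) i a u)) | n i a c u.
                     c \<in> K (Suc n) \<and> i \<le> n \<and> u \<in> cube n}"

definition real_class :: "(nat \<Rightarrow> 'c set) \<Rightarrow> (nat \<Rightarrow> nat \<Rightarrow> bool \<Rightarrow> 'c \<Rightarrow> 'c) \<Rightarrow> 'c elt \<Rightarrow> 'c point" where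
  "real_class K d x = ((real_rel K d \<union> (real_rel K d)\<inverse>)\<^sup>*) `` {x}"

definition geom_points :: "(nat \<Rightarrow> 'c set) \<Rightarrow> (nat \<Rightarrow> nat \<Rightarrow> bool \<Rightarrow> 'c \<Rightarrow> 'c) \<Rightarrow> 'c point set" where
  "geom_points K d = real_class K d ` real_elts K"

text \<open>|c|_geom : [0,1]^n -> |K|_geom\<close>
definition real_cell :: "(nat \<Rightarrow> 'c set) \<Rightarrow> (nat \<Rightarrow> nat \<Rightarrow> bool \<Rightarrow> 'c \<Rightarrow> 'c) \<Rightarrow> nat \<Rightarrow> 'c \<Rightarrow> (nat \<Rightarrow> real) \<Rightarrow> 'c point" where
  "real_cell K d n c u = real_class K d (n, c, u)"

text \<open>Colimit topology (final topology w.r.t. all maps |c|_geom).\<close>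
definition geom_top :: "(nat \<Rightarrow> 'c set) \<Rightarrow> (nat \<Rightarrow> nat \<Rightarrow> bool \<Rightarrow> 'c \<Rightarrow> 'c) \<Rightarrow> 'c point topology" where
  "geom_top K d = topology (\<lambda>V. V \<subseteq> geom_points K d \<and>
      (\<forall>n c. c \<in> K n \<longrightarrow> openin (cube_top n) {u \<in> cube n. real_cell K d n c u \<in> V}))"

definition vertex :: "(nat \<Rightarrow> 'c set) \<Rightarrow> (nat \<Rightarrow> nat \<Rightarrow> bool \<Rightarrow> 'c \<Rightarrow> 'c) \<Rightarrow> 'c \<Rightarrow> 'c point" where
  "vertex K d c = real_cell K d 0 c (\<lambda>_. 0)"

section \<open>d-paths\<close>

definition cube_dpath :: "nat \<Rightarrow> real \<Rightarrow> (real \<Rightarrow> nat \<Rightarrow> real) \<Rightarrow> bool" where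
  "cube_dpath n l g \<longleftrightarrow> 0 < l \<and>
     continuous_map (subtopology euclideanreal {0..l}) (cube_top n) g \<and>
     (\<forall>k<n. mono_on {0..l} (\<lambda>t. g t k))"

definition cube_tame :: "nat \<Rightarrow> real \<Rightarrow> (real \<Rightarrow> nat \<Rightarrow> real) \<Rightarrow> bool" where
  "cube_tame n l g \<longleftrightarrow> (\<forall>k<n. g 0 k \<in> {0, 1} \<and> g l k \<in> {0, 1})"

text \<open>dpath K d tm l p: p restricted to [0,l] is a d-path of K (a Moore composition of
 pieces |c|_geom o g with g a d-path of a cube); if tm then all pieces are tame.\<close>
inductive dpath :: "(nat \<Rightarrow> 'c set) \<Rightarrow> (nat \<Rightarrow> nat \<Rightarrow> bool \<Rightarrow> 'c \<Rightarrow> 'c) \<Rightarrow> bool \<Rightarrow> real \<Rightarrow> (real \<Rightarrow> 'c point) \<Rightarrow> bool"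
  for K d tm where
  base: "\<lbrakk> cube_dpath n l g; tm \<longrightarrow> cube_tame n l g; c \<in> K n;
           \<forall>t\<in>{0..l}. p t = real_cell K d n c (g t) \<rbrakk> \<Longrightarrow> dpath K d tm l p"
| comp: "\<lbrakk> dpath K d tm l1 p1; dpath K d tm l2 p2; p1 l1 = p2 0;
           \<forall>t\<in>{0..l1 + l2}. p t = (if t \<le> l1 then p1 t else p2 (t - l1)) \<rbrakk>
         \<Longrightarrow> dpath K d tm (l1 + l2) p"

definition regular_path :: "real \<Rightarrow> (real \<Rightarrow> 'a) \<Rightarrow> bool" where
  "regular_path l p \<longleftrightarrow> \<not> (\<exists>a b. 0 \<le> a \<and> a < b \<and> b \<le> l \<and> (\<forall>t\<in>{a..b}. p t = p a))"

definition constant_path :: "real \<Rightarrow> (real \<Rightarrow> 'a) \<Rightarrow> bool" where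
  "constant_path l p \<longleftrightarrow> (\<forall>t\<in>{0..l}. p t = p 0)"

section \<open>Multipointed d-spaces\<close>

text \<open>Execution paths are represented as functions real => 'a that are extensional on [0,1].\<close>
record 'a mdspace =
  space :: "'a topology"
  states :: "'a set"
  exec_paths :: "(real \<Rightarrow> 'a) set"

definition mdspace_map :: "'a mdspace \<Rightarrow> 'b mdspace \<Rightarrow> ('a \<Rightarrow> 'b) \<Rightarrow> bool" where
  "mdspace_map X Y f \<longleftrightarrow> continuous_map (space X) (space Y) f \<and> f ` states X \<subseteq> states Y \<and>
     (\<forall>p\<in>exec_paths X. (\<lambda>t\<in>{0..1}. f (p t)) \<in> exec_paths Y)"

text \<open>|K|^t_reg (tm = True) and |K|_reg (tm = False).\<close>
definition Kreg :: "(nat \<Rightarrow> 'c set) \<Rightarrow> (nat \<Rightarrow> nat \<Rightarrow> bool \<Rightarrow> 'c \<Rightarrow> 'c) \<Rightarrow> bool \<Rightarrow> 'c point mdspace" where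
  "Kreg K d tm = \<lparr> space = geom_top K d, states = vertex K d ` K 0,
     exec_paths = {p \<in> extensional {0..1}. dpath K d tm 1 p \<and> regular_path 1 p \<and>
        \<not> constant_path 1 p \<and> p 0 \<in> vertex K d ` K 0 \<and> p 1 \<in> vertex K d ` K 0} \<rparr>"

section \<open>Delta-kelleyfication and mapping spaces\<close>

definition delta_k :: "'a topology \<Rightarrow> 'a topology" where
  "delta_k X = topology (\<lambda>U. U \<subseteq> topspace X \<and>
     (\<forall>n \<sigma>. continuous_map (subtopology (powertop_real UNIV) (standard_simplex n)) X \<sigma> \<longrightarrow>
        openin (subtopology (powertop_real UNIV) (standard_simplex n)) {x \<in> standard_simplex n. \<sigma> x \<in> U}))"

text \<open>Compact-open topology on continuous maps X -> Y (represented extensionally on topspace X).\<close>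
definition compact_open_top :: "'a topology \<Rightarrow> 'b topology \<Rightarrow> ('a \<Rightarrow> 'b) topology" where
  "compact_open_top X Y = topology_generated_by
     {{f. continuous_map X Y f \<and> f \<in> extensional (topspace X) \<and> f ` C \<subseteq> U} | C U.
        compactin X C \<and> openin Y U}"

definition map_top :: "'a topology \<Rightarrow> 'b topology \<Rightarrow> ('a \<Rightarrow> 'b) topology" where
  "map_top X Y = delta_k (compact_open_top X Y)"

definition interval_top :: "real \<Rightarrow> real topology" where
  "interval_top l = subtopology euclideanreal {0..l}"

section \<open>The Moore flow M^G(X) and h-weak equivalences\<close>

definition MG_set :: "'a mdspace \<Rightarrow> 'a \<Rightarrow> 'a \<Rightarrow> real \<Rightarrow> (real \<Rightarrow> 'a) set" where
  "MG_set X a b l = {(\<lambda>t\<in>{0..l}. p (t / l)) | p. p \<in> exec_paths X \<and> p 0 = a \<and> p 1 = b}"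

definition MG_top :: "'a mdspace \<Rightarrow> 'a \<Rightarrow> 'a \<Rightarrow> real \<Rightarrow> (real \<Rightarrow> 'a) topology" where
  "MG_top X a b l = delta_k (subtopology (map_top (interval_top l) (space X)) (MG_set X a b l))"

definition MG_map :: "('a \<Rightarrow> 'b) \<Rightarrow> real \<Rightarrow> (real \<Rightarrow> 'a) \<Rightarrow> (real \<Rightarrow> 'b)" where
  "MG_map f l p = (\<lambda>t\<in>{0..l}. f (p t))"

definition homotopy_equivalence_map :: "'a topology \<Rightarrow> 'b topology \<Rightarrow> ('a \<Rightarrow> 'b) \<Rightarrow> bool" where
  "homotopy_equivalence_map X Y f \<longleftrightarrow> continuous_map X Y f \<and>
     (\<exists>g. continuous_map Y X g \<and> homotopic_with (\<lambda>_. True) X X (g \<circ> f) id \<and>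
          homotopic_with (\<lambda>_. True) Y Y (f \<circ> g) id)"

definition MG_h_weak_equivalence :: "'a mdspace \<Rightarrow> 'b mdspace \<Rightarrow> ('a \<Rightarrow> 'b) \<Rightarrow> bool" where
  "MG_h_weak_equivalence X Y f \<longleftrightarrow> bij_betw f (states X) (states Y) \<and>
     (\<forall>a\<in>states X. \<forall>b\<in>states X. \<forall>l>0.
        homotopy_equivalence_map (MG_top X a b l) (MG_top Y (f a) (f b) l) (MG_map f l))"

end

theory Submission
  imports Defs "HOL-Library.Confluence"
begin

text \<open>
A directed path p of length L between vertices is deformed by a coordinatewise rescaling of the
cubes: at time t every coordinate x is replaced by the steep step function
min 1 (max 0 (M (x - c(t)) + 1/2)), which fixes 0 and 1 and hence is compatible with the faces.
The threshold c(t) decreases slowly with the length travelled so far, whereas the coordinates of p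
do not decrease. So every coordinate crosses the threshold at a definite rate, and its jump from 0
to 1 takes only a short time. If M is large compared to L squared, then the times at which no
coordinate is jumping, that is, at which the deformed path is at a vertex, are so dense that all
coordinates jumping between two of them live in a common cube: the deformed path is tame. Since the
deformed path rests at times, it is reparametrized by its length, which keeps it regular. The linear
interpolation between x and the step function gives a homotopy to the identity that preserves
tameness. Lengths are continuous in families because the sum of the coordinates is a
circle-valued function on the realization.
\<close>

section \<open>Mapping spaces and products with Delta-generated spaces\<close>

text \<open>The threshold must move because of paths that linger: while one coordinate rests near a
  fixed threshold, others may cross many cubes, and the deformed path meets no vertex for a long
  time. The size of M comes from a count of lengths. Both ends are vertices, so the deformed path
  has the same total length \<open>L l\<close> as p. On a stretch without vertices it moves at least
  M / (8 * L l) times as fast as p, so a stretch of length more than 1/16 would use up more than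
  \<open>L l\<close>.

  The other obstacle is the common cube. In an arbitrary K faces of a cell may be identified, a
  point has no preferred coordinates, and consecutive pieces of a path need not lie in one cube.
  Pieces are therefore compared by a rewriting relation that forgets coordinates close to 0 or 1,
  which the step function does not see; the precubical identities make it confluent.

  Path spaces are known only through probes by simplices. Continuity is thus checked over an
  interval times a simplex; there compactness turns reparametrization by length into passage to a
  quotient.\<close>

abbreviation simplex_top :: "nat \<Rightarrow> (nat \<Rightarrow> real) topology" where
  "simplex_top n \<equiv> subtopology (powertop_real UNIV) (standard_simplex n)"

text \<open>The product with the locally compact set S preserves final topologies. Around q0 there
  is a compact neighbourhood C, and the set U of all x with C times {x} inside the preimage of W is
  open since, by the tube lemma, its preimage under every probe is. This serves both the
  realization, with cubes as probes, and the path spaces, with simplices as probes.\<close>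

lemma continuous_map_prod_final:
  fixes S :: "'p::heine_borel set" and T :: "'i \<Rightarrow> 'b topology" and \<sigma> :: "'i \<Rightarrow> 'b \<Rightarrow> 'a"
  assumes S: "closed S"
    and final: "\<And>U. U \<subseteq> topspace X \<Longrightarrow>
          (\<And>i. i \<in> I \<Longrightarrow> openin (T i) {y \<in> topspace (T i). \<sigma> i y \<in> U}) \<Longrightarrow> openin X U"
    and maps: "\<And>i y. i \<in> I \<Longrightarrow> y \<in> topspace (T i) \<Longrightarrow> \<sigma> i y \<in> topspace X"
    and cover: "\<And>x. x \<in> topspace X \<Longrightarrow> \<exists>i\<in>I. \<exists>y\<in>topspace (T i). \<sigma> i y = x"
    and cont: "\<And>i. i \<in> I \<Longrightarrow>
          continuous_map (prod_topology (top_of_set S) (T i)) Y (\<lambda>(q, y). f (q, \<sigma> i y))"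
  shows "continuous_map (prod_topology (top_of_set S) X) Y f"
  unfolding continuous_map_def
proof (intro conjI allI impI)
  show "f \<in> topspace (prod_topology (top_of_set S) X) \<rightarrow> topspace Y"
  proof
    fix z assume "z \<in> topspace (prod_topology (top_of_set S) X)"
    then obtain q x where z: "z = (q, x)" "q \<in> S" "x \<in> topspace X" by auto
    obtain i y where i: "i \<in> I" "y \<in> topspace (T i)" "\<sigma> i y = x" using cover z(3) by blast
    have "(\<lambda>(q, y). f (q, \<sigma> i y)) (q, y) \<in> topspace Y"
      using cont[OF i(1)] z(2) i(2) by (intro continuous_map_image_subset_topspace[THEN subsetD]) auto
    then show "f z \<in> topspace Y" using z i by simp
  qed
next
  fix W assume W: "openin Y W"
  let ?P = "{z \<in> topspace (prod_topology (top_of_set S) X). f z \<in> W}"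
  have op: "openin (prod_topology (top_of_set S) (T i)) {z \<in> S \<times> topspace (T i). f (fst z, \<sigma> i (snd z)) \<in> W}"
    if "i \<in> I" for i
    using openin_continuous_map_preimage[OF cont[OF that] W] by (simp add: case_prod_unfold)
  show "openin (prod_topology (top_of_set S) X) ?P"
    unfolding openin_prod_topology_alt
  proof (intro allI impI)
    fix q0 x0 assume "(q0, x0) \<in> ?P"
    then have q0: "q0 \<in> S" and x0: "x0 \<in> topspace X" and f0: "f (q0, x0) \<in> W" by auto
    obtain i y where i: "i \<in> I" "y \<in> topspace (T i)" "\<sigma> i y = x0" using cover x0 by blast
    have "continuous_map (top_of_set S) (prod_topology (top_of_set S) (T i)) (\<lambda>q. (q, y))"
      using i by (simp add: continuous_map_pairwise o_def)
    from openin_continuous_map_preimage[OF this op[OF i(1)]]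
    have "openin (top_of_set S) {q \<in> S. f (q, x0) \<in> W}"
      using i by simp
    then obtain e where e: "e > 0" "\<And>q. q \<in> S \<Longrightarrow> dist q q0 < e \<Longrightarrow> f (q, x0) \<in> W"
      using q0 f0 unfolding openin_euclidean_subtopology_iff by blast
    define C where "C = S \<inter> cball q0 (e/2)"
    have C: "compact C" unfolding C_def using S by (simp add: closed_Int_compact)
    have CW: "f (q, x0) \<in> W" if "q \<in> C" for q
      using that e by (auto simp: C_def dist_commute)
    have Cc: "compactin (top_of_set S) C"
      using C by (simp add: compactin_subtopology C_def)
    define U where "U = {x \<in> topspace X. \<forall>q\<in>C. f (q, x) \<in> W}"
    have "openin X U"
    proof (rule final)
      show "U \<subseteq> topspace X" by (auto simp: U_def)
      fix j assume j: "j \<in> I"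
      have "\<exists>V. openin (T j) V \<and> y \<in> V \<and> V \<subseteq> {y \<in> topspace (T j). \<sigma> j y \<in> U}"
        if y: "y \<in> {y \<in> topspace (T j). \<sigma> j y \<in> U}" for y
      proof -
        have "C \<times> {y} \<subseteq> {z \<in> S \<times> topspace (T j). f (fst z, \<sigma> j (snd z)) \<in> W}"
          using y by (auto simp: U_def C_def)
        from tube_lemma_left[OF op[OF j] Cc _ this] y
        obtain U' V where UV: "openin (top_of_set S) U'" "openin (T j) V" "C \<subseteq> U'" "y \<in> V"
          "U' \<times> V \<subseteq> {z \<in> S \<times> topspace (T j). f (fst z, \<sigma> j (snd z)) \<in> W}" by auto
        have "V \<subseteq> {y \<in> topspace (T j). \<sigma> j y \<in> U}"
          using UV(2,3,5) openin_subset[OF UV(2)] maps[OF j] by (fastforce simp: U_def)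
        then show ?thesis using UV by blast
      qed
      then show "openin (T j) {y \<in> topspace (T j). \<sigma> j y \<in> U}"
        by (subst openin_subopen) blast
    qed
    moreover have "openin (top_of_set S) (S \<inter> ball q0 (e/2))" by blast
    moreover have "(S \<inter> ball q0 (e/2)) \<times> U \<subseteq> ?P"
      by (auto simp: U_def C_def)
    moreover have "x0 \<in> U" using x0 CW by (auto simp: U_def)
    moreover have "q0 \<in> S \<inter> ball q0 (e/2)" using q0 e by auto
    ultimately show "\<exists>U V. openin (top_of_set S) U \<and> openin X V \<and> q0 \<in> U \<and> x0 \<in> V \<and> U \<times> V \<subseteq> ?P"
      by blast
  qed
qed

section \<open>Kelleyfication and retracts of simplices\<close>

lemma openin_delta_k:
  "openin (delta_k X) U \<longleftrightarrow> U \<subseteq> topspace X \<and>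
     (\<forall>n \<sigma>. continuous_map (simplex_top n) X \<sigma> \<longrightarrow>
        openin (simplex_top n) {x \<in> standard_simplex n. \<sigma> x \<in> U})"
proof -
  have "istopology (\<lambda>U. U \<subseteq> topspace X \<and>
     (\<forall>n \<sigma>. continuous_map (simplex_top n) X \<sigma> \<longrightarrow>
        openin (simplex_top n) {x \<in> standard_simplex n. \<sigma> x \<in> U}))" (is "istopology ?P")
    unfolding istopology_def
  proof (intro conjI allI impI)
    fix S T assume "?P S" "?P T"
    moreover have "{x \<in> standard_simplex n. \<sigma> x \<in> S \<inter> T} =
      {x \<in> standard_simplex n. \<sigma> x \<in> S} \<inter> {x \<in> standard_simplex n. \<sigma> x \<in> T}" for n and \<sigma> :: "_ \<Rightarrow> 'a" by auto
    ultimately show "S \<inter> T \<subseteq> topspace X"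
      "continuous_map (simplex_top n) X \<sigma> \<Longrightarrow> openin (simplex_top n) {x \<in> standard_simplex n. \<sigma> x \<in> S \<inter> T}" for n \<sigma>
      by (auto intro: openin_Int)
  next
    fix \<K> assume K: "\<forall>S\<in>\<K>. ?P S"
    then show "\<Union>\<K> \<subseteq> topspace X" by auto
    fix n and \<sigma> :: "(nat \<Rightarrow> real) \<Rightarrow> 'a" assume "continuous_map (simplex_top n) X \<sigma>"
    moreover have "{x \<in> standard_simplex n. \<sigma> x \<in> \<Union>\<K>} = \<Union>((\<lambda>S. {x \<in> standard_simplex n. \<sigma> x \<in> S}) ` \<K>)" by auto
    ultimately show "openin (simplex_top n) {x \<in> standard_simplex n. \<sigma> x \<in> \<Union>\<K>}"
      using K by (auto intro!: openin_Union)
  qed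
  then show ?thesis unfolding delta_k_def by (simp add: topology_inverse')
qed

lemma topspace_delta_k [simp]: "topspace (delta_k X) = topspace X"
proof -
  have "openin (delta_k X) (topspace X)"
    unfolding openin_delta_k
    by (auto dest: openin_continuous_map_preimage[OF _ openin_topspace])
  then show ?thesis
    by (meson openin_delta_k openin_subset openin_topspace subset_antisym)
qed

lemma openin_imp_openin_delta_k: "openin X U \<Longrightarrow> openin (delta_k X) U"
  unfolding openin_delta_k
  by (auto dest: openin_subset openin_continuous_map_preimage)

lemma continuous_map_into_delta_k_imp: "continuous_map Z (delta_k X) f \<Longrightarrow> continuous_map Z X f"
  unfolding continuous_map_def by (auto intro: openin_imp_openin_delta_k)

lemma simplex_into_delta_k:
  "continuous_map (simplex_top n) X \<sigma> \<Longrightarrow> continuous_map (simplex_top n) (delta_k X) \<sigma>"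
  unfolding continuous_map_def openin_delta_k by auto

text \<open>The composite of f with the retraction is a probe of X, and probes lift to
  \<open>delta_k X\<close> by construction. Restricting along j gives back f.\<close>

lemma retract_into_delta_k:
  assumes j: "continuous_map Z (simplex_top n) j" and q: "continuous_map (simplex_top n) Z q"
    and qj: "\<And>z. z \<in> topspace Z \<Longrightarrow> q (j z) = z" and f: "continuous_map Z X f"
  shows "continuous_map Z (delta_k X) f"
proof -
  have "continuous_map (simplex_top n) (delta_k X) (f \<circ> q)"
    using simplex_into_delta_k continuous_map_compose[OF q f] by blast
  from continuous_map_compose[OF j this] show ?thesis
    by (rule continuous_map_eq) (simp add: qj)
qed

text \<open>The map j distributes the barycentric coordinates x over two blocks with weights 1 - r
  and r, where r is the relative position of s in the interval. The map q adds the blocks to recover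
  x and reads s off the total weight of the second block.\<close>

lemma interval_times_simplex_retract:
  fixes a b :: real
  assumes ab: "a \<le> b"
  obtains j q where
    "continuous_map (prod_topology (top_of_set {a..b}) (simplex_top n)) (simplex_top (Suc (2 * n))) j"
    "continuous_map (simplex_top (Suc (2 * n))) (prod_topology (top_of_set {a..b}) (simplex_top n)) q"
    "\<And>z. z \<in> topspace (prod_topology (top_of_set {a..b}) (simplex_top n)) \<Longrightarrow> q (j z) = z"
proof
  let ?Z = "prod_topology (top_of_set {a..b}) (simplex_top n)"
  \<comment> \<open>For a = b this is a division by zero with value 0: all weight goes to the first
    block and q returns a. One-point intervals occur later as parameter spaces.\<close>
  let ?r = "\<lambda>s. (s - a) / (b - a)"
  define j where "j = (\<lambda>(s, x). \<lambda>i. if i \<le> n then (1 - ?r s) * x i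
      else if i \<le> Suc (2 * n) then ?r s * x (i - Suc n) else (0::real))"
  define q where "q = (\<lambda>y. (a + (b - a) * (\<Sum>i\<le>n. y (i + Suc n)),
      \<lambda>i. if i \<le> n then y i + y (i + Suc n) else (0::real)))"
  have lam: "0 \<le> ?r s" "?r s \<le> 1" if "s \<in> {a..b}" for s
    using that by (auto simp: divide_simps)
  have split: "(\<Sum>i\<le>Suc (2 * n). g i) = (\<Sum>i\<le>n. g i) + (\<Sum>i\<le>n. g (i + Suc n))" for g :: "nat \<Rightarrow> real"
  proof -
    have "{..Suc (2 * n)} = {..n} \<union> {Suc n..Suc (2 * n)}" by auto
    then have "(\<Sum>i\<le>Suc (2 * n). g i) = (\<Sum>i\<le>n. g i) + (\<Sum>i\<in>{Suc n..Suc (2 * n)}. g i)"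
      by (simp add: sum.union_disjoint)
    also have "(\<Sum>i\<in>{Suc n..Suc (2 * n)}. g i) = (\<Sum>i\<le>n. g (i + Suc n))"
      by (rule sum.reindex_bij_witness[of _ "\<lambda>i. i + Suc n" "\<lambda>i. i - Suc n"]) auto
    finally show ?thesis .
  qed
  have j_in: "j (s, x) \<in> standard_simplex (Suc (2 * n))"
    if s: "s \<in> {a..b}" and x: "x \<in> standard_simplex n" for s x
  proof -
    have x01: "0 \<le> x i" "x i \<le> 1" for i using x by (auto simp: standard_simplex_def)
    have "(\<Sum>i\<le>Suc (2 * n). j (s, x) i) = (1 - ?r s) * (\<Sum>i\<le>n. x i) + ?r s * (\<Sum>i\<le>n. x i)"
      unfolding split by (simp add: j_def sum_distrib_left)
    then have "(\<Sum>i\<le>Suc (2 * n). j (s, x) i) = 1"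
      using x by (simp add: standard_simplex_def)
    moreover have "0 \<le> j (s, x) i \<and> j (s, x) i \<le> 1" for i
      unfolding j_def using x01 lam[OF s] by (auto intro!: mult_le_one mult_nonneg_nonneg simp del: times_divide_eq_left divide_le_eq_1)
    moreover have "j (s, x) i = 0" if "i > Suc (2 * n)" for i
      using that by (simp add: j_def)
    ultimately show ?thesis by (auto simp: standard_simplex_def)
  qed
  have proj: "continuous_map (simplex_top m) euclideanreal (\<lambda>x. x i)" for m i
    by (intro continuous_map_from_subtopology continuous_map_product_projection) simp
  have projs: "continuous_map ?Z euclideanreal (\<lambda>z. snd z i)" for i
    using continuous_map_compose[OF continuous_map_snd proj] by (simp add: o_def)
  have fsts: "continuous_map ?Z euclideanreal fst"
    using continuous_map_fst[of "top_of_set {a..b}"] continuous_map_into_fulltopology by blast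
  have jeq: "j = (\<lambda>z i. if i \<le> n then (1 - ?r (fst z)) * snd z i
      else if i \<le> Suc (2 * n) then ?r (fst z) * snd z (i - Suc n) else (0::real))"
    by (simp add: j_def case_prod_unfold)
  have "continuous_map ?Z euclideanreal (\<lambda>z. j z i)" for i
    unfolding jeq
    by (cases "i \<le> n"; cases "i \<le> Suc (2 * n)")
       (auto simp: divide_inverse intro!: continuous_intros projs fsts)
  then show "continuous_map ?Z (simplex_top (Suc (2 * n))) j"
    using j_in by (auto simp: continuous_map_in_subtopology continuous_map_componentwise_UNIV)
  have qs: "q y \<in> {a..b} \<times> standard_simplex n" if y: "y \<in> standard_simplex (Suc (2 * n))" for y
  proof -
    have y0: "0 \<le> y i" for i using y by (auto simp: standard_simplex_def)
    have y1: "(\<Sum>i\<le>n. y i) + (\<Sum>i\<le>n. y (i + Suc n)) = 1"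
      using y split[of y] by (auto simp: standard_simplex_def)
    have s1: "0 \<le> (\<Sum>i\<le>n. y (i + Suc n))" "0 \<le> (\<Sum>i\<le>n. y i)" by (auto intro: sum_nonneg y0)
    have "(b - a) * (\<Sum>i\<le>n. y (i + Suc n)) \<le> (b - a) * 1"
      using ab y1 s1 by (intro mult_left_mono) auto
    moreover have "y i + y (i + Suc n) \<le> 1" if "i \<le> n" for i
      using y1 member_le_sum[of i "{..n}" y] member_le_sum[of i "{..n}" "\<lambda>i. y (i + Suc n)"] y0 that by auto
    ultimately show ?thesis using ab s1 y0 y1 by (auto simp: q_def standard_simplex_def sum.distrib)
  qed
  have "continuous_map (simplex_top (Suc (2 * n))) euclideanreal (\<lambda>y. fst (q y))"
    unfolding q_def by (auto intro!: continuous_intros proj)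
  moreover have "continuous_map (simplex_top (Suc (2 * n))) euclideanreal (\<lambda>y. snd (q y) i)" for i
    unfolding q_def by (cases "i \<le> n") (auto intro!: continuous_intros proj)
  ultimately show "continuous_map (simplex_top (Suc (2 * n))) ?Z q"
    using qs by (auto simp: continuous_map_pairwise o_def continuous_map_in_subtopology
        continuous_map_componentwise_UNIV mem_Times_iff)
  show "q (j z) = z" if "z \<in> topspace ?Z" for z
  proof -
    obtain s x where z: "z = (s, x)" by fastforce
    with that have s: "s \<in> {a..b}" and x: "x \<in> standard_simplex n" by auto
    have "(\<Sum>i\<le>n. j (s, x) (i + Suc n)) = ?r s * (\<Sum>i\<le>n. x i)"
      by (simp add: j_def sum_distrib_left)
    also have "\<dots> = ?r s" using x by (simp add: standard_simplex_def)
    finally have "a + (b - a) * (\<Sum>i\<le>n. j (s, x) (i + Suc n)) = s" using s by auto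
    moreover have "(\<lambda>i. if i \<le> n then j (s, x) i + j (s, x) (i + Suc n) else 0) = x"
      using x by (auto simp: j_def standard_simplex_def algebra_simps)
    ultimately show ?thesis by (simp add: q_def z)
  qed
qed

section \<open>The compact-open topology over an interval: evaluation and its adjoint\<close>

lemma topspace_compact_open_top:
  "topspace (compact_open_top X Y) = {f. continuous_map X Y f \<and> f \<in> extensional (topspace X)}"
  unfolding compact_open_top_def topology_generated_by_topspace by auto

lemma openin_compact_open:
  assumes "compactin X C" "openin Y U"
  shows "openin (compact_open_top X Y) {f. continuous_map X Y f \<and> f \<in> extensional (topspace X) \<and> f ` C \<subseteq> U}"
  unfolding compact_open_top_def using assms by (intro topology_generated_by_Basis) blast

lemma topspace_interval_top [simp]: "topspace (interval_top l) = {0..l}"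
  by (simp add: interval_top_def)

text \<open>Continuity of evaluation rests on local compactness of the interval: near t0 the path
  \<open>f z0\<close> maps a compact neighbourhood C into W, and this is an open condition on the
  path.\<close>

lemma continuous_map_compact_open_eval:
  assumes f: "continuous_map Z (compact_open_top (interval_top l) Y) f"
  shows "continuous_map (prod_topology Z (interval_top l)) Y (\<lambda>(z, t). f z t)"
  unfolding continuous_map_def
proof (intro conjI allI impI)
  have fz: "continuous_map (interval_top l) Y (f z)" if "z \<in> topspace Z" for z
    using continuous_map_image_subset_topspace[OF f] that by (auto simp: topspace_compact_open_top)
  show "(\<lambda>(z, t). f z t) \<in> topspace (prod_topology Z (interval_top l)) \<rightarrow> topspace Y"
    using fz continuous_map_image_subset_topspace by fastforce
  fix W assume W: "openin Y W"
  let ?P = "{z \<in> topspace (prod_topology Z (interval_top l)). (case z of (z, t) \<Rightarrow> f z t) \<in> W}"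
  show "openin (prod_topology Z (interval_top l)) ?P"
    unfolding openin_prod_topology_alt
  proof (intro allI impI)
    fix z0 t0 assume "(z0, t0) \<in> ?P"
    then have z0: "z0 \<in> topspace Z" and t0: "t0 \<in> {0..l}" and w: "f z0 t0 \<in> W" by auto
    have "openin (top_of_set {0..l}) {t \<in> {0..l}. f z0 t \<in> W}"
      using openin_continuous_map_preimage[OF fz[OF z0] W] by (simp add: interval_top_def)
    then obtain e where e: "e > 0" "\<And>t. t \<in> {0..l} \<Longrightarrow> dist t t0 < e \<Longrightarrow> f z0 t \<in> W"
      using t0 w unfolding openin_euclidean_subtopology_iff by blast
    define C where "C = {0..l} \<inter> cball t0 (e/2)"
    have C: "compactin (interval_top l) C"
      by (simp add: interval_top_def compactin_subtopology C_def closed_Int_compact)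
    have CW: "f z0 t \<in> W" if "t \<in> C" for t
      using that e by (auto simp: C_def dist_commute)
    define U where "U = {z \<in> topspace Z. f z \<in> {f. continuous_map (interval_top l) Y f \<and> f \<in> extensional (topspace (interval_top l)) \<and> f ` C \<subseteq> W}}"
    have "openin Z U" unfolding U_def
      by (rule openin_continuous_map_preimage[OF f openin_compact_open[OF C W]])
    moreover have "z0 \<in> U"
      using z0 CW continuous_map_image_subset_topspace[OF f] by (auto simp: U_def topspace_compact_open_top)
    moreover have "openin (interval_top l) ({0..l} \<inter> ball t0 (e/2))"
      by (auto simp: interval_top_def)
    moreover have "t0 \<in> {0..l} \<inter> ball t0 (e/2)" using t0 e by auto
    moreover have "U \<times> ({0..l} \<inter> ball t0 (e/2)) \<subseteq> ?P"
      by (auto simp: U_def C_def)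
    ultimately show "\<exists>U V. openin Z U \<and> openin (interval_top l) V \<and> z0 \<in> U \<and> t0 \<in> V \<and> U \<times> V \<subseteq> ?P"
      by (intro exI[of _ U] exI[of _ "{0..l} \<inter> ball t0 (e/2)"]) simp
  qed
qed

text \<open>For a compact C, the tube lemma thickens a point times C inside the open preimage of U
  to a neighbourhood of the point.\<close>

lemma continuous_map_into_compact_open:
  assumes f: "continuous_map (prod_topology Z (interval_top l)) Y (\<lambda>(z, t). f z t)"
    and ext: "\<And>z. z \<in> topspace Z \<Longrightarrow> f z \<in> extensional {0..l}"
  shows "continuous_map Z (compact_open_top (interval_top l) Y) f"
proof -
  have fz: "continuous_map (interval_top l) Y (f z)" if "z \<in> topspace Z" for z
  proof -
    have "continuous_map (interval_top l) (prod_topology Z (interval_top l)) (\<lambda>t. (z, t))"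
      using that by (simp add: continuous_map_pairwise o_def)
    from continuous_map_compose[OF this f] show ?thesis by (simp add: o_def)
  qed
  show ?thesis
    unfolding compact_open_top_def continuous_on_generated_topo_iff
  proof (intro conjI allI impI)
    show "f ` topspace Z \<subseteq> \<Union> {{f. continuous_map (interval_top l) Y f \<and> f \<in> extensional (topspace (interval_top l)) \<and> f ` C \<subseteq> U} |C U.
            compactin (interval_top l) C \<and> openin Y U}"
    proof
      fix g assume "g \<in> f ` topspace Z"
      then have "continuous_map (interval_top l) Y g" "g \<in> extensional (topspace (interval_top l))"
        using fz ext by auto
      \<comment> \<open>Membership in the union needs just one generator, and the empty compact set
        puts no condition on images.\<close>
      moreover have "compactin (interval_top l) {}" "openin Y {}" by auto
      ultimately have "g \<in> {f. continuous_map (interval_top l) Y f \<and> f \<in> extensional (topspace (interval_top l)) \<and> f ` {} \<subseteq> {}}"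
        by blast
      with \<open>compactin (interval_top l) {}\<close> \<open>openin Y {}\<close> show "g \<in> \<Union> {{f. continuous_map (interval_top l) Y f \<and> f \<in> extensional (topspace (interval_top l)) \<and> f ` C \<subseteq> U} |C U.
            compactin (interval_top l) C \<and> openin Y U}"
        by (intro UnionI[rotated, where X = "{f. continuous_map (interval_top l) Y f \<and> f \<in> extensional (topspace (interval_top l)) \<and> f ` {} \<subseteq> {}}"]) fast+
    qed
  next
    fix N assume "N \<in> {{f. continuous_map (interval_top l) Y f \<and> f \<in> extensional (topspace (interval_top l)) \<and> f ` C \<subseteq> U} |C U.
            compactin (interval_top l) C \<and> openin Y U}"
    then obtain C U where C: "compactin (interval_top l) C" and U: "openin Y U" and N:
      "N = {f. continuous_map (interval_top l) Y f \<and> f \<in> extensional (topspace (interval_top l)) \<and> f ` C \<subseteq> U}" by blast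
    have CI: "C \<subseteq> {0..l}" using compactin_subset_topspace[OF C] by simp
    have op: "openin (prod_topology Z (interval_top l)) {p \<in> topspace (prod_topology Z (interval_top l)). (\<lambda>(z, t). f z t) p \<in> U}"
      by (rule openin_continuous_map_preimage[OF f U])
    have "\<exists>V. openin Z V \<and> z \<in> V \<and> V \<subseteq> f -` N \<inter> topspace Z" if z: "z \<in> f -` N \<inter> topspace Z" for z
    proof -
      have "{z} \<times> C \<subseteq> {p \<in> topspace (prod_topology Z (interval_top l)). (\<lambda>(z, t). f z t) p \<in> U}"
        using z CI by (auto simp: N)
      from tube_lemma_right[OF op C _ this] z
      obtain V V' where V: "openin Z V" "z \<in> V" "C \<subseteq> V'"
        "V \<times> V' \<subseteq> {p \<in> topspace (prod_topology Z (interval_top l)). (\<lambda>(z, t). f z t) p \<in> U}" by auto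
      have "f z' \<in> N \<and> z' \<in> topspace Z" if "z' \<in> V" for z'
      proof -
        have "z' \<in> topspace Z" using that openin_subset[OF V(1)] by blast
        moreover have "f z' t \<in> U" if "t \<in> C" for t
          using V(3) V(4)[THEN subsetD, of "(z', t)"] that \<open>z' \<in> V\<close> by auto
        ultimately show ?thesis using fz ext by (auto simp: N)
      qed
      then show ?thesis using V(1,2) by (intro exI[of _ V]) auto
    qed
    then show "openin Z (f -` N \<inter> topspace Z)" by (subst openin_subopen) blast
  qed
qed

section \<open>Functions on the geometric realization\<close>

definition face_invariant :: "(nat \<Rightarrow> 'c set) \<Rightarrow> (nat \<Rightarrow> nat \<Rightarrow> bool \<Rightarrow> 'c \<Rightarrow> 'c) \<Rightarrow> ('c elt \<Rightarrow> 'b) \<Rightarrow> bool" where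
  "face_invariant K d f \<longleftrightarrow> (\<forall>n i a c u. c \<in> K (Suc n) \<and> i \<le> n \<and> u \<in> cube n \<longrightarrow>
     f (n, d (Suc n) i a c, u) = f (Suc n, c, cface (Suc n) i a u))"

definition repr :: "(nat \<Rightarrow> 'c set) \<Rightarrow> (nat \<Rightarrow> nat \<Rightarrow> bool \<Rightarrow> 'c \<Rightarrow> 'c) \<Rightarrow> 'c point \<Rightarrow> 'c elt" where
  "repr K d p = (SOME x. x \<in> real_elts K \<and> real_class K d x = p)"

text \<open>Points of the realization are equivalence classes, and a function on them is given by
  evaluation at a chosen representative. Independence of the choice is
  \<open>face_invariant\<close>, to be checked for each function.\<close>

definition descend :: "(nat \<Rightarrow> 'c set) \<Rightarrow> (nat \<Rightarrow> nat \<Rightarrow> bool \<Rightarrow> 'c \<Rightarrow> 'c) \<Rightarrow> ('c elt \<Rightarrow> 'b) \<Rightarrow> 'c point \<Rightarrow> 'b" where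
  "descend K d f p = f (repr K d p)"

definition phi :: "(nat \<Rightarrow> 'c set) \<Rightarrow> (nat \<Rightarrow> nat \<Rightarrow> bool \<Rightarrow> 'c \<Rightarrow> 'c) \<Rightarrow> (real \<Rightarrow> real) \<Rightarrow> 'c point \<Rightarrow> 'c point" where
  "phi K d h = descend K d (\<lambda>(n, c, u). real_cell K d n c (\<lambda>k. h (u k)))"

text \<open>The sum of the coordinates does not descend to the realization, since passing to a face
  at 1 lowers it by 1. Its change under h does, because \<open>h x - x\<close> vanishes at 0 and 1.
  This is the real number by which h changes lengths.\<close>

definition excess :: "(nat \<Rightarrow> 'c set) \<Rightarrow> (nat \<Rightarrow> nat \<Rightarrow> bool \<Rightarrow> 'c \<Rightarrow> 'c) \<Rightarrow> (real \<Rightarrow> real) \<Rightarrow> 'c point \<Rightarrow> real" where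
  "excess K d h = descend K d (\<lambda>(n, c, u). \<Sum>k<n. h (u k) - u k)"

text \<open>The sum of the coordinates is well defined modulo 1.\<close>
definition turn :: "(nat \<Rightarrow> 'c set) \<Rightarrow> (nat \<Rightarrow> nat \<Rightarrow> bool \<Rightarrow> 'c \<Rightarrow> 'c) \<Rightarrow> 'c point \<Rightarrow> complex" where
  "turn K d = descend K d (\<lambda>(n, c, u). cis (2 * pi * (\<Sum>k<n. u k)))"

definition is_vertex :: "(nat \<Rightarrow> 'c set) \<Rightarrow> (nat \<Rightarrow> nat \<Rightarrow> bool \<Rightarrow> 'c \<Rightarrow> 'c) \<Rightarrow> 'c point \<Rightarrow> bool" where
  "is_vertex K d = descend K d (\<lambda>(n, c, u). \<forall>k<n. u k \<in> {0, 1})"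

lemma real_class_eq_imp_rel:
  assumes "real_class K d x = real_class K d y"
  shows "(x, y) \<in> (real_rel K d \<union> (real_rel K d)\<inverse>)\<^sup>*"
proof -
  have "y \<in> real_class K d x" unfolding assms by (simp add: real_class_def)
  then show ?thesis by (simp add: real_class_def)
qed

lemma real_class_eq_invariant:
  assumes "real_class K d x = real_class K d y" and f: "face_invariant K d f"
  shows "f x = f y"
  using real_class_eq_imp_rel[OF assms(1)]
proof (induction rule: rtrancl_induct)
  case (step y z)
  then show ?case using f by (auto simp: real_rel_def face_invariant_def)
qed simp

lemma real_class_face:
  assumes "c \<in> K (Suc n)" "i \<le> n" "u \<in> cube n"
  shows "real_cell K d n (d (Suc n) i a c) u = real_cell K d (Suc n) c (cface (Suc n) i a u)"
proof -
  let ?R = "real_rel K d \<union> (real_rel K d)\<inverse>"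
  have "((n, d (Suc n) i a c, u), (Suc n, c, cface (Suc n) i a u)) \<in> ?R"
    using assms by (auto simp: real_rel_def)
  moreover have "sym (?R\<^sup>*)" by (intro sym_rtrancl) (auto simp: sym_def)
  ultimately show ?thesis
    unfolding real_cell_def real_class_def
    by (auto dest: symD intro: rtrancl_trans r_into_rtrancl)
qed

lemma repr_cell:
  assumes "c \<in> K n" "u \<in> cube n"
  shows "repr K d (real_cell K d n c u) \<in> real_elts K"
    "real_class K d (repr K d (real_cell K d n c u)) = real_class K d (n, c, u)"
proof -
  have "\<exists>x. x \<in> real_elts K \<and> real_class K d x = real_cell K d n c u"
    using assms by (auto simp: real_elts_def real_cell_def)
  from someI_ex[OF this]
  show "repr K d (real_cell K d n c u) \<in> real_elts K"
    "real_class K d (repr K d (real_cell K d n c u)) = real_class K d (n, c, u)"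
    by (auto simp: repr_def real_cell_def)
qed

lemma descend_cell:
  assumes "face_invariant K d f" "c \<in> K n" "u \<in> cube n"
  shows "descend K d f (real_cell K d n c u) = f (n, c, u)"
  unfolding descend_def using repr_cell(2)[of c K n u d] assms by (intro real_class_eq_invariant) auto

lemma geom_points_cases:
  assumes "p \<in> geom_points K d"
  obtains n c u where "c \<in> K n" "u \<in> cube n" "p = real_cell K d n c u"
  using assms by (auto simp: geom_points_def real_elts_def real_cell_def)

lemma real_cell_in_geom_points: "c \<in> K n \<Longrightarrow> u \<in> cube n \<Longrightarrow> real_cell K d n c u \<in> geom_points K d"
  by (auto simp: geom_points_def real_elts_def real_cell_def)

lemma cface_in_cube: "i \<le> n \<Longrightarrow> u \<in> cube n \<Longrightarrow> cface (Suc n) i a u \<in> cube (Suc n)"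
  by (auto simp: cube_def cface_def)

lemma cube_comp:
  assumes "\<And>x. 0 \<le> x \<Longrightarrow> x \<le> 1 \<Longrightarrow> 0 \<le> h x \<and> h x \<le> 1" "h 0 = (0::real)" "u \<in> cube n"
  shows "(\<lambda>k. h (u k)) \<in> cube n"
  using assms by (auto simp: cube_def)

lemma cface_comp:
  assumes "h 0 = 0" "h 1 = (1::real)"
  shows "(\<lambda>k. h (cface (Suc n) i a u k)) = cface (Suc n) i a (\<lambda>k. h (u k))"
  using assms by (auto simp: cface_def)

lemma sum_cface:
  assumes i: "i \<le> n"
  shows "(\<Sum>k<Suc n. g (cface (Suc n) i a u k)) = (\<Sum>k<n. g (u k)) + (g (of_bool a) :: 'b::comm_monoid_add)"
proof -
  have "{..<Suc n} = insert i ({..<i} \<union> {i<..<Suc n})" using i by auto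
  then have "(\<Sum>k<Suc n. g (cface (Suc n) i a u k)) =
      g (cface (Suc n) i a u i) + (\<Sum>k\<in>{..<i} \<union> {i<..<Suc n}. g (cface (Suc n) i a u k))"
    by simp
  also have "(\<Sum>k\<in>{..<i} \<union> {i<..<Suc n}. g (cface (Suc n) i a u k)) =
      (\<Sum>k<i. g (cface (Suc n) i a u k)) + (\<Sum>k\<in>{i<..<Suc n}. g (cface (Suc n) i a u k))"
    by (rule sum.union_disjoint) auto
  also have "(\<Sum>k\<in>{i<..<Suc n}. g (cface (Suc n) i a u k)) = (\<Sum>k\<in>{i..<n}. g (u k))"
    by (rule sum.reindex_bij_witness[of _ Suc "\<lambda>k. k - 1"]) (auto simp: cface_def)
  also have "(\<Sum>k<i. g (cface (Suc n) i a u k)) = (\<Sum>k<i. g (u k))"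
    by (rule sum.cong) (auto simp: cface_def)
  also have "(\<Sum>k<i. g (u k)) + (\<Sum>k\<in>{i..<n}. g (u k)) = (\<Sum>k<n. g (u k))"
    using i by (subst sum.union_disjoint[symmetric]) (auto intro: sum.cong)
  finally show ?thesis by (simp add: cface_def add.commute)
qed

definition unit_map :: "(real \<Rightarrow> real) \<Rightarrow> bool" where
  "unit_map h \<longleftrightarrow> h 0 = 0 \<and> h 1 = 1 \<and> (\<forall>x. 0 \<le> x \<and> x \<le> 1 \<longrightarrow> 0 \<le> h x \<and> h x \<le> 1)"

lemma unit_map_cube: "unit_map h \<Longrightarrow> u \<in> cube n \<Longrightarrow> (\<lambda>k. h (u k)) \<in> cube n"
  by (rule cube_comp) (auto simp: unit_map_def)

lemma phi_cell:
  assumes h: "unit_map h" and c: "c \<in> K n" and u: "u \<in> cube n"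
  shows "phi K d h (real_cell K d n c u) = real_cell K d n c (\<lambda>k. h (u k))"
  unfolding phi_def
proof (subst descend_cell[where K = K and d = d and n = n and c = c and u = u])
  show "face_invariant K d (\<lambda>(n, c, u). real_cell K d n c (\<lambda>k. h (u k)))"
    unfolding face_invariant_def using h
    by (auto simp: cface_comp real_class_face unit_map_cube unit_map_def[of h])
qed (use c u in simp_all)

lemma excess_cell:
  assumes h: "unit_map h" and c: "c \<in> K n" and u: "u \<in> cube n"
  shows "excess K d h (real_cell K d n c u) = (\<Sum>k<n. h (u k) - u k)"
  unfolding excess_def
proof (subst descend_cell[where K = K and d = d and n = n and c = c and u = u])
  show "face_invariant K d (\<lambda>(n, c, u). \<Sum>k<n. h (u k) - u k)"
    unfolding face_invariant_def using h sum_cface[where g = "\<lambda>x. h x - x"]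
    by (auto simp: unit_map_def simp del: sum.lessThan_Suc)
qed (use c u in simp_all)

lemma turn_cell:
  assumes c: "c \<in> K n" and u: "u \<in> cube n"
  shows "turn K d (real_cell K d n c u) = cis (2 * pi * (\<Sum>k<n. u k))"
  unfolding turn_def
proof (subst descend_cell[where K = K and d = d and n = n and c = c and u = u])
  have "cis (2 * pi * ((\<Sum>k<n. u k) + of_bool a)) = cis (2 * pi * (\<Sum>k<n. u k))" for n a and u :: "nat \<Rightarrow> real"
    by (auto simp: distrib_left simp flip: cis_mult)
  then show "face_invariant K d (\<lambda>(n, c, u). cis (2 * pi * (\<Sum>k<n. u k)))"
    unfolding face_invariant_def using sum_cface[where g = "\<lambda>x. x"]
    by (auto simp del: sum.lessThan_Suc)
qed (use c u in simp_all)

lemma is_vertex_cell: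
  assumes c: "c \<in> K n" and u: "u \<in> cube n"
  shows "is_vertex K d (real_cell K d n c u) \<longleftrightarrow> (\<forall>k<n. u k \<in> {0, 1})"
  unfolding is_vertex_def
proof (subst descend_cell[where K = K and d = d and n = n and c = c and u = u])
  have "(\<forall>k<Suc n. cface (Suc n) i a u k \<in> {0, 1}) \<longleftrightarrow> (\<forall>k<n. u k \<in> {0, 1})" (is "?L \<longleftrightarrow> ?R")
    if "i \<le> n" for n i a and u :: "nat \<Rightarrow> real"
  proof
    assume L: ?L
    show ?R
    proof (intro allI impI)
      fix k assume "k < n"
      then show "u k \<in> {0, 1}"
        using L[rule_format, of k] L[rule_format, of "Suc k"] that
        by (cases "k < i") (auto simp: cface_def split: if_splits)
    qed
  next
    assume R: ?R
    show ?L
    proof (intro allI impI)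
      fix k assume "k < Suc n"
      then show "cface (Suc n) i a u k \<in> {0, 1}"
        using R[rule_format, of k] R[rule_format, of "k - 1"] that
        by (cases "k < i"; cases "k = i") (auto simp: cface_def)
    qed
  qed
  then show "face_invariant K d (\<lambda>(n, c, u). \<forall>k<n. u k \<in> {0, 1})"
    unfolding face_invariant_def by auto
qed (use c u in simp_all)

lemma zero_in_cube: "(\<lambda>_. 0) \<in> cube n"
  by (simp add: cube_def)

lemma is_vertex_vertex: "c \<in> K 0 \<Longrightarrow> is_vertex K d (vertex K d c)"
  by (simp add: vertex_def is_vertex_cell zero_in_cube)

section \<open>The topology of the realization and continuity of the descended functions\<close>

lemma topspace_cube_top [simp]: "topspace (cube_top n) = cube n"
  by (simp add: cube_top_def)

lemma continuous_map_cube_top: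
  "continuous_map Z (cube_top n) g \<longleftrightarrow>
     (\<forall>z\<in>topspace Z. g z \<in> cube n) \<and> (\<forall>k<n. continuous_map Z euclideanreal (\<lambda>z. g z k))"
proof -
  have "continuous_map Z euclideanreal (\<lambda>z. g z k)" if "\<forall>z\<in>topspace Z. g z \<in> cube n" "\<not> k < n" for k
    by (rule continuous_map_eq[of _ _ "\<lambda>_. 0"]) (use that in \<open>auto simp: cube_def\<close>)
  then show ?thesis
    unfolding cube_top_def
    by (auto simp: continuous_map_in_subtopology continuous_map_componentwise_UNIV)
qed

lemma openin_geom_top:
  "openin (geom_top K d) V \<longleftrightarrow> V \<subseteq> geom_points K d \<and>
      (\<forall>n c. c \<in> K n \<longrightarrow> openin (cube_top n) {u \<in> cube n. real_cell K d n c u \<in> V})"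
proof -
  have "istopology (\<lambda>V. V \<subseteq> geom_points K d \<and>
      (\<forall>n c. c \<in> K n \<longrightarrow> openin (cube_top n) {u \<in> cube n. real_cell K d n c u \<in> V}))" (is "istopology ?P")
    unfolding istopology_def
  proof (intro conjI allI impI)
    fix S T assume "?P S" "?P T"
    moreover have "{u \<in> cube n. real_cell K d n c u \<in> S \<inter> T} =
      {u \<in> cube n. real_cell K d n c u \<in> S} \<inter> {u \<in> cube n. real_cell K d n c u \<in> T}" for n c by auto
    ultimately show "S \<inter> T \<subseteq> geom_points K d"
      "c \<in> K n \<Longrightarrow> openin (cube_top n) {u \<in> cube n. real_cell K d n c u \<in> S \<inter> T}" for n c
      by auto
  next
    fix \<K> assume K: "\<forall>S\<in>\<K>. ?P S"
    then show "\<Union>\<K> \<subseteq> geom_points K d" by auto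
    fix n c assume "c \<in> K n"
    moreover have "{u \<in> cube n. real_cell K d n c u \<in> \<Union>\<K>} = \<Union>((\<lambda>S. {u \<in> cube n. real_cell K d n c u \<in> S}) ` \<K>)" by auto
    ultimately show "openin (cube_top n) {u \<in> cube n. real_cell K d n c u \<in> \<Union>\<K>}"
      using K by (auto intro!: openin_Union)
  qed
  then show ?thesis unfolding geom_top_def by (simp add: topology_inverse')
qed

lemma topspace_geom_top [simp]: "topspace (geom_top K d) = geom_points K d"
proof -
  have "{u \<in> cube n. real_cell K d n c u \<in> geom_points K d} = topspace (cube_top n)" if "c \<in> K n" for n c
    using that by (auto intro: real_cell_in_geom_points)
  then have "openin (geom_top K d) (geom_points K d)"
    unfolding openin_geom_top using openin_topspace[of "cube_top _"] by (intro conjI allI impI order_refl) (simp only:)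
  then show ?thesis
    by (meson openin_geom_top openin_subset openin_topspace subset_antisym)
qed

lemma continuous_map_real_cell: "c \<in> K n \<Longrightarrow> continuous_map (cube_top n) (geom_top K d) (real_cell K d n c)"
  unfolding continuous_map_def by (auto simp: openin_geom_top intro: real_cell_in_geom_points)

text \<open>The realization has the final topology for the maps \<open>real_cell K d n c\<close>, so
  joint continuity in a parameter and a point can be tested cell by cell.\<close>

lemma continuous_map_prod_geom:
  fixes S :: "'p::heine_borel set"
  assumes S: "closed S" and cont: "\<And>n c. c \<in> K n \<Longrightarrow>
     continuous_map (prod_topology (top_of_set S) (cube_top n)) Y (\<lambda>(q, u). f (q, real_cell K d n c u))"
  shows "continuous_map (prod_topology (top_of_set S) (geom_top K d)) Y f"
proof (rule continuous_map_prod_final[where I = "{(n, c). c \<in> K n}" and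
      T = "\<lambda>(n, c). cube_top n" and \<sigma> = "\<lambda>(n, c). real_cell K d n c", OF S])
  fix U assume "U \<subseteq> topspace (geom_top K d)"
    "\<And>i. i \<in> {(n, c). c \<in> K n} \<Longrightarrow> openin (case i of (n, c) \<Rightarrow> cube_top n)
       {y \<in> topspace (case i of (n, c) \<Rightarrow> cube_top n). (case i of (n, c) \<Rightarrow> real_cell K d n c) y \<in> U}"
  then show "openin (geom_top K d) U" by (force simp: openin_geom_top)
next
  fix x assume "x \<in> topspace (geom_top K d)"
  then obtain n c u where "c \<in> K n" "u \<in> cube n" "x = real_cell K d n c u"
    by (auto elim: geom_points_cases)
  then show "\<exists>i\<in>{(n, c). c \<in> K n}. \<exists>y\<in>topspace (case i of (n, c) \<Rightarrow> cube_top n).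
      (case i of (n, c) \<Rightarrow> real_cell K d n c) y = x"
    by (intro bexI[of _ "(n, c)"]) auto
qed (auto intro: real_cell_in_geom_points cont)

lemma continuous_map_from_geom:
  assumes cont: "\<And>n c. c \<in> K n \<Longrightarrow> continuous_map (cube_top n) Y (\<lambda>u. f (real_cell K d n c u))"
  shows "continuous_map (geom_top K d) Y f"
proof -
  \<comment> \<open>A one-point parameter space makes the version without parameter an instance of
    the previous lemma.\<close>
  have *: "continuous_map (prod_topology (top_of_set {0::real}) (geom_top K d)) Y (f \<circ> snd)"
  proof (rule continuous_map_prod_geom)
    fix n c assume "c \<in> K n"
    from continuous_map_compose[OF continuous_map_snd cont[OF this], of "top_of_set {0::real}"]
    show "continuous_map (prod_topology (top_of_set {0::real}) (cube_top n)) Y (\<lambda>(q, u). (f \<circ> snd) (q, real_cell K d n c u))"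
      by (simp add: o_def case_prod_unfold)
  qed simp
  have "continuous_map (geom_top K d) (prod_topology (top_of_set {0::real}) (geom_top K d)) (\<lambda>x. (0, x))"
    by (simp add: continuous_map_pairwise o_def)
  from continuous_map_compose[OF this *] show ?thesis by (simp add: o_def)
qed

lemma continuous_map_param_coord:
  fixes S :: "'p::heine_borel set" and h :: "'p \<Rightarrow> real \<Rightarrow> real"
  assumes h: "continuous_on (S \<times> {0..1}) (\<lambda>(q, x). h q x)" and k: "k < n"
  shows "continuous_map (prod_topology (top_of_set S) (cube_top n)) euclideanreal (\<lambda>(q, u). h q (u k))"
proof -
  have "continuous_map (cube_top n) euclideanreal (\<lambda>u. u k)"
    unfolding cube_top_def by (intro continuous_map_from_subtopology continuous_map_product_projection) simp
  then have "continuous_map (prod_topology (top_of_set S) (cube_top n)) euclideanreal (\<lambda>z. snd z k)"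
    using continuous_map_compose[OF continuous_map_snd] by (fastforce simp: o_def)
  moreover have "continuous_map (prod_topology (top_of_set S) (cube_top n)) euclidean fst"
    using continuous_map_fst[of "top_of_set S" "cube_top n"] continuous_map_into_fulltopology by blast
  ultimately have "continuous_map (prod_topology (top_of_set S) (cube_top n)) (prod_topology euclidean euclidean)
      (\<lambda>(q, u). (q, u k))"
    by (simp only: continuous_map_pairwise) (simp add: o_def case_prod_unfold)
  then have "continuous_map (prod_topology (top_of_set S) (cube_top n)) (top_of_set (S \<times> {0..1})) (\<lambda>(q, u). (q, u k))"
    using k by (auto simp: continuous_map_in_subtopology euclidean_product_topology cube_def)
  moreover have "continuous_map (top_of_set (S \<times> {0..1})) euclideanreal (\<lambda>(q, x). h q x)"
    using h by simp
  ultimately have "continuous_map (prod_topology (top_of_set S) (cube_top n)) euclideanreal ((\<lambda>(q, x). h q x) \<circ> (\<lambda>(q, u). (q, u k)))"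
    by (rule continuous_map_compose)
  then show ?thesis by (simp add: o_def case_prod_unfold)
qed

lemma continuous_map_phi:
  fixes S :: "'p::heine_borel set" and h :: "'p \<Rightarrow> real \<Rightarrow> real"
  assumes S: "closed S" and h: "continuous_on (S \<times> {0..1}) (\<lambda>(q, x). h q x)"
    and um: "\<And>q. q \<in> S \<Longrightarrow> unit_map (h q)"
  shows "continuous_map (prod_topology (top_of_set S) (geom_top K d)) (geom_top K d) (\<lambda>(q, p). phi K d (h q) p)"
proof (rule continuous_map_prod_geom[OF S])
  fix n c assume c: "c \<in> K n"
  have "continuous_map (prod_topology (top_of_set S) (cube_top n)) (cube_top n) (\<lambda>(q, u). \<lambda>k. h q (u k))"
    using unit_map_cube[OF um] continuous_map_param_coord[OF h]
    by (auto simp: continuous_map_cube_top case_prod_unfold)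
  from continuous_map_compose[OF this continuous_map_real_cell[of c K n d, OF c]]
  have "continuous_map (prod_topology (top_of_set S) (cube_top n)) (geom_top K d)
     (real_cell K d n c \<circ> (\<lambda>(q, u). \<lambda>k. h q (u k)))" .
  then show "continuous_map (prod_topology (top_of_set S) (cube_top n)) (geom_top K d)
     (\<lambda>(q, u). (\<lambda>(q, p). phi K d (h q) p) (q, real_cell K d n c u))"
    by (rule continuous_map_eq) (auto simp: phi_cell um c)
qed

lemma continuous_map_excess:
  fixes S :: "'p::heine_borel set" and h :: "'p \<Rightarrow> real \<Rightarrow> real"
  assumes S: "closed S" and h: "continuous_on (S \<times> {0..1}) (\<lambda>(q, x). h q x)"
    and um: "\<And>q. q \<in> S \<Longrightarrow> unit_map (h q)"
  shows "continuous_map (prod_topology (top_of_set S) (geom_top K d)) euclideanreal (\<lambda>(q, p). excess K d (h q) p)"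
proof (rule continuous_map_prod_geom[OF S])
  fix n c assume c: "c \<in> K n"
  have i: "continuous_on (S \<times> {0..1}) (\<lambda>(q, x). x)" by (simp add: case_prod_unfold continuous_on_snd)
  have "continuous_map (prod_topology (top_of_set S) (cube_top n)) euclideanreal
     (\<lambda>z. \<Sum>k<n. h (fst z) (snd z k) - snd z k)"
    using continuous_map_param_coord[OF h, of _ n] continuous_map_param_coord[OF i, of _ n]
    by (auto simp: case_prod_unfold intro!: continuous_map_sum continuous_map_diff)
  then show "continuous_map (prod_topology (top_of_set S) (cube_top n)) euclideanreal
     (\<lambda>(q, u). (\<lambda>(q, p). excess K d (h q) p) (q, real_cell K d n c u))"
    by (rule continuous_map_eq) (auto simp: excess_cell um c)
qed

lemma continuous_map_turn: "continuous_map (geom_top K d) euclidean (turn K d)"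
proof (rule continuous_map_from_geom)
  fix n c assume c: "c \<in> K n"
  have "continuous_map (cube_top n) euclideanreal (\<lambda>u. \<Sum>k<n. u k)"
    unfolding cube_top_def
    by (intro continuous_map_sum continuous_map_from_subtopology continuous_map_product_projection) auto
  moreover have "continuous_map euclideanreal euclidean (\<lambda>x. cis (2 * pi * x))"
    by (auto intro!: continuous_intros)
  ultimately have "continuous_map (cube_top n) euclidean ((\<lambda>x. cis (2 * pi * x)) \<circ> (\<lambda>u. \<Sum>k<n. u k))"
    by (rule continuous_map_compose)
  then show "continuous_map (cube_top n) euclidean (\<lambda>u. turn K d (real_cell K d n c u))"
    by (rule continuous_map_eq) (auto simp: turn_cell c)
qed

text \<open>Both sides measure how far h moves the sum of the coordinates. Consequently length plus
  excess is a lift of \<open>turn\<close> along a deformed path.\<close>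

lemma turn_phi:
  assumes "unit_map h" "p \<in> geom_points K d"
  shows "turn K d (phi K d h p) = turn K d p * cis (2 * pi * excess K d h p)"
proof -
  obtain n c u where p: "c \<in> K n" "u \<in> cube n" "p = real_cell K d n c u"
    using assms(2) by (rule geom_points_cases)
  have "2 * pi * (\<Sum>k<n. u k) + 2 * pi * (\<Sum>k<n. h (u k) - u k) = 2 * pi * (\<Sum>k<n. h (u k))"
    by (simp only: sum_subtractf) (simp add: algebra_simps)
  then show ?thesis
    unfolding p(3) phi_cell[where n = n and K = K, OF assms(1) p(1,2)] excess_cell[where n = n and K = K, OF assms(1) p(1,2)]
      turn_cell[where n = n and K = K, OF p(1) p(2)] turn_cell[where n = n and K = K, OF p(1) unit_map_cube[OF assms(1) p(2)]]
    by (simp only: cis_mult)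
qed

lemma phi_excess_id:
  assumes h: "\<And>x. h x = x" and "p \<in> geom_points K d"
  shows "phi K d h p = p" "excess K d h p = 0"
proof -
  obtain n c u where p: "c \<in> K n" "u \<in> cube n" "p = real_cell K d n c u"
    using assms(2) by (rule geom_points_cases)
  have um: "unit_map h" by (simp add: unit_map_def h)
  show "phi K d h p = p" "excess K d h p = 0"
    unfolding p(3) phi_cell[where n = n and K = K, OF um p(1,2)] excess_cell[where n = n and K = K, OF um p(1,2)] by (simp_all add: h)
qed

section \<open>Directed paths as chains of segments\<close>

text \<open>The coordinates u belong to the data: \<open>real_cell K d n c\<close> need not be
  injective, so p does not determine them.\<close>

definition seg :: "(nat \<Rightarrow> 'c set) \<Rightarrow> (nat \<Rightarrow> nat \<Rightarrow> bool \<Rightarrow> 'c \<Rightarrow> 'c) \<Rightarrow> bool \<Rightarrow> (real \<Rightarrow> 'c point) \<Rightarrow> real \<Rightarrow> real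
    \<Rightarrow> nat \<Rightarrow> 'c \<Rightarrow> (real \<Rightarrow> nat \<Rightarrow> real) \<Rightarrow> bool" where
  "seg K d tm p a b n c u \<longleftrightarrow> a \<le> b \<and> c \<in> K n \<and>
     (\<forall>t\<in>{a..b}. u t \<in> cube n \<and> p t = real_cell K d n c (u t)) \<and>
     (\<forall>k<n. continuous_on {a..b} (\<lambda>t. u t k) \<and> mono_on {a..b} (\<lambda>t. u t k)) \<and>
     (tm \<longrightarrow> (\<forall>k<n. u a k \<in> {0, 1} \<and> u b k \<in> {0, 1}))"

text \<open>In contrast to the Moore compositions in dpath, pieces of length zero are allowed.\<close>
inductive chain :: "(nat \<Rightarrow> 'c set) \<Rightarrow> (nat \<Rightarrow> nat \<Rightarrow> bool \<Rightarrow> 'c \<Rightarrow> 'c) \<Rightarrow> bool \<Rightarrow> (real \<Rightarrow> 'c point) \<Rightarrow> real \<Rightarrow> real \<Rightarrow> bool"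
  for K d tm p where
  one: "seg K d tm p a b n c u \<Longrightarrow> chain K d tm p a b"
| snoc: "chain K d tm p a s \<Longrightarrow> seg K d tm p s b n c u \<Longrightarrow> chain K d tm p a b"

lemma segD:
  assumes "seg K d tm p a b n c u"
  shows "a \<le> b" "c \<in> K n" "\<And>t. t \<in> {a..b} \<Longrightarrow> u t \<in> cube n"
    "\<And>t. t \<in> {a..b} \<Longrightarrow> p t = real_cell K d n c (u t)"
    "\<And>k. k < n \<Longrightarrow> continuous_on {a..b} (\<lambda>t. u t k)"
    "\<And>k t t'. k < n \<Longrightarrow> a \<le> t \<Longrightarrow> t \<le> t' \<Longrightarrow> t' \<le> b \<Longrightarrow> u t k \<le> u t' k"
    "\<And>k. tm \<Longrightarrow> k < n \<Longrightarrow> u a k \<in> {0, 1} \<and> u b k \<in> {0, 1}"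
proof -
  show "u t k \<le> u t' k" if "k < n" "a \<le> t" "t \<le> t'" "t' \<le> b" for k t t'
  proof -
    have "mono_on {a..b} (\<lambda>t. u t k)" using assms that(1) unfolding seg_def by blast
    then show ?thesis using mono_onD[of "{a..b}" "\<lambda>t. u t k" t t'] that by auto
  qed
qed (use assms in \<open>unfold seg_def, blast+\<close>)

lemma segI:
  assumes "a \<le> b" "c \<in> K n" "\<And>t. t \<in> {a..b} \<Longrightarrow> u t \<in> cube n"
    "\<And>t. t \<in> {a..b} \<Longrightarrow> p t = real_cell K d n c (u t)"
    "\<And>k. k < n \<Longrightarrow> continuous_on {a..b} (\<lambda>t. u t k)"
    "\<And>k t t'. k < n \<Longrightarrow> a \<le> t \<Longrightarrow> t \<le> t' \<Longrightarrow> t' \<le> b \<Longrightarrow> u t k \<le> u t' k"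
    "\<And>k. tm \<Longrightarrow> k < n \<Longrightarrow> u a k \<in> {0, 1} \<and> u b k \<in> {0, 1}"
  shows "seg K d tm p a b n c u"
proof -
  have "mono_on {a..b} (\<lambda>t. u t k)" if "k < n" for k
    using assms(6)[OF that] by (intro mono_onI) auto
  then show ?thesis unfolding seg_def using assms(1-5,7) by blast
qed

lemma chain_le: "chain K d tm p a b \<Longrightarrow> a \<le> b"
  by (induction rule: chain.induct) (auto dest: segD(1))

lemma chain_append:
  assumes "chain K d tm p s b" "chain K d tm p a s"
  shows "chain K d tm p a b"
  using assms by (induction rule: chain.induct) (auto intro: chain.intros)

text \<open>The flag becomes False because the new end points need not be vertices.\<close>

lemma seg_restrict:
  assumes "seg K d tm p a b n c u" "a \<le> a'" "a' \<le> b'" "b' \<le> b"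
  shows "seg K d False p a' b' n c u"
proof -
  have sub: "{a'..b'} \<subseteq> {a..b}" using assms by auto
  show ?thesis
  proof (rule segI)
    fix k t t' assume "k < n" "a' \<le> t" "t \<le> t'" "t' \<le> b'"
    then show "u t k \<le> u t' k" using segD(6)[OF assms(1), of k t t'] assms by simp
  next
    fix k assume "k < n"
    then show "continuous_on {a'..b'} (\<lambda>t. u t k)"
      using segD(5)[OF assms(1)] sub by (blast intro: continuous_on_subset)
  qed (use segD(2,3,4)[OF assms(1)] assms sub in \<open>auto\<close>)
qed

lemma chain_restrict:
  assumes "chain K d tm p a b" "a \<le> a'" "a' \<le> b'" "b' \<le> b"
  shows "chain K d False p a' b'"
  using assms
proof (induction arbitrary: a' b' rule: chain.induct)
  case (one a b n c u)
  then show ?case by (blast intro: chain.one seg_restrict)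
next
  case (snoc a s b n c u)
  consider "b' \<le> s" | "s \<le> a'" | "a' \<le> s" "s \<le> b'" by linarith
  then show ?case
  proof cases
    case 1
    then show ?thesis using snoc by blast
  next
    case 2
    then show ?thesis using seg_restrict[OF snoc(2) 2 snoc(5,6)] by (blast intro: chain.one)
  next
    case 3
    have "seg K d False p s b' n c u" using seg_restrict[OF snoc(2) order_refl 3(2) snoc(6)] .
    moreover have "chain K d False p a' s" using snoc 3 by blast
    ultimately show ?thesis by (blast intro: chain.snoc)
  qed
qed

lemma seg_point: "seg K d tm p a b n c u \<Longrightarrow> t \<in> {a..b} \<Longrightarrow> p t \<in> geom_points K d"
  using segD(2,3,4)[of K d tm p a b n c u] real_cell_in_geom_points[of c K n "u t" d] by auto

lemma chain_point: "chain K d tm p a b \<Longrightarrow> t \<in> {a..b} \<Longrightarrow> p t \<in> geom_points K d"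
proof (induction rule: chain.induct)
  case (one a b n c u)
  then show ?case by (blast intro: seg_point)
next
  case (snoc a s b n c u)
  show ?case
  proof (cases "t \<le> s")
    case True then show ?thesis using snoc by simp
  next
    case False
    then have "t \<in> {s..b}" using snoc by simp
    then show ?thesis by (rule seg_point[OF snoc(2)])
  qed
qed

section \<open>Length as a real lift of the circle-valued function \<open>turn\<close>\<close>

lemma cis_constant:
  fixes h :: "real \<Rightarrow> real"
  assumes "continuous_on {a..b} h" "\<And>t. t \<in> {a..b} \<Longrightarrow> cis (2 * pi * h t) = w" "t \<in> {a..b}" "t' \<in> {a..b}"
  shows "h t = h t'"
proof -
  have int: "h x - h y \<in> \<int>" if "x \<in> {a..b}" "y \<in> {a..b}" for x y
  proof -
    have "cis (2 * pi * h x) = cis (2 * pi * h y)" using assms(2) that by simp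
    then have "cis (2 * pi * (h x - h y)) = 1"
      by (simp add: right_diff_distrib flip: cis_divide)
    then have "cos (2 * pi * (h x - h y)) = 1" by (metis cis.simps(1) one_complex.simps(1))
    then obtain m :: int where "2 * pi * (h x - h y) = of_int m * (2 * pi)"
      by (auto simp: cos_one_2pi_int)
    then have "(2 * pi) * (h x - h y) = (2 * pi) * of_int m" by (simp only: mult.commute)
    then have "h x - h y = of_int m" by (simp only: mult_cancel_left) simp
    then show ?thesis by simp
  qed
  have "h constant_on {a..b}"
  proof (rule continuous_discrete_range_constant[OF _ assms(1)])
    show "\<exists>e>0. \<forall>y. y \<in> {a..b} \<and> h y \<noteq> h x \<longrightarrow> e \<le> norm (h y - h x)" if "x \<in> {a..b}" for x
    proof (intro exI[of _ 1] conjI allI impI)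
      fix y assume y: "y \<in> {a..b} \<and> h y \<noteq> h x"
      then have "h y - h x \<in> \<int>" using int that by simp
      then obtain m :: int where "h y - h x = of_int m" by (rule Ints_cases)
      with y have "m \<noteq> 0" by auto
      then have "(1::real) \<le> \<bar>of_int m\<bar>" by linarith
      then show "1 \<le> norm (h y - h x)" by (simp add: \<open>h y - h x = of_int m\<close>)
    qed simp
  qed simp
  then show ?thesis using assms(3,4) unfolding constant_on_def by metis
qed

lemma turn_nonzero: "p \<in> geom_points K d \<Longrightarrow> turn K d p \<noteq> 0"
  by (erule geom_points_cases) (simp add: turn_cell)

text \<open>Only increments of L enter, so the same L serves on every subinterval without
  renormalization.\<close>

definition lift_on :: "(nat \<Rightarrow> 'c set) \<Rightarrow> (nat \<Rightarrow> nat \<Rightarrow> bool \<Rightarrow> 'c \<Rightarrow> 'c) \<Rightarrow> (real \<Rightarrow> 'c point) \<Rightarrow> (real \<Rightarrow> real) \<Rightarrow> real \<Rightarrow> real \<Rightarrow> bool" where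
  "lift_on K d p L a b \<longleftrightarrow> continuous_on {a..b} L \<and>
     (\<forall>t\<in>{a..b}. turn K d (p t) = turn K d (p a) * cis (2 * pi * (L t - L a)))"

lemma lift_onD:
  assumes "lift_on K d p L a b"
  shows "continuous_on {a..b} L"
    "\<And>t. t \<in> {a..b} \<Longrightarrow> turn K d (p t) = turn K d (p a) * cis (2 * pi * (L t - L a))"
  using assms unfolding lift_on_def by blast+

lemma lift_on_restrict:
  assumes L: "lift_on K d p L a b" and a: "a \<le> a'" "b' \<le> b"
  shows "lift_on K d p L a' b'"
  unfolding lift_on_def
proof (intro conjI ballI)
  show "continuous_on {a'..b'} L"
    using lift_onD(1)[OF L] by (rule continuous_on_subset) (use a in auto)
  fix t assume t: "t \<in> {a'..b'}"
  have 1: "turn K d (p t) = turn K d (p a) * cis (2 * pi * (L t - L a))"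
    by (rule lift_onD(2)[OF L]) (use a t in auto)
  have 2: "turn K d (p a') = turn K d (p a) * cis (2 * pi * (L a' - L a))"
    by (rule lift_onD(2)[OF L]) (use a t in auto)
  have "2 * pi * (L t - L a) = 2 * pi * (L a' - L a) + 2 * pi * (L t - L a')" by (simp add: algebra_simps)
  then show "turn K d (p t) = turn K d (p a') * cis (2 * pi * (L t - L a'))"
    unfolding 1 2 by (simp only: cis_mult[symmetric] mult.assoc)
qed

text \<open>L and the sum of the coordinates lift the same circle-valued function up to a constant
  factor, so their difference is constant by \<open>cis_constant\<close>.\<close>

lemma seg_length:
  assumes s: "seg K d tm p a b n c u" and L: "lift_on K d p L a b" and t: "t \<in> {a..b}" "t' \<in> {a..b}"
  shows "L t' - L t = (\<Sum>k<n. u t' k) - (\<Sum>k<n. u t k)"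
proof -
  let ?h = "\<lambda>t. L t - (\<Sum>k<n. u t k)"
  have L1: "cis (2 * pi * (\<Sum>k<n. u t k)) = turn K d (p a) * cis (2 * pi * (L t - L a))" if "t \<in> {a..b}" for t
    using lift_onD(2)[OF L that] segD(2)[OF s] segD(3,4)[OF s that] turn_cell[of c K n "u t" d] by simp
  have "a \<in> {a..b}" using t by auto
  then have nz: "turn K d (p a) \<noteq> 0" 
    by (intro turn_nonzero seg_point[OF s])
  have "cis (2 * pi * ?h t) = cis (2 * pi * L a) / turn K d (p a)" if "t \<in> {a..b}" for t
  proof -
    have "cis (2 * pi * ?h t) = cis (2 * pi * L t) / cis (2 * pi * (\<Sum>k<n. u t k))"
      by (simp only: cis_divide right_diff_distrib)
    also have "\<dots> = cis (2 * pi * L t) / cis (2 * pi * (L t - L a)) / turn K d (p a)"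
      unfolding L1[OF that] by simp
    also have "cis (2 * pi * L t) / cis (2 * pi * (L t - L a)) = cis (2 * pi * L a)"
      by (simp add: cis_divide algebra_simps)
    finally show ?thesis .
  qed
  moreover have "continuous_on {a..b} ?h"
    using lift_onD(1)[OF L] segD(5)[OF s] by (auto intro!: continuous_intros)
  ultimately have "?h t = ?h t'" using t by (intro cis_constant) auto
  then show ?thesis by simp
qed

lemma continuous_on_glue:
  fixes f g :: "real \<Rightarrow> real"
  assumes "continuous_on {a..s} f" "continuous_on {s..b} g" "f s = g s"
  shows "continuous_on {a..b} (\<lambda>t. if t \<le> s then f t else g t)"
  by (rule continuous_on_cases_le)
     (use assms in \<open>auto intro: continuous_on_subset\<close>)

lemma seg_turn:
  assumes "seg K d tm p a b n c u" "t \<in> {a..b}"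
  shows "turn K d (p t) = cis (2 * pi * (\<Sum>k<n. u t k))"
  using segD(2)[OF assms(1)] segD(3,4)[OF assms] turn_cell[of c K n "u t" d] by simp

lemma chain_lift_exists: "chain K d tm p a b \<Longrightarrow> \<exists>L. lift_on K d p L a b \<and> L a = 0"
proof (induction rule: chain.induct)
  case (one a b n c u)
  let ?L = "\<lambda>t. (\<Sum>k<n. u t k) - (\<Sum>k<n. u a k)"
  have "turn K d (p t) = turn K d (p a) * cis (2 * pi * (?L t - ?L a))" if "t \<in> {a..b}" for t
    using that by (simp add: seg_turn[OF one] cis_mult algebra_simps)
  moreover have "continuous_on {a..b} ?L"
    using segD(5)[OF one(1)] by (auto intro!: continuous_intros)
  ultimately have "lift_on K d p ?L a b" unfolding lift_on_def by blast
  then show ?case by (intro exI[of _ ?L]) simp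
next
  case (snoc a s b n c u)
  obtain L where L: "lift_on K d p L a s" "L a = 0" using snoc.IH by blast
  have as: "a \<le> s" using chain_le[OF snoc(1)] .
  define M where "M t = (if t \<le> s then L t else L s + ((\<Sum>k<n. u t k) - (\<Sum>k<n. u s k)))" for t
  have "continuous_on {a..b} M" unfolding M_def
  proof (rule continuous_on_glue)
    show "continuous_on {a..s} L" using lift_onD(1)[OF L(1)] .
    show "continuous_on {s..b} (\<lambda>t. L s + ((\<Sum>k<n. u t k) - (\<Sum>k<n. u s k)))"
      using segD(5)[OF snoc(2)] by (auto intro!: continuous_intros)
  qed simp
  moreover have Ma: "M a = 0" using as L(2) by (simp add: M_def)
  moreover have "turn K d (p t) = turn K d (p a) * cis (2 * pi * (M t - M a))" if t: "t \<in> {a..b}" for t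
  proof (cases "t \<le> s")
    case True
    then show ?thesis using lift_onD(2)[OF L(1), of t] t unfolding Ma L(2) by (simp add: M_def)
  next
    case False
    have 1: "turn K d (p s) = turn K d (p a) * cis (2 * pi * L s)"
      using lift_onD(2)[OF L(1), of s] as unfolding L(2) by simp
    have "turn K d (p t) = turn K d (p s) * cis (2 * pi * ((\<Sum>k<n. u t k) - (\<Sum>k<n. u s k)))"
      using seg_turn[OF snoc(2), of t] seg_turn[OF snoc(2), of s] False t
      by (simp add: cis_mult algebra_simps)
    also have "\<dots> = turn K d (p a) * cis (2 * pi * M t)"
      unfolding 1 mult.assoc cis_mult using False by (simp add: M_def distrib_left)
    finally show ?thesis by (simp add: Ma)
  qed
  ultimately show ?case unfolding lift_on_def by blast
qed

text \<open>The point is that u, and not just p, is constant on the fibres of r. On a fibre p is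
  constant, hence so is \<open>turn\<close>, hence so is the coordinate sum by
  \<open>cis_constant\<close>; nondecreasing coordinates with constant sum are constant. So u
  descends along r.\<close>

lemma seg_quot:
  assumes s: "seg K d tm p a b n c u" and r: "continuous_on {a..b} r"
    and mono: "\<And>t t'. a \<le> t \<Longrightarrow> t \<le> t' \<Longrightarrow> t' \<le> b \<Longrightarrow> r t \<le> r t'"
    and q: "\<And>t. t \<in> {a..b} \<Longrightarrow> q (r t) = p t"
  obtains v where "seg K d tm q (r a) (r b) n c v"
proof -
  have ab: "a \<le> b" using segD(1)[OF s] .
  have fib: "u t k = u t' k" if t: "a \<le> t" "t \<le> t'" "t' \<le> b" "r t = r t'" and k: "k < n" for t t' k
  proof -
    have px: "p x = p t" if "x \<in> {t..t'}" for x
    proof -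
      have "r x = r t" using mono[of t x] mono[of x t'] t that by auto
      then show ?thesis using q[of x] q[of t] t that by simp
    qed
    have c: "cis (2 * pi * (\<Sum>k<n. u x k)) = turn K d (p t)" if "x \<in> {t..t'}" for x
      using seg_turn[OF s, of x] px[OF that] that t by simp
    have "continuous_on {t..t'} (\<lambda>x. \<Sum>k<n. u x k)"
      by (intro continuous_on_sum continuous_on_subset[OF segD(5)[OF s]]) (use t in auto)
    then have eq: "(\<Sum>k<n. u t' k) - (\<Sum>k<n. u t k) = 0"
      using cis_constant[where h = "\<lambda>x. \<Sum>k<n. u x k" and a = t and b = t' and t = t and t' = t', OF _ c] t by simp
    have nn: "0 \<le> u t' k - u t k" if "k < n" for k
      using segD(6)[OF s that, of t t'] t by simp
    have "(\<Sum>k<n. u t' k - u t k) = 0" using eq by (simp add: sum_subtractf)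
    then have "\<forall>k\<in>{..<n}. u t' k - u t k = 0"
      by (subst (asm) sum_nonneg_eq_0_iff) (use nn in auto)
    then show ?thesis using k by simp
  qed
  have rfib: "u t k = u t' k" if "t \<in> {a..b}" "t' \<in> {a..b}" "r t = r t'" "k < n" for t t' k
  proof (cases "t \<le> t'")
    case True
    show ?thesis by (rule fib) (use that True in auto)
  next
    case False
    show ?thesis by (rule fib[symmetric]) (use that False in auto)
  qed
  have im: "r ` {a..b} = {r a..r b}"
  proof
    show "r ` {a..b} \<subseteq> {r a..r b}" using mono by auto
    show "{r a..r b} \<subseteq> r ` {a..b}"
    proof
      fix y assume "y \<in> {r a..r b}"
      then obtain x where "a \<le> x" "x \<le> b" "r x = y" using IVT'[of r a y b] r ab by auto
      then show "y \<in> r ` {a..b}" by auto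
    qed
  qed
  define sec where "sec y = (SOME t. t \<in> {a..b} \<and> r t = y)" for y
  have sec: "sec y \<in> {a..b}" "r (sec y) = y" if "y \<in> {r a..r b}" for y
  proof -
    have "\<exists>t. t \<in> {a..b} \<and> r t = y" using that im by (metis imageE)
    from someI_ex[OF this] show "sec y \<in> {a..b}" "r (sec y) = y" by (auto simp: sec_def)
  qed
  define v where "v y = u (sec y)" for y
  have vr: "v (r t) k = u t k" if "t \<in> {a..b}" "k < n" for t k
  proof -
    have "r t \<in> {r a..r b}" using im that by blast
    then show ?thesis unfolding v_def using sec that by (intro rfib) auto
  qed
  \<comment> \<open>The section \<open>sec\<close> need not be continuous. Continuity of v comes
    from that of u, since r is a surjection of a compact space onto a Hausdorff space.\<close>
  have quot: "quotient_map (top_of_set {a..b}) (top_of_set {r a..r b}) r"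
    by (rule continuous_imp_quotient_map)
       (use r im in \<open>auto simp: Hausdorff_space_euclidean Hausdorff_space_subtopology compact_space_subtopology\<close>)
  have "seg K d tm q (r a) (r b) n c v"
  proof (rule segI)
    show "r a \<le> r b" using mono[of a b] ab by simp
    show "c \<in> K n" using segD(2)[OF s] .
    fix y assume "y \<in> {r a..r b}"
    then show "v y \<in> cube n" "q y = real_cell K d n c (v y)"
      using sec[of y] segD(3,4)[OF s, of "sec y"] q[of "sec y"] by (auto simp: v_def)
  next
    fix k assume k: "k < n"
    have "continuous_on {a..b} (\<lambda>t. v (r t) k)"
      using segD(5)[OF s k] by (rule continuous_on_eq) (use vr k in auto)
    then have "continuous_map (top_of_set {a..b}) euclideanreal ((\<lambda>y. v y k) \<circ> r)"
      by (simp add: o_def)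
    from continuous_compose_quotient_map[OF quot this]
    show "continuous_on {r a..r b} (\<lambda>y. v y k)" by simp
  next
    fix k y y' assume k: "k < n" and y: "r a \<le> y" "y \<le> y'" "y' \<le> r b"
    show "v y k \<le> v y' k"
    proof (cases "sec y \<le> sec y'")
      case True
      then show ?thesis using sec[of y] sec[of y'] y segD(6)[OF s k, of "sec y" "sec y'"] by (auto simp: v_def)
    next
      case False
      then have "r (sec y') \<le> r (sec y)" using mono[of "sec y'" "sec y"] sec[of y] sec[of y'] y by simp
      then have "y = y'" using sec(2)[of y] sec(2)[of y'] y by simp
      then show ?thesis by simp
    qed
  next
    fix k assume "tm" "k < n"
    then show "v (r a) k \<in> {0, 1} \<and> v (r b) k \<in> {0, 1}"
      using vr[of a k] vr[of b k] segD(7)[OF s] ab by auto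
  qed
  then show ?thesis by (rule that)
qed

lemma chain_quot:
  assumes "chain K d tm p a b" "continuous_on {a..b} r"
    "\<And>t t'. a \<le> t \<Longrightarrow> t \<le> t' \<Longrightarrow> t' \<le> b \<Longrightarrow> r t \<le> r t'"
    "\<And>t. t \<in> {a..b} \<Longrightarrow> q (r t) = p t"
  shows "chain K d tm q (r a) (r b)"
  using assms
proof (induction rule: chain.induct)
  case (one a b n c u)
  then obtain v where "seg K d tm q (r a) (r b) n c v" by (rule seg_quot) auto
  then show ?case by (rule chain.one)
next
  case (snoc a s b n c u)
  have as: "a \<le> s" "s \<le> b" using chain_le[OF snoc(1)] segD(1)[OF snoc(2)] .
  have "chain K d tm q (r a) (r s)"
  proof (rule snoc.IH)
    show "continuous_on {a..s} r" using snoc(4) as by (auto intro: continuous_on_subset)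
  qed (use snoc(5,6) as in auto)
  moreover have "continuous_on {s..b} r" using snoc(4) as by (auto intro: continuous_on_subset)
  then obtain v where "seg K d tm q (r s) (r b) n c v"
    using snoc(5,6) as by (elim seg_quot[OF snoc(2), where q = q]) auto
  ultimately show ?case by (rule chain.snoc)
qed

lemma dpath_imp_chain:
  assumes "dpath K d tm l p"
  shows "0 < l \<and> chain K d tm p 0 l"
  using assms
proof (induction rule: dpath.induct)
  case (base n l g c p)
  then have "seg K d tm p 0 l n c g"
    by (auto simp: seg_def cube_dpath_def cube_tame_def continuous_map_cube_top)
  then show ?case using base by (auto simp: cube_dpath_def intro: chain.one)
next
  case (comp l1 p1 l2 p2 p)
  have l: "0 < l1" "0 < l2" and c: "chain K d tm p1 0 l1" "chain K d tm p2 0 l2" using comp.IH by auto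
  have "chain K d tm p 0 l1"
    using chain_quot[OF c(1), of "\<lambda>t. t" p] comp.hyps(4) l by (auto intro!: continuous_intros)
  moreover have "chain K d tm p (0 + l1) (l2 + l1)"
    using comp.hyps(3,4) l
    by (intro chain_quot[OF c(2), of "\<lambda>t. t + l1" p]) (auto intro!: continuous_intros)
  ultimately show ?case using l chain_append[of K d tm p l1 "l2 + l1" 0] by (simp add: add.commute)
qed

lemma seg_imp_dpath:
  assumes "seg K d tm p a b n c u" "a < b"
  shows "dpath K d tm (b - a) (\<lambda>t. p (a + t))"
proof (rule dpath.base)
  have cont: "continuous_on {0..b - a} (\<lambda>t. u (a + t) k)" if "k < n" for k
    by (rule continuous_on_compose2[OF segD(5)[OF assms(1) that]]) (auto intro!: continuous_intros)
  show "cube_dpath n (b - a) (\<lambda>t. u (a + t))"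
    unfolding cube_dpath_def continuous_map_cube_top
    using assms(2) cont segD(3)[OF assms(1)] segD(6)[OF assms(1)] by (auto intro!: mono_onI)
  show "tm \<longrightarrow> cube_tame n (b - a) (\<lambda>t. u (a + t))"
    using segD(7)[OF assms(1)] by (auto simp: cube_tame_def)
  show "c \<in> K n" using segD(2)[OF assms(1)] .
  show "\<forall>t\<in>{0..b - a}. p (a + t) = real_cell K d n c (u (a + t))"
    using segD(4)[OF assms(1)] by auto
qed

text \<open>Moore compositions have no pieces of length zero, so a degenerate last piece or a
  degenerate initial part is left out.\<close>

lemma chain_imp_dpath:
  assumes "chain K d tm p a b" "a < b"
  shows "dpath K d tm (b - a) (\<lambda>t. p (a + t))"
  using assms
proof (induction rule: chain.induct)
  case (one a b n c u)
  then show ?case by (rule seg_imp_dpath)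
next
  case (snoc a s b n c u)
  have as: "a \<le> s" "s \<le> b" using chain_le[OF snoc(1)] segD(1)[OF snoc(2)] .
  show ?case
  proof (cases "a = s \<or> s = b")
    case True
    then show ?thesis using snoc seg_imp_dpath[OF snoc(2)] by blast
  next
    case False
    have "dpath K d tm ((s - a) + (b - s)) (\<lambda>t. p (a + t))"
    proof (rule dpath.comp)
      show "dpath K d tm (s - a) (\<lambda>t. p (a + t))" using snoc False as by simp
      show "dpath K d tm (b - s) (\<lambda>t. p (s + t))" using seg_imp_dpath[OF snoc(2)] False as by simp
    qed (auto simp: algebra_simps)
    then show ?thesis by simp
  qed
qed

lemma dpath_iff_chain: "dpath K d tm l p \<longleftrightarrow> 0 < l \<and> chain K d tm p 0 l"
  using dpath_imp_chain[of K d tm l p] chain_imp_dpath[of K d tm p 0 l] by auto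

section \<open>Deformations of directed paths\<close>

text \<open>Monotonicity is required in time and coordinate jointly: then nondecreasing coordinates
  stay nondecreasing although the rescaling itself changes with time.\<close>

definition deformation :: "(real \<Rightarrow> real \<Rightarrow> real) \<Rightarrow> real \<Rightarrow> real \<Rightarrow> bool" where
  "deformation T a b \<longleftrightarrow> (\<forall>t\<in>{a..b}. unit_map (T t)) \<and>
     (\<forall>t t' x x'. a \<le> t \<and> t \<le> t' \<and> t' \<le> b \<and> 0 \<le> x \<and> x \<le> x' \<and> x' \<le> 1 \<longrightarrow> T t x \<le> T t' x') \<and>
     continuous_on ({a..b} \<times> {0..1}) (\<lambda>(t, x). T t x)"

lemma deformationD:
  assumes "deformation T a b"
  shows "\<And>t. t \<in> {a..b} \<Longrightarrow> unit_map (T t)"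
    "\<And>t t' x x'. a \<le> t \<Longrightarrow> t \<le> t' \<Longrightarrow> t' \<le> b \<Longrightarrow> 0 \<le> x \<Longrightarrow> x \<le> x' \<Longrightarrow> x' \<le> 1 \<Longrightarrow> T t x \<le> T t' x'"
    "continuous_on ({a..b} \<times> {0..1}) (\<lambda>(t, x). T t x)"
  using assms unfolding deformation_def by blast+

lemma deformation_restrict:
  assumes "deformation T a b" "a \<le> a'" "b' \<le> b"
  shows "deformation T a' b'"
  unfolding deformation_def
proof (intro conjI ballI allI impI)
  show "continuous_on ({a'..b'} \<times> {0..1}) (\<lambda>(t, x). T t x)"
    using deformationD(3)[OF assms(1)] by (rule continuous_on_subset) (use assms in auto)
  fix t t' x x' assume "a' \<le> t \<and> t \<le> t' \<and> t' \<le> b' \<and> 0 \<le> x \<and> x \<le> x' \<and> x' \<le> (1::real)"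
  then show "T t x \<le> T t' x'" using assms by (intro deformationD(2)[OF assms(1)]) auto
qed (use deformationD(1)[OF assms(1)] assms in auto)

lemma cube_coord: "u \<in> cube n \<Longrightarrow> 0 \<le> u k \<and> u k \<le> 1"
  by (cases "k < n") (auto simp: cube_def)

lemma deformation_coord_cont:
  assumes T: "deformation T a b" and u: "continuous_on {a..b} f" "\<And>t. t \<in> {a..b} \<Longrightarrow> 0 \<le> f t \<and> f t \<le> 1"
  shows "continuous_on {a..b} (\<lambda>t. T t (f t))"
proof -
  have "continuous_on {a..b} (\<lambda>t. (\<lambda>(t, x). T t x) (t, f t))"
    by (rule continuous_on_compose2[OF deformationD(3)[OF T]]) (use u in \<open>auto intro!: continuous_intros\<close>)
  then show ?thesis by simp
qed

lemma seg_deform: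
  assumes s: "seg K d tm p a b n c u" and T: "deformation T a b"
  shows "seg K d tm (\<lambda>t. phi K d (T t) (p t)) a b n c (\<lambda>t k. T t (u t k))"
proof (rule segI)
  show "a \<le> b" "c \<in> K n" using segD(1,2)[OF s] by auto
  fix t assume t: "t \<in> {a..b}"
  show "(\<lambda>k. T t (u t k)) \<in> cube n"
    by (rule unit_map_cube[OF deformationD(1)[OF T t] segD(3)[OF s t]])
  show "phi K d (T t) (p t) = real_cell K d n c (\<lambda>k. T t (u t k))"
    unfolding segD(4)[OF s t]
    by (rule phi_cell) (use deformationD(1)[OF T t] segD(2)[OF s] segD(3)[OF s t] in auto)
next
  fix k assume k: "k < n"
  show "continuous_on {a..b} (\<lambda>t. T t (u t k))"
    by (rule deformation_coord_cont[OF T segD(5)[OF s k]]) (use cube_coord segD(3)[OF s] in blast)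
next
  fix k t t' assume k: "k < n" and t: "a \<le> t" "t \<le> t'" "t' \<le> b"
  show "T t (u t k) \<le> T t' (u t' k)"
    using cube_coord[of "u t" n k] cube_coord[of "u t'" n k] segD(3)[OF s, of t] segD(3)[OF s, of t'] t
    by (intro deformationD(2)[OF T] segD(6)[OF s k]) auto
next
  fix k assume tm and k: "k < n"
  have "unit_map (T a)" "unit_map (T b)" using deformationD(1)[OF T] segD(1)[OF s] by auto
  then show "T a (u a k) \<in> {0, 1} \<and> T b (u b k) \<in> {0, 1}"
    using segD(7)[OF s \<open>tm\<close> k] unfolding unit_map_def by auto
qed

lemma seg_deform_length:
  assumes s: "seg K d tm p a b n c u" and T: "deformation T a b" and L: "lift_on K d p L a b"
    and t: "t \<in> {a..b}" and t': "t' \<in> {a..b}"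
  shows "(L t' + excess K d (T t') (p t')) - (L t + excess K d (T t) (p t)) =
     (\<Sum>k<n. T t' (u t' k)) - (\<Sum>k<n. T t (u t k))"
proof -
  have ex: "excess K d (T t) (p t) = (\<Sum>k<n. T t (u t k)) - (\<Sum>k<n. u t k)" if "t \<in> {a..b}" for t
  proof -
    have "excess K d (T t) (real_cell K d n c (u t)) = (\<Sum>k<n. T t (u t k) - u t k)"
      by (rule excess_cell) (use deformationD(1)[OF T that] segD(2)[OF s] segD(3)[OF s that] in auto)
    then show ?thesis unfolding segD(4)[OF s that] by (simp add: sum_subtractf)
  qed
  show ?thesis using ex[OF t] ex[OF t'] seg_length[OF s L t t'] by linarith
qed

lemma chain_deform:
  assumes "chain K d tm p a b" "deformation T a b"
  shows "chain K d tm (\<lambda>t. phi K d (T t) (p t)) a b"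
  using assms
proof (induction rule: chain.induct)
  case (one a b n c u)
  then show ?case by (blast intro: chain.one seg_deform)
next
  case (snoc a s b n c u)
  have as: "a \<le> s" "s \<le> b" using chain_le[OF snoc(1)] segD(1)[OF snoc(2)] .
  have "deformation T a s" "deformation T s b"
    using deformation_restrict[OF snoc(4)] as by auto
  then show ?case using snoc(3) seg_deform[OF snoc(2)] by (blast intro: chain.snoc)
qed

lemma continuous_on_append:
  fixes f :: "real \<Rightarrow> real"
  assumes "continuous_on {a..s} f" "continuous_on {s..b} f" "a \<le> s" "s \<le> b"
  shows "continuous_on {a..b} f"
proof -
  have "continuous_on ({a..s} \<union> {s..b}) f"
    by (rule continuous_on_closed_Un) (use assms in auto)
  moreover have "{a..s} \<union> {s..b} = {a..b}" using assms by auto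
  ultimately show ?thesis by simp
qed

text \<open>The length of the deformed path up to time t is L t plus the excess at t.\<close>
definition dlen :: "(nat \<Rightarrow> 'c set) \<Rightarrow> (nat \<Rightarrow> nat \<Rightarrow> bool \<Rightarrow> 'c \<Rightarrow> 'c) \<Rightarrow> (real \<Rightarrow> 'c point) \<Rightarrow> (real \<Rightarrow> real)
    \<Rightarrow> (real \<Rightarrow> real \<Rightarrow> real) \<Rightarrow> real \<Rightarrow> real" where
  "dlen K d p L T t = L t + excess K d (T t) (p t)"

lemma seg_dlen:
  assumes s: "seg K d tm p a b n c u" and T: "deformation T a b" and L: "lift_on K d p L a b"
    and t: "t \<in> {a..b}" and t': "t' \<in> {a..b}"
  shows "dlen K d p L T t' = dlen K d p L T t + ((\<Sum>k<n. T t' (u t' k)) - (\<Sum>k<n. T t (u t k)))"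
  using seg_deform_length[OF assms] unfolding dlen_def by linarith

text \<open>It says that q factors through the nondecreasing parameter f. With f a length and q a
  path, this is what makes reparametrization by length possible.\<close>

definition fibre_mono :: "(real \<Rightarrow> real) \<Rightarrow> (real \<Rightarrow> 'x) \<Rightarrow> real \<Rightarrow> real \<Rightarrow> bool" where
  "fibre_mono f q a b \<longleftrightarrow> continuous_on {a..b} f \<and>
     (\<forall>t t'. a \<le> t \<and> t \<le> t' \<and> t' \<le> b \<longrightarrow> f t \<le> f t' \<and> (f t = f t' \<longrightarrow> q t = q t'))"

lemma fibre_monoD:
  assumes "fibre_mono f q a b"
  shows "continuous_on {a..b} f"
    "\<And>t t'. a \<le> t \<Longrightarrow> t \<le> t' \<Longrightarrow> t' \<le> b \<Longrightarrow> f t \<le> f t'"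
    "\<And>t t'. a \<le> t \<Longrightarrow> t \<le> t' \<Longrightarrow> t' \<le> b \<Longrightarrow> f t = f t' \<Longrightarrow> q t = q t'"
  using assms unfolding fibre_mono_def by blast+

lemma fibre_mono_append:
  assumes "fibre_mono f q a s" "fibre_mono f q s b" "a \<le> s" "s \<le> b"
  shows "fibre_mono f q a b"
  unfolding fibre_mono_def
proof (intro conjI allI impI)
  show "continuous_on {a..b} f"
    by (rule continuous_on_append[OF fibre_monoD(1)[OF assms(1)] fibre_monoD(1)[OF assms(2)] assms(3,4)])
  fix t t' assume t: "a \<le> t \<and> t \<le> t' \<and> t' \<le> b"
  have "f t \<le> f t' \<and> (f t = f t' \<longrightarrow> q t = q t')"
  proof -
    consider "t' \<le> s" | "s \<le> t" | "t \<le> s" "s \<le> t'" by linarith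
    then show ?thesis
    proof cases
      case 1 then show ?thesis using assms(1) t unfolding fibre_mono_def by blast
    next
      case 2 then show ?thesis using assms(2) t unfolding fibre_mono_def by blast
    next
      case 3
      have "f t \<le> f s" "f s \<le> f t'"
        using fibre_monoD(2)[OF assms(1), of t s] fibre_monoD(2)[OF assms(2), of s t'] t 3 by auto
      moreover have "q t = q t'" if "f t = f s" "f s = f t'"
        using fibre_monoD(3)[OF assms(1), of t s] fibre_monoD(3)[OF assms(2), of s t'] t 3 that by simp
      ultimately show ?thesis by auto
    qed
  qed
  then show "f t \<le> f t'" "f t = f t' \<Longrightarrow> q t = q t'" by auto
qed

text \<open>The increment of \<open>dlen\<close> is the sum of the increments of the deformed
  coordinates, which are nonnegative. If it is zero, all deformed coordinates agree at the two
  times, and so do the points.\<close>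

lemma seg_fibre_mono:
  assumes s: "seg K d tm p a b n c u" and T: "deformation T a b" and L: "lift_on K d p L a b"
  shows "fibre_mono (dlen K d p L T) (\<lambda>t. phi K d (T t) (p t)) a b"
  unfolding fibre_mono_def
proof (intro conjI allI impI)
  let ?len = "dlen K d p L T" and ?phi = "\<lambda>t. phi K d (T t) (p t)"
  have ab: "a \<le> b" using segD(1)[OF s] .
  have s': "seg K d tm ?phi a b n c (\<lambda>t k. T t (u t k))" by (rule seg_deform[OF s T])
  have "continuous_on {a..b} (\<lambda>t. ?len a + ((\<Sum>k<n. T t (u t k)) - (\<Sum>k<n. T a (u a k))))"
    by (intro continuous_intros) (use segD(5)[OF s'] in auto)
  then show "continuous_on {a..b} ?len"
    by (rule continuous_on_eq) (rule seg_dlen[OF s T L, symmetric], use ab in auto)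
  fix t t' assume t: "a \<le> t \<and> t \<le> t' \<and> t' \<le> b"
  have le: "T t (u t k) \<le> T t' (u t' k)" if "k < n" for k using segD(6)[OF s' that, of t t'] t by simp
  have dl: "?len t' = ?len t + ((\<Sum>k<n. T t' (u t' k)) - (\<Sum>k<n. T t (u t k)))"
    by (rule seg_dlen[OF s T L]) (use t in auto)
  have "(\<Sum>k<n. T t (u t k)) \<le> (\<Sum>k<n. T t' (u t' k))" by (rule sum_mono) (use le in auto)
  then show "?len t \<le> ?len t'" using dl by linarith
  assume "?len t = ?len t'"
  then have "(\<Sum>k<n. T t' (u t' k) - T t (u t k)) = 0" using dl by (simp add: sum_subtractf)
  then have eq: "\<forall>k\<in>{..<n}. T t' (u t' k) - T t (u t k) = 0"
    by (subst (asm) sum_nonneg_eq_0_iff) (use le in auto)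
  have tt: "t \<in> {a..b}" "t' \<in> {a..b}" using t by auto
  have "T t (u t k) = T t' (u t' k)" for k
    using eq segD(3)[OF s' tt(1)] segD(3)[OF s' tt(2)] by (cases "k < n") (auto simp: cube_def)
  then show "?phi t = ?phi t'"
    unfolding segD(4)[OF s' tt(1)] segD(4)[OF s' tt(2)] by simp
qed

lemma chain_fibre_mono:
  assumes "chain K d tm p a b" "deformation T a b" "lift_on K d p L a b"
  shows "fibre_mono (dlen K d p L T) (\<lambda>t. phi K d (T t) (p t)) a b"
  using assms
proof (induction rule: chain.induct)
  case (one a b n c u)
  then show ?case by (rule seg_fibre_mono)
next
  case (snoc a s b n c u)
  have as: "a \<le> s" "s \<le> b" using chain_le[OF snoc(1)] segD(1)[OF snoc(2)] .
  have T: "deformation T a s" "deformation T s b" using deformation_restrict[OF snoc(4)] as by auto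
  have L: "lift_on K d p L a s" "lift_on K d p L s b"
    using lift_on_restrict[OF snoc(5)] as by auto
  show ?case
    by (rule fibre_mono_append[OF snoc.IH[OF T(1) L(1)] seg_fibre_mono[OF snoc(2) T(2) L(2)] as])
qed

section \<open>Rewriting to faces by dropping coordinates close to 0 or 1\<close>

definition del :: "nat \<Rightarrow> (nat \<Rightarrow> real) \<Rightarrow> nat \<Rightarrow> real" where
  "del i u = (\<lambda>k. if k < i then u k else u (Suc k))"

definition ins :: "nat \<Rightarrow> real \<Rightarrow> (nat \<Rightarrow> real) \<Rightarrow> nat \<Rightarrow> real" where
  "ins i x u = (\<lambda>k. if k < i then u k else if k = i then x else u (k - 1))"

lemma del_cube: "i \<le> n \<Longrightarrow> u \<in> cube (Suc n) \<Longrightarrow> del i u \<in> cube n"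
  by (auto simp: del_def cube_def)

lemma ins_cube: "i \<le> n \<Longrightarrow> v \<in> cube n \<Longrightarrow> 0 \<le> x \<Longrightarrow> x \<le> 1 \<Longrightarrow> ins i x v \<in> cube (Suc n)"
  by (auto simp: ins_def cube_def)

lemma del_ins [simp]: "del i (ins i x v) = v"
  by (auto simp: ins_def del_def)

lemma ins_del [simp]: "ins i (u i) (del i u) = u"
proof
  show "ins i (u i) (del i u) k = u k" for k by (cases k) (auto simp: ins_def del_def)
qed

lemma del_del:
  assumes "i < j"
  shows "del i (del j u) = del (j - 1) (del i u)"
proof
  show "del i (del j u) k = del (j - 1) (del i u) k" for k using assms by (auto simp: del_def)
qed

lemma map_ins: "(\<lambda>k. h (ins i x v k)) = ins i (h x) (\<lambda>k. h (v k))"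
  by (auto simp: ins_def)

lemma cface_eq_ins: "i \<le> n \<Longrightarrow> v \<in> cube n \<Longrightarrow> cface (Suc n) i a v = ins i (of_bool a) v"
  by (auto simp: cface_def ins_def cube_def)

text \<open>A step does not preserve the point, only its image under functions that are 0 below lo
  and 1 above 5/8. When the dropped coordinate is exactly 0 or 1, a step is a generating
  identification of the realization, directed towards the smaller cube.\<close>

inductive drop_coord :: "(nat \<Rightarrow> 'c set) \<Rightarrow> (nat \<Rightarrow> nat \<Rightarrow> bool \<Rightarrow> 'c \<Rightarrow> 'c) \<Rightarrow> real \<Rightarrow> 'c elt \<Rightarrow> 'c elt \<Rightarrow> bool"
  for K d lo where
  "c \<in> K (Suc n) \<Longrightarrow> i \<le> n \<Longrightarrow> u \<in> cube (Suc n) \<Longrightarrow> (if a then 5 / 8 < u i else u i < lo) \<Longrightarrow>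
     drop_coord K d lo (Suc n, c, u) (n, d (Suc n) i a c, del i u)"

text \<open>Drops of two different coordinates can be carried out in either order, with the same
  result by the precubical identity. This is strong confluence, so no termination argument is
  involved.\<close>

lemma drop_coord_confluent:
  assumes pc: "precubical_set K d" and lo: "lo \<le> 5 / 8"
  shows "confluentp (drop_coord K d lo)"
proof (rule strong_confluentp_imp_confluentp, rule strong_confluentpI)
  let ?R = "drop_coord K d lo"
  have join: "\<exists>w. ?R (Suc m, d (Suc (Suc m)) i a c, del i u) w \<and> ?R (Suc m, d (Suc (Suc m)) j b c, del j u) w"
    if c: "c \<in> K (Suc (Suc m))" and ij: "i < j" "j \<le> Suc m" and u: "u \<in> cube (Suc (Suc m))"
      and a: "if a then 5 / 8 < u i else u i < lo" and b: "if b then 5 / 8 < u j else u j < lo"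
    for m c i j a b u
  proof -
    \<comment> \<open>After coordinate i < j has been removed, coordinate j sits at index j -
      1.\<close>
    have f: "d (Suc m) i a (d (Suc (Suc m)) j b c) = d (Suc m) (j - 1) b (d (Suc (Suc m)) i a c)"
      using pc c ij unfolding precubical_set_def by blast
    have k: "d (Suc (Suc m)) i a c \<in> K (Suc m)" "d (Suc (Suc m)) j b c \<in> K (Suc m)"
      using pc c ij unfolding precubical_set_def by auto
    have "?R (Suc m, d (Suc (Suc m)) i a c, del i u)
       (m, d (Suc m) (j - 1) b (d (Suc (Suc m)) i a c), del (j - 1) (del i u))"
      using ij b by (intro drop_coord.intros k(1) del_cube u) (auto simp: del_def)
    moreover have "?R (Suc m, d (Suc (Suc m)) j b c, del j u)
       (m, d (Suc m) i a (d (Suc (Suc m)) j b c), del i (del j u))"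
      using ij a by (intro drop_coord.intros k(2) del_cube u) (auto simp: del_def)
    ultimately show ?thesis using f del_del[OF ij(1), of u] by auto
  qed
  fix x y z assume "?R x y" "?R x z"
  then obtain n c u i j a b where x: "x = (Suc n, c, u)" "c \<in> K (Suc n)" "u \<in> cube (Suc n)"
    and i: "i \<le> n" "if a then 5 / 8 < u i else u i < lo" "y = (n, d (Suc n) i a c, del i u)"
    and j: "j \<le> n" "if b then 5 / 8 < u j else u j < lo" "z = (n, d (Suc n) j b c, del j u)"
    by (auto elim!: drop_coord.cases)
  show "\<exists>w. ?R\<^sup>*\<^sup>* y w \<and> ?R\<^sup>=\<^sup>= z w"
  proof (cases "i = j")
    case True
    \<comment> \<open>One coordinate cannot be dropped towards both ends, because
      \<open>lo \<le> 5 / 8\<close>.\<close>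
    then have "a = b" using i(2) j(2) lo by (auto split: if_splits)
    then show ?thesis using i j True by auto
  next
    case False
    then obtain m where n: "n = Suc m" using i(1) j(1) by (cases n) auto
    have "\<exists>w. ?R y w \<and> ?R z w"
    proof (cases "i < j")
      case True
      then show ?thesis using join[of c m i j u a b] x i j n by auto
    next
      case F: False
      then have "j < i" using False by simp
      then show ?thesis using join[of c m j i u b a] x i j n by auto
    qed
    then show ?thesis by blast
  qed
qed

lemma real_rel_drop_coord:
  assumes "(x, y) \<in> real_rel K d" "0 < lo"
  shows "drop_coord K d lo y x"
proof -
  obtain n i a c u where e: "x = (n, d (Suc n) i a c, u)" "y = (Suc n, c, cface (Suc n) i a u)"
    "c \<in> K (Suc n)" "i \<le> n" "u \<in> cube n"
    using assms(1) by (auto simp: real_rel_def)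
  have "drop_coord K d lo y (n, d (Suc n) i a c, del i (cface (Suc n) i a u))"
    unfolding e(2) using e assms(2)
    by (intro drop_coord.intros cface_in_cube) (auto simp: cface_def)
  then show ?thesis using e cface_eq_ins[OF e(4,5)] by simp
qed

text \<open>The chosen representative is the common reference through which different coordinates of
  the same point are compared.\<close>

lemma repr_drop_equiv:
  assumes "c \<in> K n" "u \<in> cube n" "0 < lo"
  shows "equivclp (drop_coord K d lo) (repr K d (real_cell K d n c u)) (n, c, u)"
proof -
  have "real_class K d (repr K d (real_cell K d n c u)) = real_class K d (n, c, u)"
    using repr_cell(2)[of c K n u d] assms by simp
  from real_class_eq_imp_rel[OF this] show ?thesis
  proof (induction rule: rtrancl_induct)
    case (step y z)
    have "equivclp (drop_coord K d lo) y z"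
      using step(2)
    proof
      assume "(y, z) \<in> real_rel K d"
      then show ?thesis
        using real_rel_drop_coord[OF _ assms(3)] by (blast intro: converse_r_into_equivclp)
    next
      assume "(y, z) \<in> (real_rel K d)\<inverse>"
      then have "(z, y) \<in> real_rel K d" by simp
      then show ?thesis
        using real_rel_drop_coord[OF _ assms(3)] by (blast intro: r_into_equivclp)
    qed
    with step(3) show ?case by (rule equivclp_trans)
  qed simp
qed

text \<open>The dropped coordinate is sent to 0 or 1 by h, so the image already lies on the face to
  which the step passes.\<close>

lemma drop_coord_phi:
  assumes "drop_coord K d lo (n, c, u) (m, e, v)" and h: "unit_map h"
    and lo: "\<And>x. 0 \<le> x \<Longrightarrow> x < lo \<Longrightarrow> h x = 0" and hi: "\<And>x. 5 / 8 < x \<Longrightarrow> x \<le> 1 \<Longrightarrow> h x = 1"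
  shows "real_cell K d n c (\<lambda>k. h (u k)) = real_cell K d m e (\<lambda>k. h (v k))"
  using assms(1)
proof (cases rule: drop_coord.cases)
  case (1 i a)
  have hv: "(\<lambda>k. h (v k)) \<in> cube m" using 1 by (intro unit_map_cube[OF h]) (auto intro: del_cube)
  have "h (u i) = of_bool a"
    using 1 lo[of "u i"] hi[of "u i"] cube_coord[of u "Suc m" i] by (auto split: if_splits)
  then have "(\<lambda>k. h (u k)) = ins i (of_bool a) (\<lambda>k. h (v k))"
    using map_ins[of h i "u i" v] 1 by simp
  then show ?thesis
    using 1 real_class_face[of c K m i "\<lambda>k. h (v k)" d a] hv cface_eq_ins[of i m "\<lambda>k. h (v k)" a] by simp
qed

lemma equiv_phi:
  assumes "equivclp (drop_coord K d lo) X Y" and h: "unit_map h"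
    and lo: "\<And>x. 0 \<le> x \<Longrightarrow> x < lo \<Longrightarrow> h x = 0" and hi: "\<And>x. 5 / 8 < x \<Longrightarrow> x \<le> 1 \<Longrightarrow> h x = 1"
  shows "(case X of (n, c, u) \<Rightarrow> real_cell K d n c (\<lambda>k. h (u k))) = (case Y of (n, c, u) \<Rightarrow> real_cell K d n c (\<lambda>k. h (u k)))"
  using assms(1)
proof (induction rule: equivclp_induct)
  case (step Y Z)
  obtain n c u m e v where "Y = (n, c, u)" "Z = (m, e, v)" by (metis prod_cases3)
  then show ?case using step drop_coord_phi[OF _ h lo hi] by fastforce
qed simp

section \<open>Short paths in a single cube\<close>

text \<open>No coordinate moves faster than the length L. This bounds how far a coordinate below the
  lower threshold can have risen at a later time.\<close>

definition slow_path :: "(real \<Rightarrow> real) \<Rightarrow> real \<Rightarrow> real \<Rightarrow> nat \<Rightarrow> (real \<Rightarrow> nat \<Rightarrow> real) \<Rightarrow> bool" where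
  "slow_path L a b n u \<longleftrightarrow> (\<forall>t\<in>{a..b}. u t \<in> cube n) \<and> (\<forall>k. continuous_on {a..b} (\<lambda>t. u t k)) \<and>
     (\<forall>k t t'. a \<le> t \<and> t \<le> t' \<and> t' \<le> b \<longrightarrow> u t k \<le> u t' k \<and> u t' k - u t k \<le> L t' - L t)"

lemma slow_pathD:
  assumes "slow_path L a b n u"
  shows "\<And>t. t \<in> {a..b} \<Longrightarrow> u t \<in> cube n" "\<And>k. continuous_on {a..b} (\<lambda>t. u t k)"
    "\<And>k t t'. a \<le> t \<Longrightarrow> t \<le> t' \<Longrightarrow> t' \<le> b \<Longrightarrow> u t k \<le> u t' k"
    "\<And>k t t'. a \<le> t \<Longrightarrow> t \<le> t' \<Longrightarrow> t' \<le> b \<Longrightarrow> u t' k - u t k \<le> L t' - L t"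
  using assms unfolding slow_path_def by blast+

lemma slow_path_del:
  assumes "slow_path L a b (Suc n) u" "i \<le> n"
  shows "slow_path L a b n (\<lambda>t. del i (u t))"
  unfolding slow_path_def
proof (intro conjI ballI allI impI)
  fix k
  show "continuous_on {a..b} (\<lambda>t. del i (u t) k)"
    unfolding del_def by (cases "k < i") (simp_all add: slow_pathD(2)[OF assms(1)])
  fix t t' assume "a \<le> t \<and> t \<le> t' \<and> t' \<le> b"
  then show "del i (u t) k \<le> del i (u t') k" "del i (u t') k - del i (u t) k \<le> L t' - L t"
    using slow_pathD(3,4)[OF assms(1)] by (auto simp: del_def)
qed (rule del_cube[OF assms(2) slow_pathD(1)[OF assms(1)]])

lemma slow_path_ins:
  assumes "slow_path L a b n u" "i \<le> n" "0 \<le> x" "x \<le> 1"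
    and L: "\<And>t t'. a \<le> t \<Longrightarrow> t \<le> t' \<Longrightarrow> t' \<le> b \<Longrightarrow> L t \<le> L t'"
  shows "slow_path L a b (Suc n) (\<lambda>t. ins i x (u t))"
  unfolding slow_path_def
proof (intro conjI ballI allI impI)
  fix k
  show "continuous_on {a..b} (\<lambda>t. ins i x (u t) k)"
    unfolding ins_def by (cases "k < i"; cases "k = i") (simp_all add: slow_pathD(2)[OF assms(1)])
  fix t t' assume t: "a \<le> t \<and> t \<le> t' \<and> t' \<le> b"
  then show "ins i x (u t) k \<le> ins i x (u t') k" "ins i x (u t') k - ins i x (u t) k \<le> L t' - L t"
    using slow_pathD(3,4)[OF assms(1)] L by (auto simp: ins_def)
qed (rule ins_cube[OF assms(2) slow_pathD(1)[OF assms(1)] assms(3,4)])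

text \<open>A drop that is possible at time s stays possible: a coordinate above 5/8 does not
  decrease, and a coordinate below \<open>lo s\<close> rises no faster than the threshold. So the
  whole rewriting sequence at time s is carried along the path.\<close>

lemma slow_path_down:
  assumes "(drop_coord K d (lo s))\<^sup>*\<^sup>* (n, c, u s) Y" and u: "slow_path L s b n u" and sb: "s \<le> b"
    and lo: "\<And>t. t \<in> {s..b} \<Longrightarrow> lo t = lo s + (L t - L s)"
  shows "\<exists>m e v. Y = (m, e, v s) \<and> slow_path L s b m v \<and>
     (\<forall>t\<in>{s..b}. (drop_coord K d (lo t))\<^sup>*\<^sup>* (n, c, u t) (m, e, v t))"
  using assms(1)
proof (induction rule: rtranclp_induct)
  case base
  show ?case using u by (intro exI[of _ n] exI[of _ c] exI[of _ u]) simp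
next
  case (step Y Z)
  then obtain m e v where Y: "Y = (m, e, v s)" and v: "slow_path L s b m v"
    and R: "\<And>t. t \<in> {s..b} \<Longrightarrow> (drop_coord K d (lo t))\<^sup>*\<^sup>* (n, c, u t) (m, e, v t)" by blast
  from step(2) Y obtain m' i a where m: "m = Suc m'" "Z = (m', d (Suc m') i a e, del i (v s))"
    "e \<in> K (Suc m')" "i \<le> m'" "if a then 5 / 8 < v s i else v s i < lo s"
    by (auto elim!: drop_coord.cases)
  have "(drop_coord K d (lo t))\<^sup>*\<^sup>* (n, c, u t) (m', d (Suc m') i a e, del i (v t))"
    if t: "t \<in> {s..b}" for t
  proof -
    have "if a then 5 / 8 < v t i else v t i < lo t"
      using m(5) slow_pathD(3,4)[OF v, of s t i] t lo[OF t] by (auto split: if_splits)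
    then have "drop_coord K d (lo t) (m, e, v t) (m', d (Suc m') i a e, del i (v t))"
      unfolding m(1) using slow_pathD(1)[OF v t] m by (intro drop_coord.intros) auto
    with R[OF t] show ?thesis by (rule rtranclp.rtrancl_into_rtrancl)
  qed
  then show ?case
    using slow_path_del[of L s b m' v i] v m
    by (intro exI[of _ m'] exI[of _ "d (Suc m') i a e"] exI[of _ "\<lambda>t. del i (v t)"]) simp
qed

text \<open>The converse transport, from the reduct back into the larger cube. The motion in the
  dropped directions may be chosen freely, since no step function sees it.\<close>

lemma slow_path_up:
  assumes "(drop_coord K d (lo s))\<^sup>*\<^sup>* X (m, e, v s)" and v: "slow_path L s b m v" and sb: "s \<le> b"
    and lo: "\<And>t. t \<in> {s..b} \<Longrightarrow> lo t = lo s + (L t - L s)"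
    and L: "\<And>t t'. s \<le> t \<Longrightarrow> t \<le> t' \<Longrightarrow> t' \<le> b \<Longrightarrow> L t \<le> L t'"
  shows "\<exists>n c u. X = (n, c, u s) \<and> slow_path L s b n u \<and>
     (\<forall>t\<in>{s..b}. (drop_coord K d (lo t))\<^sup>*\<^sup>* (n, c, u t) (m, e, v t))"
  using assms(1)
proof (induction rule: converse_rtranclp_induct)
  case base
  show ?case using v by (intro exI[of _ m] exI[of _ e] exI[of _ v]) simp
next
  case (step X Y)
  then obtain n c u where Y: "Y = (n, c, u s)" and u: "slow_path L s b n u"
    and R: "\<And>t. t \<in> {s..b} \<Longrightarrow> (drop_coord K d (lo t))\<^sup>*\<^sup>* (n, c, u t) (m, e, v t)" by blast
  from step(1) Y obtain c' w i a where X: "X = (Suc n, c', w)" "c = d (Suc n) i a c'" "u s = del i w"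
    "c' \<in> K (Suc n)" "i \<le> n" "w \<in> cube (Suc n)" "if a then 5 / 8 < w i else w i < lo s"
    by (auto elim!: drop_coord.cases)
  have w: "0 \<le> w i" "w i \<le> 1" using cube_coord[OF X(6)] by auto
  \<comment> \<open>The dropped coordinate is put back with its value at time s and kept there; the
    condition for dropping it persists because the threshold does not decrease.\<close>
  let ?u = "\<lambda>t. ins i (w i) (u t)"
  have u': "slow_path L s b (Suc n) ?u" by (rule slow_path_ins[OF u X(5) w L])
  have "(drop_coord K d (lo t))\<^sup>*\<^sup>* (Suc n, c', ?u t) (m, e, v t)" if t: "t \<in> {s..b}" for t
  proof -
    have "if a then 5 / 8 < ?u t i else ?u t i < lo t"
      using X(7) lo[OF t] L[of s t] t by (auto simp: ins_def split: if_splits)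
    then have "drop_coord K d (lo t) (Suc n, c', ?u t) (n, d (Suc n) i a c', del i (?u t))"
      by (intro drop_coord.intros X(4,5) slow_pathD(1)[OF u' t])
    then show ?thesis using R[OF t] unfolding del_ins X(2) by (rule converse_rtranclp_into_rtranclp)
  qed
  moreover have "X = (Suc n, c', ?u s)" using X by simp
  ultimately show ?case
    using u' by (intro exI[of _ "Suc n"] exI[of _ c'] exI[of _ ?u]) simp
qed

text \<open>A single coordinate gains at most what the sum of all gains, and that gain is the length
  by \<open>seg_length\<close>.\<close>

lemma seg_slow_path:
  assumes s: "seg K d tm p a b n c u" and L: "lift_on K d p L a b"
  shows "slow_path L a b n u"
  unfolding slow_path_def
proof (intro conjI allI impI ballI)
  fix k
  have z: "u t k = 0" if "t \<in> {a..b}" "\<not> k < n" for t k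
    using segD(3)[OF s that(1)] that(2) by (auto simp: cube_def)
  show "continuous_on {a..b} (\<lambda>t. u t k)"
  proof (cases "k < n")
    case False
    have "continuous_on {a..b} (\<lambda>t. 0::real)" by simp
    then show ?thesis by (rule continuous_on_eq) (use z False in auto)
  qed (rule segD(5)[OF s])
  fix t t' assume t: "a \<le> t \<and> t \<le> t' \<and> t' \<le> b"
  then have tt: "t \<in> {a..b}" "t' \<in> {a..b}" by auto
  have nn: "0 \<le> u t' k - u t k" for k
    using segD(6)[OF s, of k t t'] z[OF tt(1), of k] z[OF tt(2), of k] t by (cases "k < n") auto
  then show "u t k \<le> u t' k" by (simp add: diff_ge_0_iff_ge)
  have S: "L t' - L t = (\<Sum>k<n. u t' k - u t k)"
    using seg_length[OF s L tt] by (simp add: sum_subtractf)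
  show "u t' k - u t k \<le> L t' - L t"
  proof (cases "k < n")
    case True
    then show ?thesis unfolding S by (intro member_le_sum) (use nn in auto)
  next
    case False
    then have "u t' k - u t k = 0" using z[OF tt(1)] z[OF tt(2)] by simp
    then show ?thesis unfolding S using nn by (simp add: sum_nonneg)
  qed
qed (rule segD(3)[OF s])

lemma slow_path_append:
  assumes u: "slow_path L a s n u" and v: "slow_path L s b n v" and eq: "u s = v s" and as: "a \<le> s" "s \<le> b"
  shows "slow_path L a b n (\<lambda>t. if t \<le> s then u t else v t)" (is "slow_path L a b n ?w")
  unfolding slow_path_def
proof (intro conjI allI impI ballI)
  show "?w t \<in> cube n" if "t \<in> {a..b}" for t
    using slow_pathD(1)[OF u] slow_pathD(1)[OF v] that by auto
  fix k
  have "continuous_on {a..b} (\<lambda>t. if t \<le> s then u t k else v t k)"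
    by (rule continuous_on_glue[OF slow_pathD(2)[OF u] slow_pathD(2)[OF v]]) (simp add: eq)
  then show "continuous_on {a..b} (\<lambda>t. (if t \<le> s then u t else v t) k)" by (simp add: if_distribR)
  fix t t' assume t: "a \<le> t \<and> t \<le> t' \<and> t' \<le> b"
  consider "t' \<le> s" | "s < t" | "t \<le> s" "s < t'" by linarith
  then have "?w t k \<le> ?w t' k \<and> ?w t' k - ?w t k \<le> L t' - L t"
  proof cases
    case 1 then show ?thesis using slow_pathD(3,4)[OF u, of t t' k] t by simp
  next
    case 2 then show ?thesis using slow_pathD(3,4)[OF v, of t t' k] t by simp
  next
    case 3
    then show ?thesis
      using slow_pathD(3,4)[OF u, of t s k] slow_pathD(3,4)[OF v, of s t' k] t eq by simp
  qed
  then show "?w t k \<le> ?w t' k" "?w t' k - ?w t k \<le> L t' - L t" by auto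
qed

text \<open>The lower threshold grows with the length so that coordinates can only leave the cube that
  carries the start of the path, never enter it.\<close>
lemma chain_window:
  assumes pc: "precubical_set K d" and "chain K d tm p a b" "lift_on K d p L a b"
    "\<And>t t'. a \<le> t \<Longrightarrow> t \<le> t' \<Longrightarrow> t' \<le> b \<Longrightarrow> L t \<le> L t'" "L b - L a \<le> 1 / 8"
  shows "\<exists>m e x. e \<in> K m \<and> slow_path L a b m x \<and>
     (\<forall>t\<in>{a..b}. equivclp (drop_coord K d (1 / 4 + (L t - L a))) (repr K d (p t)) (m, e, x t))"
  using assms(2-5)
proof (induction rule: chain.induct)
  case (one a b n c u)
  note s = one(1) and L = one(2)
  have "equivclp (drop_coord K d (1 / 4 + (L t - L a))) (repr K d (p t)) (n, c, u t)" if t: "t \<in> {a..b}" for t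
    unfolding segD(4)[OF s t] using one(3)[of a t] t
    by (intro repr_drop_equiv segD(2)[OF s] segD(3)[OF s t]) auto
  then show ?case using seg_slow_path[OF s L] segD(2)[OF s] by blast
next
  case (snoc a s b n c u)
  have as: "a \<le> s" "s \<le> b" using chain_le[OF snoc(1)] segD(1)[OF snoc(2)] .
  note Lm = snoc(5)
  have L: "lift_on K d p L a s" "lift_on K d p L s b"
    using lift_on_restrict[OF snoc(4)] as by auto
  define lo where "lo t = 1 / 4 + (L t - L a)" for t
  have lo_rec: "lo t = lo s + (L t - L s)" for t by (simp add: lo_def)
  \<comment> \<open>The length budget of 1/8 is exactly what the threshold may rise from 1/4 to 3/8.
    It stays positive, so the identifications of the realization are drops, and below 5/8, so drops
    are confluent.\<close>
  have lo_bd: "1 / 4 \<le> lo t" "lo t \<le> 3 / 8" if "t \<in> {a..b}" for t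
    using Lm[of a t] Lm[of t b] snoc(6) that by (auto simp: lo_def)
  have "\<exists>m e x. e \<in> K m \<and> slow_path L a s m x \<and>
     (\<forall>t\<in>{a..s}. equivclp (drop_coord K d (1 / 4 + (L t - L a))) (repr K d (p t)) (m, e, x t))"
  proof (rule snoc.IH[OF L(1)])
    show "L t \<le> L t'" if "a \<le> t" "t \<le> t'" "t' \<le> s" for t t' using Lm[of t t'] that as by simp
    show "L s - L a \<le> 1 / 8" using Lm[of s b] snoc(6) as by simp
  qed
  then obtain m e x where e: "e \<in> K m" and x: "slow_path L a s m x"
    and xe: "\<And>t. t \<in> {a..s} \<Longrightarrow> equivclp (drop_coord K d (lo t)) (repr K d (p t)) (m, e, x t)"
    unfolding lo_def by blast
  have ue: "equivclp (drop_coord K d (lo t)) (repr K d (p t)) (n, c, u t)" if t: "t \<in> {s..b}" for t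
    unfolding segD(4)[OF snoc(2) t] using lo_bd[of t] t as
    by (intro repr_drop_equiv segD(2)[OF snoc(2)] segD(3)[OF snoc(2) t]) auto
  have "confluentp (drop_coord K d (lo s))"
    using lo_bd[of s] as by (intro drop_coord_confluent pc) auto
  moreover have "equivclp (drop_coord K d (lo s)) (n, c, u s) (m, e, x s)"
    using xe[of s] ue[of s] as by (auto intro: equivclp_trans equivclp_sym)
  \<comment> \<open>The window so far and the new piece give two descriptions of the point at time
    s; Z is a common reduct.\<close>
  ultimately obtain Z where Z: "(drop_coord K d (lo s))\<^sup>*\<^sup>* (n, c, u s) Z" "(drop_coord K d (lo s))\<^sup>*\<^sup>* (m, e, x s) Z"
    by (auto dest!: confluentp_imp_semiconfluentp semiconfluentp_equivclp simp: rtranclp_conversep)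
  from slow_path_down[OF Z(1) seg_slow_path[OF snoc(2) L(2)] as(2) lo_rec]
  obtain k f v where v: "Z = (k, f, v s)" "slow_path L s b k v"
    "\<And>t. t \<in> {s..b} \<Longrightarrow> (drop_coord K d (lo t))\<^sup>*\<^sup>* (n, c, u t) (k, f, v t)" by blast
  \<comment> \<open>Having been followed forward in the cube of the new piece, the reduct is lifted
    back to the cell e, so that one cell serves the entire window.\<close>
  have "\<exists>n' c' y. (m, e, x s) = (n', c', y s) \<and> slow_path L s b n' y \<and>
     (\<forall>t\<in>{s..b}. (drop_coord K d (lo t))\<^sup>*\<^sup>* (n', c', y t) (k, f, v t))"
    by (rule slow_path_up[OF Z(2)[unfolded v(1)] v(2) as(2) lo_rec]) (use Lm as in auto)
  then obtain y where y: "x s = y s" "slow_path L s b m y"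
    "\<And>t. t \<in> {s..b} \<Longrightarrow> (drop_coord K d (lo t))\<^sup>*\<^sup>* (m, e, y t) (k, f, v t)" by blast
  let ?w = "\<lambda>t. if t \<le> s then x t else y t"
  have "slow_path L a b m ?w" by (rule slow_path_append[OF x y(2,1) as])
  moreover have "equivclp (drop_coord K d (lo t)) (repr K d (p t)) (m, e, ?w t)" if t: "t \<in> {a..b}" for t
  proof (cases "t \<le> s")
    case True
    then show ?thesis using xe t by simp
  next
    case False
    then have t': "t \<in> {s..b}" using t by simp
    have "equivclp (drop_coord K d (lo t)) (n, c, u t) (m, e, y t)"
      using rtranclp_into_equivclp[OF v(3)[OF t']] rtranclp_into_equivclp[OF y(3)[OF t']]
      by (rule equivclp_trans[OF _ equivclp_sym])
    then show ?thesis using ue[OF t'] False by (auto intro: equivclp_trans)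
  qed
  ultimately show ?case using e unfolding lo_def by blast
qed

text \<open>The rewriting that moves \<open>p t\<close> into the cell e drops only coordinates below
  3/8 or above 5/8, where T is 0 or 1. Hence the deformed path is given by the coordinates
  \<open>T t (x t k)\<close> in this single cell, and being at a vertex at both ends makes it one
  tame piece.\<close>

lemma deformed_window_seg:
  assumes pc: "precubical_set K d" and ch: "chain K d tm p a b" and L: "lift_on K d p L a b"
    and Lm: "\<And>t t'. a \<le> t \<Longrightarrow> t \<le> t' \<Longrightarrow> t' \<le> b \<Longrightarrow> L t \<le> L t'" and short: "L b - L a \<le> 1 / 8"
    and T: "deformation T a b"
    and T0: "\<And>t x. t \<in> {a..b} \<Longrightarrow> 0 \<le> x \<Longrightarrow> x \<le> 3 / 8 \<Longrightarrow> T t x = 0"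
    and T1: "\<And>t x. t \<in> {a..b} \<Longrightarrow> 5 / 8 \<le> x \<Longrightarrow> x \<le> 1 \<Longrightarrow> T t x = 1"
    and va: "is_vertex K d (phi K d (T a) (p a))" and vb: "is_vertex K d (phi K d (T b) (p b))"
  shows "chain K d True (\<lambda>t. phi K d (T t) (p t)) a b"
proof -
  obtain m e x where e: "e \<in> K m" and x: "slow_path L a b m x"
    and xe: "\<And>t. t \<in> {a..b} \<Longrightarrow> equivclp (drop_coord K d (1 / 4 + (L t - L a))) (repr K d (p t)) (m, e, x t)"
    using chain_window[OF pc ch L Lm short] by blast
  have ab: "a \<le> b" by (rule chain_le[OF ch])
  have cube: "(\<lambda>k. T t (x t k)) \<in> cube m" if t: "t \<in> {a..b}" for t
    by (rule unit_map_cube[OF deformationD(1)[OF T t] slow_pathD(1)[OF x t]])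
  have eq: "phi K d (T t) (p t) = real_cell K d m e (\<lambda>k. T t (x t k))" if t: "t \<in> {a..b}" for t
  proof -
    obtain n c u where p: "c \<in> K n" "u \<in> cube n" "p t = real_cell K d n c u"
      using chain_point[OF ch t] by (rule geom_points_cases)
    have lo: "0 < 1 / 4 + (L t - L a)" "1 / 4 + (L t - L a) \<le> 3 / 8"
      using Lm[of a t] Lm[of t b] short t by auto
    have "equivclp (drop_coord K d (1 / 4 + (L t - L a))) (n, c, u) (m, e, x t)"
      using repr_drop_equiv[where K = K and n = n and d = d, OF p(1,2) lo(1)] xe[OF t] unfolding p(3)
      by (blast intro: equivclp_trans equivclp_sym)
    then have "(case (n, c, u) of (n, c, u) \<Rightarrow> real_cell K d n c (\<lambda>k. T t (u k))) =
        (case (m, e, x t) of (n, c, u) \<Rightarrow> real_cell K d n c (\<lambda>k. T t (u k)))"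
      by (rule equiv_phi) (use deformationD(1)[OF T t] T0[OF t] T1[OF t] lo in auto)
    then show ?thesis
      unfolding p(3) using phi_cell[of "T t" c K n u d] deformationD(1)[OF T t] p by simp
  qed
  have vert: "T t (x t k) \<in> {0, 1}" if "t \<in> {a..b}" "is_vertex K d (phi K d (T t) (p t))" "k < m" for t k
    using that(2,3) cube[OF that(1)] unfolding eq[OF that(1)]
    by (simp add: is_vertex_cell[of e K m, OF e])
  have "seg K d True (\<lambda>t. phi K d (T t) (p t)) a b m e (\<lambda>t k. T t (x t k))"
  proof (rule segI)
    fix k assume k: "k < m"
    show "continuous_on {a..b} (\<lambda>t. T t (x t k))"
      by (rule deformation_coord_cont[OF T slow_pathD(2)[OF x]]) (use cube_coord slow_pathD(1)[OF x] in blast)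
    show "T a (x a k) \<in> {0, 1} \<and> T b (x b k) \<in> {0, 1}"
      using vert[of a k] vert[of b k] va vb ab k by auto
    fix t t' assume t: "a \<le> t" "t \<le> t'" "t' \<le> b"
    show "T t (x t k) \<le> T t' (x t' k)"
      using cube_coord[of "x t" m k] cube_coord[of "x t'" m k] slow_pathD(1)[OF x, of t] slow_pathD(1)[OF x, of t'] t
      by (intro deformationD(2)[OF T] slow_pathD(3)[OF x]) auto
  qed (use ab e cube eq in auto)
  then show ?thesis by (rule chain.one)
qed

text \<open>Wherever the deformed path is not at a vertex, some coordinate is on the steep part of T, so
  the deformed path moves at least r times as fast as the original one.\<close>
lemma seg_steep:
  assumes s: "seg K d tm p a b n c u" and T: "deformation T a b" and L: "lift_on K d p L a b"
    and nv: "\<And>t. t \<in> {\<alpha>..\<omega>} \<Longrightarrow> \<not> is_vertex K d (phi K d (T t) (p t))"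
    and sub: "a \<le> \<alpha>" "\<alpha> \<le> \<omega>" "\<omega> \<le> b"
    and Th: "\<And>t x. t \<in> {a..b} \<Longrightarrow> T t x = min 1 (max 0 (h t x))"
    and hc: "continuous_on ({a..b} \<times> {0..1}) (\<lambda>(t, x). h t x)"
    and hr: "\<And>t t' x x'. a \<le> t \<Longrightarrow> t \<le> t' \<Longrightarrow> t' \<le> b \<Longrightarrow> x \<le> x' \<Longrightarrow> r * (L t' - L t) \<le> h t' x' - h t x"
  shows "r * (L \<omega> - L \<alpha>) \<le> dlen K d p L T \<omega> - dlen K d p L T \<alpha>"
proof -
  let ?S = "\<lambda>t. \<Sum>k<n. T t (u t k)"
  have s': "seg K d tm (\<lambda>t. phi K d (T t) (p t)) a b n c (\<lambda>t k. T t (u t k))" by (rule seg_deform[OF s T])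
  \<comment> \<open>Induction on intervals: the estimate is additive over adjacent intervals and
    holds locally. The guard confines it to the stretch without vertices.\<close>
  define P where "P x y \<longleftrightarrow> (\<alpha> \<le> x \<and> x \<le> y \<and> y \<le> \<omega> \<longrightarrow> r * (L y - L x) \<le> ?S y - ?S x)" for x y
  have "P \<alpha> \<omega>"
    using sub(2)
  proof (induction rule: Bolzano)
    case (trans x y z)
    show ?case unfolding P_def
    proof
      assume xz: "\<alpha> \<le> x \<and> x \<le> z \<and> z \<le> \<omega>"
      then have "r * (L y - L x) \<le> ?S y - ?S x" "r * (L z - L y) \<le> ?S z - ?S y"
        using trans xz unfolding P_def by auto
      moreover have "r * (L z - L x) = r * (L y - L x) + r * (L z - L y)" by (simp add: algebra_simps)
      ultimately show "r * (L z - L x) \<le> ?S z - ?S x" by linarith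
    qed
  next
    case (local x)
    then have x: "x \<in> {a..b}" and xx: "x \<in> {\<alpha>..\<omega>}" using sub by auto
    \<comment> \<open>Away from vertices some deformed coordinate is strictly between 0 and 1.
      There, and at nearby times, clipping is inactive and the coordinate moves as h
      prescribes.\<close>
    have "\<exists>k<n. T x (u x k) \<notin> {0, 1}"
      using nv[OF xx] is_vertex_cell[of c K n "\<lambda>k. T x (u x k)" d] segD(2,3)[OF s'] x
      unfolding segD(4)[OF s' x] by auto
    then obtain k where k: "k < n" "T x (u x k) \<noteq> 0" "T x (u x k) \<noteq> 1" by auto
    let ?g = "\<lambda>t. h t (u t k)"
    have gx: "0 < ?g x" "?g x < 1" using k Th[OF x, of "u x k"] by (auto simp: min_def max_def split: if_splits)
    have "continuous_on {a..b} (\<lambda>t. (\<lambda>(t, x). h t x) (t, u t k))"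
      by (rule continuous_on_compose2[OF hc])
         (use segD(5)[OF s k(1)] cube_coord[OF segD(3)[OF s]] in \<open>auto intro!: continuous_intros\<close>)
    then have gc: "continuous_on {a..b} ?g" by simp
    define \<epsilon> where "\<epsilon> = min (?g x) (1 - ?g x)"
    have "\<epsilon> > 0" using gx by (simp add: \<epsilon>_def)
    then obtain \<delta> where \<delta>: "\<delta> > 0" "\<And>t. t \<in> {a..b} \<Longrightarrow> dist t x < \<delta> \<Longrightarrow> dist (?g t) (?g x) < \<epsilon>"
      using gc x unfolding continuous_on_iff by metis
    have Tg: "T t (u t k) = ?g t" if "t \<in> {a..b}" "dist t x < \<delta>" for t
    proof -
      have "0 < ?g t" "?g t < 1" using \<delta>(2)[OF that] by (auto simp: \<epsilon>_def dist_real_def)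
      then show ?thesis using Th[OF that(1)] by simp
    qed
    show ?case
    proof (intro exI[of _ \<delta>] conjI allI impI)
      fix y z assume yz: "y \<le> x \<and> x \<le> z \<and> z - y < \<delta>"
      show "P y z" unfolding P_def
      proof
        assume "\<alpha> \<le> y \<and> y \<le> z \<and> z \<le> \<omega>"
        then have in_ab: "a \<le> y" "y \<le> z" "z \<le> b" using sub by auto
        have "r * (L z - L y) \<le> ?g z - ?g y"
          by (rule hr[OF in_ab segD(6)[OF s k(1) in_ab]])
        also have "\<dots> = T z (u z k) - T y (u y k)"
          using Tg[of y] Tg[of z] in_ab yz by (simp add: dist_real_def)
        also have "\<dots> \<le> (\<Sum>k<n. T z (u z k) - T y (u y k))"
        proof (rule member_le_sum[of k "{..<n}" "\<lambda>k. T z (u z k) - T y (u y k)"])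
          show "0 \<le> T z (u z j) - T y (u y j)" if "j \<in> {..<n} - {k}" for j
            using segD(6)[OF s' _ in_ab, of j] that by simp
        qed (use k in auto)
        also have "\<dots> = ?S z - ?S y" by (simp add: sum_subtractf)
        finally show "r * (L z - L y) \<le> ?S z - ?S y" .
      qed
    qed (rule \<delta>(1))
  qed
  then have "r * (L \<omega> - L \<alpha>) \<le> ?S \<omega> - ?S \<alpha>" unfolding P_def using sub by simp
  moreover have "dlen K d p L T \<omega> = dlen K d p L T \<alpha> + (?S \<omega> - ?S \<alpha>)"
    by (rule seg_dlen[OF s T L]) (use sub in auto)
  ultimately show ?thesis by linarith
qed

text \<open>Both sides of the estimate are additive over adjacent intervals, so a stretch that spans
  several pieces is split at their junctions.\<close>

lemma chain_steep:
  assumes "chain K d tm p a b" "deformation T a b" "lift_on K d p L a b"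
    "\<And>t. t \<in> {\<alpha>..\<omega>} \<Longrightarrow> \<not> is_vertex K d (phi K d (T t) (p t))"
    "a \<le> \<alpha>" "\<alpha> \<le> \<omega>" "\<omega> \<le> b"
    "\<And>t x. t \<in> {a..b} \<Longrightarrow> T t x = min 1 (max 0 (h t x))"
    "continuous_on ({a..b} \<times> {0..1}) (\<lambda>(t, x). h t x)"
    "\<And>t t' x x'. a \<le> t \<Longrightarrow> t \<le> t' \<Longrightarrow> t' \<le> b \<Longrightarrow> x \<le> x' \<Longrightarrow> r * (L t' - L t) \<le> h t' x' - h t x"
  shows "r * (L \<omega> - L \<alpha>) \<le> dlen K d p L T \<omega> - dlen K d p L T \<alpha>"
  using assms
proof (induction arbitrary: \<alpha> \<omega> rule: chain.induct)
  case (one a b n c u)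
  show ?case by (rule seg_steep[OF one])
next
  case (snoc a s b n c u)
  have as: "a \<le> s" "s \<le> b" using chain_le[OF snoc(1)] segD(1)[OF snoc(2)] .
  have T: "deformation T a s" "deformation T s b" using deformation_restrict[OF snoc(4)] as by auto
  have L: "lift_on K d p L a s" "lift_on K d p L s b"
    using lift_on_restrict[OF snoc(5)] as by auto
  have hc: "continuous_on ({a..s} \<times> {0..1}) (\<lambda>(t, x). h t x)" "continuous_on ({s..b} \<times> {0..1}) (\<lambda>(t, x). h t x)"
    by (rule continuous_on_subset[OF snoc(11)], use as in auto)+
  have Th: "T t x = min 1 (max 0 (h t x))" if "t \<in> {a..b}" for t x using snoc(10) that .
  have hr: "r * (L t' - L t) \<le> h t' x' - h t x" if "a \<le> t" "t \<le> t'" "t' \<le> b" "x \<le> x'" for t t' x x'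
    using snoc(12) that .
  have nv: "\<not> is_vertex K d (phi K d (T t) (p t))" if "t \<in> {\<alpha>..\<omega>}" for t using snoc(6) that .
  have left: "r * (L \<omega>' - L \<alpha>') \<le> dlen K d p L T \<omega>' - dlen K d p L T \<alpha>'"
    if "\<alpha> \<le> \<alpha>'" "\<alpha>' \<le> \<omega>'" "\<omega>' \<le> \<omega>" "\<omega>' \<le> s" for \<alpha>' \<omega>'
  proof (rule snoc.IH[OF T(1) L(1) _ _ _ _ _ hc(1)])
    show "\<not> is_vertex K d (phi K d (T t) (p t))" if "t \<in> {\<alpha>'..\<omega>'}" for t
      by (rule nv) (use that \<open>\<alpha> \<le> \<alpha>'\<close> \<open>\<omega>' \<le> \<omega>\<close> in auto)
    show "T t x = min 1 (max 0 (h t x))" if "t \<in> {a..s}" for t x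
      by (rule Th) (use that as in auto)
    show "r * (L t' - L t) \<le> h t' x' - h t x" if "a \<le> t" "t \<le> t'" "t' \<le> s" "x \<le> x'" for t t' x x'
      by (rule hr) (use that as in auto)
  qed (use that snoc(7) in auto)
  have right: "r * (L \<omega>' - L \<alpha>') \<le> dlen K d p L T \<omega>' - dlen K d p L T \<alpha>'"
    if "\<alpha> \<le> \<alpha>'" "\<alpha>' \<le> \<omega>'" "\<omega>' \<le> \<omega>" "s \<le> \<alpha>'" for \<alpha>' \<omega>'
  proof (rule seg_steep[OF snoc(2) T(2) L(2) _ _ _ _ _ hc(2)])
    show "\<not> is_vertex K d (phi K d (T t) (p t))" if "t \<in> {\<alpha>'..\<omega>'}" for t
      by (rule nv) (use that \<open>\<alpha> \<le> \<alpha>'\<close> \<open>\<omega>' \<le> \<omega>\<close> in auto)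
    show "T t x = min 1 (max 0 (h t x))" if "t \<in> {s..b}" for t x
      by (rule Th) (use that as in auto)
    show "r * (L t' - L t) \<le> h t' x' - h t x" if "s \<le> t" "t \<le> t'" "t' \<le> b" "x \<le> x'" for t t' x x'
      by (rule hr) (use that as in auto)
  qed (use that snoc(9) in auto)
  consider "\<omega> \<le> s" | "s \<le> \<alpha>" | "\<alpha> \<le> s" "s \<le> \<omega>" by linarith
  then show ?case
  proof cases
    case 1 then show ?thesis using left snoc(8) by simp
  next
    case 2 then show ?thesis using right snoc(8) by simp
  next
    case 3
    have "r * (L \<omega> - L \<alpha>) = r * (L s - L \<alpha>) + r * (L \<omega> - L s)" by (simp add: algebra_simps)
    then show ?thesis using left[of \<alpha> s] right[of s \<omega>] 3 by simp
  qed
qed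

section \<open>The taming deformation\<close>

text \<open>With q = (s, M, c), this interpolates with weight s between the identity and the line of
  slope M through (c, 1/2), clipped to [0, 1]. Collecting the parameters in one triple makes
  continuity in all of them an instance of \<open>continuous_map_phi\<close>.\<close>

definition snap :: "real \<times> real \<times> real \<Rightarrow> real \<Rightarrow> real" where
  "snap q x = (1 - fst q) * x + fst q * min 1 (max 0 (fst (snd q) * (x - snd (snd q)) + 1 / 2))"

text \<open>A slope of at least 8 makes half the width of the jump at most 1/16, and c is within
  1/16 of 1/2. So every jump takes place between 3/8 and 5/8, the range that
  \<open>drop_coord\<close> leaves alone as long as lo is at most 3/8.\<close>

definition snap_params :: "(real \<times> real \<times> real) set" where
  "snap_params = {0..1} \<times> {8..} \<times> {7 / 16..9 / 16}"

lemma closed_snap_params: "closed snap_params"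
  unfolding snap_params_def by (intro closed_Times) auto

lemma continuous_on_snap: "continuous_on S (\<lambda>(q, x). snap q x)"
  unfolding snap_def case_prod_unfold by (intro continuous_intros)

lemma snap_eqs:
  assumes q: "(s, M, c) \<in> snap_params"
  shows "snap (s, M, c) 0 = 0" "snap (s, M, c) 1 = 1"
    "x \<le> 3 / 8 \<Longrightarrow> snap (1, M, c) x = 0" "5 / 8 \<le> x \<Longrightarrow> snap (1, M, c) x = 1"
proof -
  have M: "8 \<le> M" and c: "7 / 16 \<le> c" "c \<le> 9 / 16" using q by (auto simp: snap_params_def)
  have lo: "M * (x - c) + 1 / 2 \<le> 0" if "x \<le> 3 / 8" for x
  proof -
    have "M * (c - x) \<ge> 8 * (1 / 16)" using M c that by (intro mult_mono) auto
    then show ?thesis by (simp add: algebra_simps)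
  qed
  have hi: "M * (x - c) + 1 / 2 \<ge> 1" if "5 / 8 \<le> x" for x
  proof -
    have "M * (x - c) \<ge> 8 * (1 / 16)" using M c that by (intro mult_mono) auto
    then show ?thesis by (simp add: algebra_simps)
  qed
  show "snap (s, M, c) 0 = 0" "snap (s, M, c) 1 = 1"
    using lo[of 0] hi[of 1] by (simp_all add: snap_def)
  show "x \<le> 3 / 8 \<Longrightarrow> snap (1, M, c) x = 0" "5 / 8 \<le> x \<Longrightarrow> snap (1, M, c) x = 1"
    using lo[of x] hi[of x] by (simp_all add: snap_def)
qed

lemma snap_mono:
  assumes "0 \<le> s" "s \<le> 1" "0 \<le> M" "x \<le> x'" "c' \<le> c"
  shows "snap (s, M, c) x \<le> snap (s, M, c') x'"
proof -
  have "M * (x - c) \<le> M * (x' - c')" using assms by (intro mult_left_mono) auto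
  then have "min 1 (max 0 (M * (x - c) + 1 / 2)) \<le> min 1 (max 0 (M * (x' - c') + 1 / 2))" by auto
  then show ?thesis
    unfolding snap_def using assms by (auto intro!: add_mono mult_left_mono)
qed

lemma unit_map_snap:
  assumes q: "q \<in> snap_params"
  shows "unit_map (snap q)"
proof -
  obtain s M c where e: "q = (s, M, c)" by (cases q) auto
  have s: "0 \<le> s" "s \<le> 1" "0 \<le> M" using q by (auto simp: snap_params_def e)
  note z = snap_eqs(1,2)[OF q[unfolded e]]
  have "0 \<le> snap q x \<and> snap q x \<le> 1" if "0 \<le> x" "x \<le> 1" for x
    using snap_mono[OF s, of 0 x c c] snap_mono[OF s, of x 1 c c] z that by (simp add: e)
  then show ?thesis using z unfolding unit_map_def e by blast
qed

lemma is_vertex_fixed: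
  assumes "p \<in> geom_points K d" "is_vertex K d p" and h: "unit_map h"
  shows "phi K d h p = p" "excess K d h p = 0"
proof -
  obtain n c u where p: "c \<in> K n" "u \<in> cube n" "p = real_cell K d n c u"
    using assms(1) by (rule geom_points_cases)
  have u: "\<forall>k<n. u k \<in> {0, 1}"
    using assms(2) unfolding p(3) is_vertex_cell[where K = K and n = n, OF p(1,2)] .
  have hu: "h (u k) = u k" for k
    using u h p(2) by (cases "k < n") (auto simp: unit_map_def cube_def)
  show "phi K d h p = p" "excess K d h p = 0"
    unfolding p(3) phi_cell[where K = K and n = n, OF h p(1,2)] excess_cell[where K = K and n = n, OF h p(1,2)]
    by (simp_all add: hu)
qed

text \<open>For a chain the chosen lift is unique on \<open>{0..l}\<close>: two candidates differ by
  a continuous integer-valued function that vanishes at 0.\<close>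

definition len :: "(nat \<Rightarrow> 'c set) \<Rightarrow> (nat \<Rightarrow> nat \<Rightarrow> bool \<Rightarrow> 'c \<Rightarrow> 'c) \<Rightarrow> real \<Rightarrow> (real \<Rightarrow> 'c point) \<Rightarrow> real \<Rightarrow> real" where
  "len K d l p = (SOME L. lift_on K d p L 0 l \<and> L 0 = 0)"

text \<open>The threshold at which a coordinate jumps from 0 to 1 decreases along the path. Hence the
  distance of every coordinate to the threshold grows at a definite rate, and all jumps are fast.\<close>
definition jump :: "(real \<Rightarrow> real) \<Rightarrow> real \<Rightarrow> real \<Rightarrow> real \<Rightarrow> real \<times> real \<times> real" where
  "jump L l s t = (s, 128 * (L l)\<^sup>2 + 8, 9 / 16 - L t / (8 * L l))"

definition bent :: "(nat \<Rightarrow> 'c set) \<Rightarrow> (nat \<Rightarrow> nat \<Rightarrow> bool \<Rightarrow> 'c \<Rightarrow> 'c) \<Rightarrow> real \<Rightarrow> real \<Rightarrow> (real \<Rightarrow> 'c point) \<Rightarrow> real \<Rightarrow> 'c point" where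
  "bent K d l s p t = phi K d (snap (jump (len K d l p) l s t)) (p t)"

definition blen :: "(nat \<Rightarrow> 'c set) \<Rightarrow> (nat \<Rightarrow> nat \<Rightarrow> bool \<Rightarrow> 'c \<Rightarrow> 'c) \<Rightarrow> real \<Rightarrow> real \<Rightarrow> (real \<Rightarrow> 'c point) \<Rightarrow> real \<Rightarrow> real" where
  "blen K d l s p = dlen K d p (len K d l p) (\<lambda>t. snap (jump (len K d l p) l s t))"

text \<open>bent may rest; reparametrizing it by length makes it regular again.\<close>
definition hpath :: "(nat \<Rightarrow> 'c set) \<Rightarrow> (nat \<Rightarrow> nat \<Rightarrow> bool \<Rightarrow> 'c \<Rightarrow> 'c) \<Rightarrow> real \<Rightarrow> real \<Rightarrow> (real \<Rightarrow> 'c point) \<Rightarrow> real \<Rightarrow> 'c point" where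
  "hpath K d l s p = (\<lambda>t\<in>{0..l}. bent K d l s p (SOME t'. t' \<in> {0..l} \<and> blen K d l s p t' = len K d l p t))"

locale regular_chain =
  fixes K :: "nat \<Rightarrow> 'c set" and d tm l p
  assumes l: "0 < l" and chain: "chain K d tm p 0 l" and regular: "regular_path l p"
    and start: "is_vertex K d (p 0)" and stop: "is_vertex K d (p l)"
begin

abbreviation "L \<equiv> len K d l p"

lemma lift: "lift_on K d p L 0 l" and L0: "L 0 = 0"
proof -
  have "\<exists>L. lift_on K d p L 0 l \<and> L 0 = 0" using chain_lift_exists[OF chain] .
  from someI_ex[OF this] show "lift_on K d p L 0 l" "L 0 = 0" unfolding len_def by blast+
qed

lemma points: "t \<in> {0..l} \<Longrightarrow> p t \<in> geom_points K d"
  using chain_point[OF chain] .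

text \<open>The identity is a deformation with excess 0, so the result for deformed paths
  specializes to p.\<close>

lemma L_fibre: "fibre_mono L p 0 l"
proof -
  have id: "deformation (\<lambda>_ x. x) 0 l"
    unfolding deformation_def unit_map_def by (auto simp: case_prod_unfold intro!: continuous_intros)
  have e: "dlen K d p L (\<lambda>_ x. x) t = L t" "phi K d (\<lambda>x. x) (p t) = p t" if "t \<in> {0..l}" for t
    using phi_excess_id[of "\<lambda>x. x" "p t" K d] points[OF that] by (auto simp: dlen_def)
  note f = chain_fibre_mono[OF chain id lift]
  show ?thesis
    unfolding fibre_mono_def
  proof (intro conjI allI impI)
    show "continuous_on {0..l} L" by (rule lift_onD(1)[OF lift])
    fix t t' assume t: "0 \<le> t \<and> t \<le> t' \<and> t' \<le> l"
    then show "L t \<le> L t'" using fibre_monoD(2)[OF f, of t t'] e(1)[of t] e(1)[of t'] by simp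
    show "p t = p t'" if "L t = L t'"
      using fibre_monoD(3)[OF f, of t t'] e[of t] e[of t'] t that by simp
  qed
qed

lemma L_cont: "continuous_on {0..l} L" by (rule fibre_monoD(1)[OF L_fibre])

lemma L_mono: "0 \<le> t \<Longrightarrow> t \<le> t' \<Longrightarrow> t' \<le> l \<Longrightarrow> L t \<le> L t'"
  by (rule fibre_monoD(2)[OF L_fibre])

text \<open>If L stalled on an interval, p would be constant there by \<open>L_fibre\<close>,
  contrary to regularity.\<close>

lemma L_strict:
  assumes "0 \<le> t" "t < t'" "t' \<le> l"
  shows "L t < L t'"
proof (rule ccontr)
  assume "\<not> L t < L t'"
  then have eq: "L t = L t'" using L_mono[of t t'] assms by simp
  have "p x = p t" if x: "x \<in> {t..t'}" for x
  proof -
    have "L t \<le> L x" "L x \<le> L t'" using L_mono[of t x] L_mono[of x t'] assms x by auto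
    then have "L t = L x" using eq by simp
    then show ?thesis using fibre_monoD(3)[OF L_fibre, of t x] assms x by simp
  qed
  then show False using regular assms unfolding regular_path_def by blast
qed

lemma n_pos: "0 < L l" using L_strict[of 0 l] l L0 by simp

lemma L_bounds: "t \<in> {0..l} \<Longrightarrow> 0 \<le> L t \<and> L t \<le> L l"
  using L_mono[of 0 t] L_mono[of t l] L0 by auto

lemma L_inj: "inj_on L {0..l}"
proof (rule inj_onI)
  fix x y assume "x \<in> {0..l}" "y \<in> {0..l}" "L x = L y"
  then show "x = y" using L_strict[of x y] L_strict[of y x] by (cases x y rule: linorder_cases) auto
qed

lemma L_image: "L ` {0..l} = {0..L l}"
proof
  show "L ` {0..l} \<subseteq> {0..L l}" using L_bounds by auto
  show "{0..L l} \<subseteq> L ` {0..l}"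
  proof
    fix y assume "y \<in> {0..L l}"
    then obtain x where "0 \<le> x" "x \<le> l" "L x = y" using IVT'[of L 0 y l] L_cont l L0 by auto
    then show "y \<in> L ` {0..l}" by auto
  qed
qed

lemma jump_params:
  assumes "s \<in> {0..1}" "t \<in> {0..l}"
  shows "jump L l s t \<in> snap_params"
proof -
  have "L t / (8 * L l) \<le> 1 / 8" "0 \<le> L t / (8 * L l)" using L_bounds[OF assms(2)] n_pos by (auto simp: divide_simps)
  then show ?thesis using assms(1) by (auto simp: jump_def snap_params_def)
qed

lemma deformation:
  assumes s: "s \<in> {0..1}"
  shows "deformation (\<lambda>t. snap (jump L l s t)) 0 l"
  unfolding deformation_def
proof (intro conjI ballI allI impI)
  fix t assume "t \<in> {0..l}"
  then show "unit_map (snap (jump L l s t))" using jump_params[OF s] by (intro unit_map_snap)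
next
  fix t t' x x' assume a: "0 \<le> t \<and> t \<le> t' \<and> t' \<le> l \<and> 0 \<le> x \<and> x \<le> x' \<and> x' \<le> (1::real)"
  have "L t / (8 * L l) \<le> L t' / (8 * L l)" using L_mono[of t t'] a n_pos by (intro divide_right_mono) auto
  then show "snap (jump L l s t) x \<le> snap (jump L l s t') x'"
    unfolding jump_def using s a by (intro snap_mono) auto
next
  have c: "continuous_on ({0..l} \<times> {0..1::real}) (\<lambda>z. L (fst z))"
    by (rule continuous_on_compose2[OF L_cont]) (auto intro!: continuous_intros)
  show "continuous_on ({0..l} \<times> {0..1}) (\<lambda>(t, x). snap (jump L l s t) x)"
    unfolding snap_def jump_def case_prod_unfold fst_conv snd_conv
    by (intro continuous_intros c) (use n_pos in auto)
qed

lemma bent_chain: "s \<in> {0..1} \<Longrightarrow> chain K d tm (bent K d l s p) 0 l"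
  using chain_deform[OF chain deformation] unfolding bent_def .

lemma bent_fibre: "s \<in> {0..1} \<Longrightarrow> fibre_mono (blen K d l s p) (bent K d l s p) 0 l"
  using chain_fibre_mono[OF chain deformation lift] unfolding bent_def blen_def .

lemma bent_ends:
  assumes s: "s \<in> {0..1}"
  shows "bent K d l s p 0 = p 0" "bent K d l s p l = p l" "blen K d l s p 0 = 0" "blen K d l s p l = L l"
  using is_vertex_fixed[OF points start unit_map_snap[OF jump_params[OF s]], of 0]
    is_vertex_fixed[OF points stop unit_map_snap[OF jump_params[OF s]], of l] l L0
  by (auto simp: bent_def blen_def dlen_def)

text \<open>Every stretch of length more than 1/16 contains a time at which the deformed path is at
  a vertex. The path is cut at such times into windows of length at most 1/8, each of which is tame
  by \<open>deformed_window_seg\<close>.\<close>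

lemma bent_tame:
  assumes pc: "precubical_set K d"
  shows "chain K d True (bent K d l 1 p) 0 l"
proof -
  define M where "M = 128 * (L l)\<^sup>2 + 8"
  define c where "c t = 9 / 16 - L t / (8 * L l)" for t
  define h where "h t x = M * (x - c t) + 1 / 2" for t x
  let ?T = "\<lambda>t. snap (jump L l 1 t)"
  have jump: "jump L l 1 t = (1, M, c t)" for t by (simp add: jump_def M_def c_def)
  have Th: "?T t x = min 1 (max 0 (h t x))" for t x by (simp add: jump snap_def h_def)
  have one: "(1::real) \<in> {0..1}" by simp
  note T = deformation[OF one]
  note T01 = snap_eqs(3,4)[OF jump_params[OF one, unfolded jump]]
  have M0: "0 \<le> M" by (simp add: M_def)
  define r where "r = M / (8 * L l)"
  \<comment> \<open>This is the origin of the factor 128 = 8 * 16: the 8 cancels the one in the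
    threshold, and 16 is the reciprocal of the length of a stretch that must contain a
    vertex.\<close>
  have r: "16 * L l \<le> r"
    using n_pos by (simp add: r_def M_def divide_simps power2_eq_square)
  have hr: "r * (L t' - L t) \<le> h t' x' - h t x" if "x \<le> x'" for t t' x x'
  proof -
    have "h t' x' - h t x = M * (x' - x) + r * (L t' - L t)"
      using n_pos by (simp add: h_def c_def r_def field_simps)
    then show ?thesis using M0 that by simp
  qed
  have cc: "continuous_on ({0..l} \<times> {0..1::real}) (\<lambda>z. L (fst z))"
    by (rule continuous_on_compose2[OF L_cont]) (auto intro!: continuous_intros)
  have hc: "continuous_on ({0..l} \<times> {0..1}) (\<lambda>(t, x). h t x)"
    unfolding h_def c_def case_prod_unfold by (intro continuous_intros cc) (use n_pos in auto)
  note bf = bent_fibre[OF one]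
  have vertex_in: "\<exists>w\<in>{\<alpha>..\<omega>}. is_vertex K d (bent K d l 1 p w)"
    if \<alpha>: "0 \<le> \<alpha>" "\<alpha> \<le> \<omega>" "\<omega> \<le> l" "L \<omega> - L \<alpha> > 1 / 16" for \<alpha> \<omega>
  proof (rule ccontr)
    assume "\<not> ?thesis"
    then have nv: "\<not> is_vertex K d (phi K d (?T t) (p t))" if "t \<in> {\<alpha>..\<omega>}" for t
      using that unfolding bent_def by blast
    have "r * (L \<omega> - L \<alpha>) \<le> dlen K d p L ?T \<omega> - dlen K d p L ?T \<alpha>"
      by (rule chain_steep[OF chain T lift nv \<alpha>(1-3) Th hc hr])
    \<comment> \<open>Deformed lengths stay between 0 and \<open>L l\<close>: the ends of p are
      vertices, where the excess is 0.\<close>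
    also have "\<dots> \<le> L l"
    proof -
      have "0 \<le> blen K d l 1 p \<alpha>" "blen K d l 1 p \<omega> \<le> L l"
        using fibre_monoD(2)[OF bf, of 0 \<alpha>] fibre_monoD(2)[OF bf, of \<omega> l] bent_ends[OF one] \<alpha> by auto
      then show ?thesis by (simp add: blen_def)
    qed
    finally have "r * (L \<omega> - L \<alpha>) \<le> L l" .
    moreover have "16 * L l * (1 / 16) < r * (L \<omega> - L \<alpha>)"
      using r \<alpha>(4) n_pos by (intro mult_le_less_imp_less) auto
    ultimately show False by simp
  qed
  have window: "chain K d True (bent K d l 1 p) v w"
    if v: "0 \<le> v" "v \<le> w" "w \<le> l" "L w - L v \<le> 1 / 8"
      and "is_vertex K d (bent K d l 1 p v)" "is_vertex K d (bent K d l 1 p w)" for v w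
    unfolding bent_def
  proof (rule deformed_window_seg[OF pc chain_restrict[OF chain v(1-3)] lift_on_restrict[OF lift v(1,3)] _ v(4)
        deformation_restrict[OF T v(1,3)]])
    show "L t \<le> L t'" if "v \<le> t" "t \<le> t'" "t' \<le> w" for t t'
      using L_mono[of t t'] that v by simp
    show "?T t x = 0" if "t \<in> {v..w}" "x \<le> 3 / 8" for t x
      unfolding jump by (rule T01(1)[of t]) (use that v in auto)
    show "?T t x = 1" if "t \<in> {v..w}" "5 / 8 \<le> x" for t x
      unfolding jump by (rule T01(2)[of t]) (use that v in auto)
  qed (use that in \<open>simp_all add: bent_def\<close>)
  have stop': "is_vertex K d (bent K d l 1 p l)" using stop bent_ends[OF one] by simp
  \<comment> \<open>Induction on the remaining length in units of 1/32. From v the next vertex is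
    sought at distance between 1/32, which guarantees progress, and 1/8, the size of a window. The
    gap of 3/32 exceeds 1/16, so a vertex is found there.\<close>
  have "chain K d True (bent K d l 1 p) v l"
    if "L l - L v \<le> real j / 32" "0 \<le> v" "v \<le> l" "is_vertex K d (bent K d l 1 p v)" for j v
    using that
  proof (induction j arbitrary: v)
    case 0
    then show ?case using window[of v l] stop' by simp
  next
    case (Suc j)
    show ?case
    proof (cases "L l - L v \<le> 1 / 8")
      case True
      then show ?thesis using window[of v l] stop' Suc by simp
    next
      case False
      have vc: "continuous_on {v..l} L" by (rule continuous_on_subset[OF L_cont]) (use Suc in auto)
      obtain \<alpha> where \<alpha>: "v \<le> \<alpha>" "\<alpha> \<le> l" "L \<alpha> = L v + 1 / 32"
        using IVT'[of L v "L v + 1 / 32" l] vc False Suc by auto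
      obtain \<omega> where \<omega>: "v \<le> \<omega>" "\<omega> \<le> l" "L \<omega> = L v + 1 / 8"
        using IVT'[of L v "L v + 1 / 8" l] vc False Suc by auto
      have "\<alpha> \<le> \<omega>"
      proof (rule ccontr)
        assume "\<not> \<alpha> \<le> \<omega>"
        then show False using L_mono[of \<omega> \<alpha>] \<alpha> \<omega> Suc by simp
      qed
      then obtain w where w: "w \<in> {\<alpha>..\<omega>}" "is_vertex K d (bent K d l 1 p w)"
        using vertex_in[of \<alpha> \<omega>] \<alpha> \<omega> Suc by auto
      have "L \<alpha> \<le> L w" "L w \<le> L \<omega>" using L_mono[of \<alpha> w] L_mono[of w \<omega>] w \<alpha> \<omega> Suc by auto
      then have "chain K d True (bent K d l 1 p) v w" "chain K d True (bent K d l 1 p) w l"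
        using window[of v w] Suc.IH[of w] w \<alpha> \<omega> Suc by auto
      then show ?thesis by (rule chain_append[rotated])
    qed
  qed
  moreover have "L l - L 0 \<le> real (nat \<lceil>32 * L l\<rceil>) / 32"
    using real_nat_ceiling_ge[of "32 * L l"] L0 by simp
  ultimately show ?thesis using bent_ends(1)[OF one] start l by simp
qed

text \<open>By regularity L is a homeomorphism onto \<open>{0..L l}\<close>, and r is its inverse
  applied to \<open>blen\<close>. The equation \<open>hpath\<close> after r equals
  \<open>bent\<close> determines \<open>hpath\<close>, as r is onto, and the properties of
  \<open>hpath\<close> are derived from it.\<close>

lemma hpath_reparam:
  assumes s: "s \<in> {0..1}"
  obtains r where "continuous_on {0..l} r" "\<And>t t'. 0 \<le> t \<Longrightarrow> t \<le> t' \<Longrightarrow> t' \<le> l \<Longrightarrow> r t \<le> r t'"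
    "r 0 = 0" "r l = l" "\<And>t. t \<in> {0..l} \<Longrightarrow> r t \<in> {0..l}"
    "\<And>t. t \<in> {0..l} \<Longrightarrow> L (r t) = blen K d l s p t"
    "\<And>t. t \<in> {0..l} \<Longrightarrow> hpath K d l s p (r t) = bent K d l s p t"
proof -
  define g where "g = the_inv_into {0..l} L"
  have gL: "g (L t) = t" if "t \<in> {0..l}" for t
    unfolding g_def by (rule the_inv_into_f_f[OF L_inj that])
  have Lg: "L (g y) = y" "g y \<in> {0..l}" if "y \<in> {0..L l}" for y
  proof -
    have y: "y \<in> L ` {0..l}" using that L_image by simp
    show "L (g y) = y" unfolding g_def by (rule f_the_inv_into_f[OF L_inj y])
    show "g y \<in> {0..l}" unfolding g_def by (rule the_inv_into_into[OF L_inj y]) simp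
  qed
  have gc: "continuous_on {0..L l} g"
    using continuous_on_inv[OF L_cont _ ] gL L_image by (metis compact_Icc)
  have g_mono: "g y \<le> g y'" if "y \<in> {0..L l}" "y' \<in> {0..L l}" "y \<le> y'" for y y'
  proof (rule ccontr)
    assume "\<not> g y \<le> g y'"
    then have "L (g y') < L (g y)" using L_strict[of "g y'" "g y"] Lg(2)[OF that(1)] Lg(2)[OF that(2)] by simp
    then show False using Lg(1)[OF that(1)] Lg(1)[OF that(2)] that(3) by simp
  qed
  let ?b = "blen K d l s p"
  note bf = bent_fibre[OF s] and be = bent_ends[OF s]
  have b_in: "?b t \<in> {0..L l}" if "t \<in> {0..l}" for t
    using fibre_monoD(2)[OF bf, of 0 t] fibre_monoD(2)[OF bf, of t l] be that by auto
  show thesis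
  proof (rule that[of "\<lambda>t. g (?b t)"])
    show "continuous_on {0..l} (\<lambda>t. g (?b t))"
      by (rule continuous_on_compose2[OF gc fibre_monoD(1)[OF bf]]) (use b_in in blast)
    show "g (?b t) \<le> g (?b t')" if "0 \<le> t" "t \<le> t'" "t' \<le> l" for t t'
      using that b_in[of t] b_in[of t'] fibre_monoD(2)[OF bf that] by (intro g_mono) auto
    show "g (?b 0) = 0" using gL[of 0] l L0 be by simp
    show "g (?b l) = l" using gL[of l] l be by simp
    fix t assume t: "t \<in> {0..l}"
    show r: "g (?b t) \<in> {0..l}" by (rule Lg(2)[OF b_in[OF t]])
    show Lr: "L (g (?b t)) = ?b t" by (rule Lg(1)[OF b_in[OF t]])
    let ?P = "\<lambda>t'. t' \<in> {0..l} \<and> ?b t' = L (g (?b t))"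
    \<comment> \<open>The chosen time may differ from t, but it has the same deformed length, and
      \<open>bent_fibre\<close> gives the same point.\<close>
    have "?P (SOME t'. ?P t')" by (rule someI[of ?P t]) (use t Lr in simp)
    then have st: "(SOME t'. ?P t') \<in> {0..l}" "?b (SOME t'. ?P t') = ?b t" using Lr by auto
    have "bent K d l s p x = bent K d l s p t" if "x \<in> {0..l}" "?b x = ?b t" for x
    proof (cases "x \<le> t")
      case True
      show ?thesis by (rule fibre_monoD(3)[OF bf]) (use that t True in auto)
    next
      case False
      show ?thesis by (rule fibre_monoD(3)[OF bf, symmetric]) (use that t False in auto)
    qed
    from this[OF st] show "hpath K d l s p (g (?b t)) = bent K d l s p t"
      using r by (simp add: hpath_def)
  qed
qed

lemma hpath_chain:
  assumes s: "s \<in> {0..1}" and ch: "chain K d tm' (bent K d l s p) 0 l"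
  shows "chain K d tm' (hpath K d l s p) 0 l"
proof -
  obtain r where r: "continuous_on {0..l} r" "\<And>t t'. 0 \<le> t \<Longrightarrow> t \<le> t' \<Longrightarrow> t' \<le> l \<Longrightarrow> r t \<le> r t'"
    "r 0 = 0" "r l = l" "\<And>t. t \<in> {0..l} \<Longrightarrow> r t \<in> {0..l}"
    "\<And>t. t \<in> {0..l} \<Longrightarrow> L (r t) = blen K d l s p t"
    "\<And>t. t \<in> {0..l} \<Longrightarrow> hpath K d l s p (r t) = bent K d l s p t"
    by (rule hpath_reparam[OF s], rule that; assumption)
  from chain_quot[OF ch r(1,2,7)] show ?thesis unfolding r(3,4) .
qed

lemma hpath_ends:
  assumes s: "s \<in> {0..1}"
  shows "hpath K d l s p 0 = p 0" "hpath K d l s p l = p l"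
proof -
  obtain r where r: "continuous_on {0..l} r" "\<And>t t'. 0 \<le> t \<Longrightarrow> t \<le> t' \<Longrightarrow> t' \<le> l \<Longrightarrow> r t \<le> r t'"
    "r 0 = 0" "r l = l" "\<And>t. t \<in> {0..l} \<Longrightarrow> r t \<in> {0..l}"
    "\<And>t. t \<in> {0..l} \<Longrightarrow> L (r t) = blen K d l s p t"
    "\<And>t. t \<in> {0..l} \<Longrightarrow> hpath K d l s p (r t) = bent K d l s p t"
    by (rule hpath_reparam[OF s], rule that; assumption)
  from r(7)[of 0] r(7)[of l] r(3,4) show "hpath K d l s p 0 = p 0" "hpath K d l s p l = p l"
    using bent_ends[OF s] l by auto
qed

text \<open>\<open>blen\<close> is a lift of \<open>turn\<close> along the deformed path, so where
  that path rests its length is constant by \<open>cis_constant\<close>. This is the converse of the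
  second half of \<open>fibre_mono\<close>.\<close>

lemma blen_const:
  assumes s: "s \<in> {0..1}" and t: "0 \<le> t" "t \<le> t'" "t' \<le> l"
    and const: "\<And>x. x \<in> {t..t'} \<Longrightarrow> bent K d l s p x = bent K d l s p t"
  shows "blen K d l s p t = blen K d l s p t'"
proof (rule cis_constant[where h = "blen K d l s p" and t = t and t' = t' and a = t and b = t' and w = "turn K d (bent K d l s p t) / turn K d (p 0)"])
  show "continuous_on {t..t'} (blen K d l s p)"
    by (rule continuous_on_subset[OF fibre_monoD(1)[OF bent_fibre[OF s]]]) (use t in auto)
  fix x assume x: "x \<in> {t..t'}"
  then have xl: "x \<in> {0..l}" using t by auto
  have "turn K d (bent K d l s p x) = turn K d (p x) * cis (2 * pi * excess K d (snap (jump L l s x)) (p x))"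
    unfolding bent_def by (rule turn_phi[OF unit_map_snap[OF jump_params[OF s xl]] points[OF xl]])
  also have "turn K d (p x) = turn K d (p 0) * cis (2 * pi * L x)"
    using lift_onD(2)[OF lift xl] unfolding L0 by simp
  finally have "turn K d (bent K d l s p x) = turn K d (p 0) * cis (2 * pi * blen K d l s p x)"
    unfolding mult.assoc cis_mult by (simp add: blen_def dlen_def distrib_left)
  moreover have "turn K d (p 0) \<noteq> 0" using turn_nonzero[OF points[of 0]] l by simp
  ultimately show "cis (2 * pi * blen K d l s p x) = turn K d (bent K d l s p t) / turn K d (p 0)"
    unfolding const[OF x] by simp
qed (use t in auto)

text \<open>A rest of \<open>hpath\<close> on \<open>{a..b}\<close> pulls back along r to a rest of
  \<open>bent\<close>. There \<open>blen\<close> is constant, which forces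
  \<open>L a = L b\<close>.\<close>

lemma hpath_regular:
  assumes s: "s \<in> {0..1}"
  shows "regular_path l (hpath K d l s p)"
  unfolding regular_path_def
proof (intro notI, elim exE conjE)
  fix a b assume ab: "0 \<le> a" "a < b" "b \<le> l" and const: "\<forall>t\<in>{a..b}. hpath K d l s p t = hpath K d l s p a"
  obtain r where r: "continuous_on {0..l} r" "\<And>t t'. 0 \<le> t \<Longrightarrow> t \<le> t' \<Longrightarrow> t' \<le> l \<Longrightarrow> r t \<le> r t'"
    "r 0 = 0" "r l = l" "\<And>t. t \<in> {0..l} \<Longrightarrow> r t \<in> {0..l}"
    "\<And>t. t \<in> {0..l} \<Longrightarrow> L (r t) = blen K d l s p t"
    "\<And>t. t \<in> {0..l} \<Longrightarrow> hpath K d l s p (r t) = bent K d l s p t"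
    by (rule hpath_reparam[OF s], rule that; assumption)
  obtain t where t: "0 \<le> t" "t \<le> l" "r t = a" using IVT'[of r 0 a l] r ab l by auto
  obtain t' where t': "0 \<le> t'" "t' \<le> l" "r t' = b" using IVT'[of r 0 b l] r ab l by auto
  have "t < t'"
  proof (rule ccontr)
    assume "\<not> t < t'"
    then show False using r(2)[of t' t] t t' ab by simp
  qed
  have "bent K d l s p x = bent K d l s p t" if x: "x \<in> {t..t'}" for x
  proof -
    have "r x \<in> {a..b}" using r(2)[of t x] r(2)[of x t'] t t' x by auto
    then have "hpath K d l s p (r x) = hpath K d l s p (r t)" unfolding t(3) by (rule bspec[OF const])
    moreover have "hpath K d l s p (r x) = bent K d l s p x" by (rule r(7)) (use x t t' in auto)
    moreover have "hpath K d l s p (r t) = bent K d l s p t" by (rule r(7)) (use t in auto)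
    ultimately show ?thesis by simp
  qed
  from blen_const[OF s t(1) less_imp_le[OF \<open>t < t'\<close>] t'(2) this]
  have "blen K d l s p t = blen K d l s p t'" .
  then have "L a = L b" using r(6)[of t] r(6)[of t'] t t' by simp
  then show False using L_strict[of a b] ab by simp
qed

text \<open>At s = 0 the rescaling is the identity and \<open>blen\<close> is the injective function
  L, so the choice in \<open>hpath\<close> can only return t.\<close>

lemma hpath_0:
  assumes t: "t \<in> {0..l}"
  shows "hpath K d l 0 p t = p t"
proof -
  have e: "bent K d l 0 p x = p x" "blen K d l 0 p x = L x" if "x \<in> {0..l}" for x
    using phi_excess_id[of "snap (jump L l 0 x)" "p x" K d] points[OF that]
    by (auto simp: bent_def blen_def dlen_def jump_def snap_def)
  have "(SOME t'. t' \<in> {0..l} \<and> blen K d l 0 p t' = L t) = t"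
  proof (rule some_equality)
    show "t \<in> {0..l} \<and> blen K d l 0 p t = L t" using t e by simp
    show "t' = t" if "t' \<in> {0..l} \<and> blen K d l 0 p t' = L t" for t'
      using that e(2)[of t'] L_inj t by (auto dest: inj_onD)
  qed
  then show ?thesis using t e by (simp add: hpath_def)
qed

end

section \<open>Continuity in families\<close>

lemma continuous_map_metricI:
  fixes f :: "'a \<Rightarrow> 'b::metric_space"
  assumes "\<And>x e. x \<in> topspace X \<Longrightarrow> 0 < e \<Longrightarrow> \<exists>U. openin X U \<and> x \<in> U \<and> (\<forall>y\<in>U. dist (f y) (f x) < e)"
  shows "continuous_map X euclidean f"
  unfolding continuous_map_def
proof (intro conjI allI impI)
  fix W :: "'b set" assume "openin euclidean W"
  then have W: "open W" by simp
  have "\<exists>U. openin X U \<and> x \<in> U \<and> U \<subseteq> {x \<in> topspace X. f x \<in> W}" if x: "x \<in> topspace X" "f x \<in> W" for x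
  proof -
    obtain e where e: "e > 0" "\<And>y. dist y (f x) < e \<Longrightarrow> y \<in> W" using W x(2) open_dist by metis
    obtain U where U: "openin X U" "x \<in> U" "\<forall>y\<in>U. dist (f y) (f x) < e" using assms[OF x(1) e(1)] by blast
    have "U \<subseteq> {x \<in> topspace X. f x \<in> W}" using e(2) U(3) openin_subset[OF U(1)] by blast
    then show ?thesis using U by blast
  qed
  then show "openin X {x \<in> topspace X. f x \<in> W}" by (subst openin_subopen) blast
qed simp

lemma turn_vertex:
  assumes "p \<in> geom_points K d" "is_vertex K d p"
  shows "turn K d p = 1"
proof -
  obtain n c u where p: "c \<in> K n" "u \<in> cube n" "p = real_cell K d n c u"
    using assms(1) by (rule geom_points_cases)
  have u: "\<forall>k<n. u k \<in> {0, 1}"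
    using assms(2) unfolding p(3) is_vertex_cell[where K = K and n = n, OF p(1,2)] .
  have "(\<Sum>k<n. u k) \<in> \<int>" by (rule Ints_sum) (use u in force)
  then show ?thesis unfolding p(3) turn_cell[where K = K and n = n, OF p(1,2)] by (rule cis_multiple_2pi)
qed

lemma norm_cis_minus_one_pos:
  assumes "0 < e" "e < (1::real)"
  shows "0 < norm (cis (2 * pi * e) - 1)"
proof (rule ccontr)
  assume "\<not> ?thesis"
  then have "cis (2 * pi * e) = 1" by simp
  then have "cos (2 * pi * e) = 1" by (metis cis.simps(1) one_complex.simps(1))
  then obtain m :: int where "2 * pi * e = of_int m * (2 * pi)"
    by (auto simp: cos_one_2pi_int)
  then have "(2 * pi) * e = (2 * pi) * of_int m" by (simp only: mult.commute)
  then have "e = of_int m" by (simp only: mult_cancel_left) simp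
  then show False using assms by simp
qed

lemma norm_cis_minus_one_even: "norm (cis (- x) - 1) = norm (cis x - 1)"
proof -
  have "cis (- x) - 1 = cnj (cis x - 1)" by (simp add: cis_cnj)
  then show ?thesis by (simp only: complex_mod_cnj)
qed

text \<open>Z will be an interval of homotopy parameters times a simplex. Compactness and the
  Hausdorff property make the reparametrization of the whole family a quotient map.\<close>

locale path_family =
  fixes K :: "nat \<Rightarrow> 'c set" and d and tm and l :: real and Z :: "'z topology" and s :: "'z \<Rightarrow> real"
    and F :: "'z \<Rightarrow> real \<Rightarrow> 'c point"
  assumes Z: "compact_space Z" "Hausdorff_space Z"
    and s: "continuous_map Z euclideanreal s" and s01: "\<And>z. z \<in> topspace Z \<Longrightarrow> s z \<in> {0..1}"
    and F: "continuous_map (prod_topology Z (interval_top l)) (geom_top K d) (\<lambda>(z, t). F z t)"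
    and rc: "\<And>z. z \<in> topspace Z \<Longrightarrow> regular_chain K d tm l (F z)"
begin

abbreviation "ZI \<equiv> prod_topology Z (interval_top l)"

lemma continuous_map_turn_family: "continuous_map ZI euclidean (\<lambda>(z, t). turn K d (F z t))"
  using continuous_map_compose[OF F continuous_map_turn] by (simp add: o_def case_prod_unfold)

lemma turn_len:
  assumes "z \<in> topspace Z" "t \<in> {0..l}"
  shows "turn K d (F z t) = cis (2 * pi * len K d l (F z) t)"
proof -
  interpret regular_chain K d tm l "F z" by (rule rc[OF assms(1)])
  have "turn K d (F z 0) = 1" by (rule turn_vertex[OF points start]) (use l in auto)
  then show ?thesis using lift_onD(2)[OF lift assms(2)] unfolding L0 by simp
qed

text \<open>For z near z0 the values of \<open>turn\<close> along the two paths are close uniformly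
  in time, by the tube lemma. Both lengths start at 0; if they ever differed by \<epsilon> or more,
  they would differ by exactly \<epsilon> at some time, and there the values of \<open>turn\<close>
  would be too far apart.\<close>

lemma continuous_map_len: "continuous_map ZI euclideanreal (\<lambda>(z, t). len K d l (F z) t)"
proof (rule continuous_map_metricI)
  fix x and e :: real assume x: "x \<in> topspace ZI" and e: "0 < e"
  obtain z0 t0 where x0: "x = (z0, t0)" "z0 \<in> topspace Z" "t0 \<in> {0..l}" using x by auto
  let ?L = "\<lambda>z. len K d l (F z)" and ?G = "\<lambda>(z, t). turn K d (F z t)"
  interpret r0: regular_chain K d tm l "F z0" by (rule rc[OF x0(2)])
  \<comment> \<open>The bound 1/4 keeps \<epsilon> below a full turn, so that
    \<open>cis (2 * pi * \<epsilon>)\<close> differs from 1.\<close>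
  define \<epsilon> where "\<epsilon> = min (e / 2) (1 / 4)"
  have \<epsilon>: "0 < \<epsilon>" "\<epsilon> < 1" "\<epsilon> \<le> e / 2" using e by (auto simp: \<epsilon>_def)
  define \<eta> where "\<eta> = norm (cis (2 * pi * \<epsilon>) - 1)"
  have \<eta>: "0 < \<eta>" unfolding \<eta>_def by (rule norm_cis_minus_one_pos[OF \<epsilon>(1,2)])
  have "continuous_map ZI ZI (\<lambda>(z, t). (z0, t))"
    using x0(2) continuous_map_snd[of Z "interval_top l"]
    by (auto simp: continuous_map_pairwise o_def case_prod_unfold)
  from continuous_map_compose[OF this continuous_map_turn_family]
  have "continuous_map ZI euclidean (\<lambda>(z, t). turn K d (F z0 t))"
    by (simp add: o_def case_prod_unfold)
  then have "continuous_map ZI euclideanreal (\<lambda>y. norm (turn K d (F (fst y) (snd y)) - turn K d (F z0 (snd y))))"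
    using continuous_map_turn_family
    by (auto simp: case_prod_unfold intro!: continuous_intros)
  from openin_continuous_map_preimage[OF this, of "{..<\<eta>}"]
  have op: "openin ZI {y \<in> topspace ZI. norm (turn K d (F (fst y) (snd y)) - turn K d (F z0 (snd y))) < \<eta>}"
    by simp
  have "compactin (interval_top l) {0..l}"
    by (simp add: interval_top_def compactin_subtopology)
  moreover have "{z0} \<times> {0..l} \<subseteq> {y \<in> topspace ZI. norm (turn K d (F (fst y) (snd y)) - turn K d (F z0 (snd y))) < \<eta>}"
    using \<eta> x0(2) by auto
  ultimately have "\<exists>U V. openin Z U \<and> openin (interval_top l) V \<and> z0 \<in> U \<and> {0..l} \<subseteq> V \<and>
      U \<times> V \<subseteq> {y \<in> topspace ZI. norm (turn K d (F (fst y) (snd y)) - turn K d (F z0 (snd y))) < \<eta>}"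
    using x0(2) by (intro tube_lemma_right[OF op])
  then obtain U V where U: "openin Z U" "z0 \<in> U" "{0..l} \<subseteq> V"
    "U \<times> V \<subseteq> {y \<in> topspace ZI. norm (turn K d (F (fst y) (snd y)) - turn K d (F z0 (snd y))) < \<eta>}"
    by blast
  have close: "\<bar>?L z t - ?L z0 t\<bar> < \<epsilon>" if z: "z \<in> U" and t: "t \<in> {0..l}" for z t
  proof (rule ccontr)
    assume far: "\<not> ?thesis"
    have zZ: "z \<in> topspace Z" using z openin_subset[OF U(1)] by blast
    interpret r: regular_chain K d tm l "F z" by (rule rc[OF zZ])
    let ?D = "\<lambda>t. \<bar>?L z t - ?L z0 t\<bar>"
    have "continuous_on {0..l} ?D" by (intro continuous_intros r.L_cont r0.L_cont)
    then have "continuous_on {0..t} ?D" by (rule continuous_on_subset) (use t in auto)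
    moreover have "?D 0 = 0" using r.L0 r0.L0 by simp
    ultimately obtain x where x: "0 \<le> x" "x \<le> t" "?D x = \<epsilon>"
      using IVT'[of ?D 0 \<epsilon> t] far \<epsilon> t by auto
    then have xl: "x \<in> {0..l}" using t by auto
    have "norm (turn K d (F z x) - turn K d (F z0 x)) < \<eta>" using subsetD[OF U(4), of "(z, x)"] U(3) z xl by auto
    moreover have "turn K d (F z x) - turn K d (F z0 x) =
        cis (2 * pi * ?L z0 x) * (cis (2 * pi * (?L z x - ?L z0 x)) - 1)"
      unfolding turn_len[OF zZ xl] turn_len[OF x0(2) xl] by (simp add: right_diff_distrib cis_mult)
    ultimately have "norm (cis (2 * pi * (?L z x - ?L z0 x)) - 1) < \<eta>" by (simp add: norm_mult)
    moreover have "?L z x - ?L z0 x = \<epsilon> \<or> ?L z x - ?L z0 x = - \<epsilon>" using x(3) \<epsilon>(1) by linarith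
    then have "norm (cis (2 * pi * (?L z x - ?L z0 x)) - 1) = \<eta>"
      unfolding \<eta>_def using norm_cis_minus_one_even[of "2 * pi * \<epsilon>"] by auto
    ultimately show False by simp
  qed
  obtain \<delta> where \<delta>: "\<delta> > 0" "\<And>t. t \<in> {0..l} \<Longrightarrow> dist t t0 < \<delta> \<Longrightarrow> dist (?L z0 t) (?L z0 t0) < e / 2"
    using r0.L_cont x0(3) half_gt_zero[OF e] unfolding continuous_on_iff by metis
  show "\<exists>U. openin ZI U \<and> x \<in> U \<and> (\<forall>y\<in>U. dist (case y of (z, t) \<Rightarrow> ?L z t) (case x of (z, t) \<Rightarrow> ?L z t) < e)"
  proof (intro exI[of _ "U \<times> ({0..l} \<inter> ball t0 \<delta>)"] conjI ballI)
    have "openin (interval_top l) ({0..l} \<inter> ball t0 \<delta>)" by (auto simp: interval_top_def)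
    then show "openin ZI (U \<times> ({0..l} \<inter> ball t0 \<delta>))" using U(1) by (simp add: openin_prod_Times_iff)
    show "x \<in> U \<times> ({0..l} \<inter> ball t0 \<delta>)" using U(2) x0 \<delta>(1) by auto
    fix y assume "y \<in> U \<times> ({0..l} \<inter> ball t0 \<delta>)"
    then obtain z t where y: "y = (z, t)" "z \<in> U" "t \<in> {0..l}" "dist t t0 < \<delta>" by (auto simp: dist_commute)
    have "\<bar>?L z t - ?L z0 t\<bar> < e / 2" using close[OF y(2,3)] \<epsilon>(3) by linarith
    moreover have "\<bar>?L z0 t - ?L z0 t0\<bar> < e / 2" using \<delta>(2)[OF y(3,4)] by (simp add: dist_real_def)
    ultimately have "\<bar>?L z t - ?L z0 t0\<bar> < e" by linarith
    then show "dist (case y of (z, t) \<Rightarrow> ?L z t) (case x of (z, t) \<Rightarrow> ?L z t) < e"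
      by (simp add: y(1) x0(1) dist_real_def)
  qed
qed

lemma continuous_map_total: "continuous_map ZI euclideanreal (\<lambda>(z, t). len K d l (F z) l)"
\<comment> \<open>Positivity of l comes from a member of the family, so the empty family is treated
  separately.\<close>
proof (cases "topspace Z = {}")
  case True
  then show ?thesis by (auto simp: continuous_map_def openin_subopen[of ZI])
next
  case False
  then have "0 < l" using rc regular_chain.l by blast
  then have "continuous_map ZI ZI (\<lambda>(z, t). (z, l))"
    using continuous_map_fst[of Z "interval_top l"]
    by (auto simp: continuous_map_pairwise o_def case_prod_unfold)
  from continuous_map_compose[OF this continuous_map_len] show ?thesis
    by (simp add: o_def case_prod_unfold)
qed

lemma total_pos: "z \<in> topspace Z \<Longrightarrow> 0 < len K d l (F z) l"
  by (rule regular_chain.n_pos[OF rc])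

lemma continuous_map_ratio:
  assumes "continuous_map ZI euclideanreal (\<lambda>(z, t). f z t)"
  shows "continuous_map ZI euclideanreal (\<lambda>(z, t). f z t / len K d l (F z) l)"
  using assms continuous_map_total total_pos
  by (auto simp: case_prod_unfold intro!: continuous_map_real_divide) force

definition param :: "'z \<Rightarrow> real \<Rightarrow> real \<times> real \<times> real" where
  "param z t = jump (len K d l (F z)) l (s z) t"

lemma continuous_map_param: "continuous_map ZI (top_of_set snap_params) (\<lambda>(z, t). param z t)"
proof -
  have s': "continuous_map ZI euclideanreal (\<lambda>y. s (fst y))"
    using continuous_map_compose[OF continuous_map_fst s] by (simp add: o_def)
  have n: "continuous_map ZI euclideanreal (\<lambda>y. 128 * (len K d l (F (fst y)) l)\<^sup>2 + 8)"
    using continuous_map_total by (auto simp: case_prod_unfold intro!: continuous_intros)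
  have "continuous_map ZI euclideanreal (\<lambda>y. 9 / 16 - 1 / 8 * (len K d l (F (fst y)) (snd y) / len K d l (F (fst y)) l))"
    using continuous_map_ratio[OF continuous_map_len, unfolded case_prod_unfold]
    by (intro continuous_map_diff continuous_map_real_mult) auto
  then have c: "continuous_map ZI euclideanreal (\<lambda>y. 9 / 16 - len K d l (F (fst y)) (snd y) / (8 * len K d l (F (fst y)) l))"
    by (simp add: mult.commute)
  have "continuous_map ZI (prod_topology euclideanreal (prod_topology euclideanreal euclideanreal)) (\<lambda>(z, t). param z t)"
    using s' n c by (simp only: continuous_map_pairwise) (simp add: o_def case_prod_unfold param_def jump_def)
  then have "continuous_map ZI euclidean (\<lambda>(z, t). param z t)"
    by (simp add: euclidean_product_topology)
  moreover have "param z t \<in> snap_params" if "z \<in> topspace Z" "t \<in> {0..l}" for z t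
    unfolding param_def by (rule regular_chain.jump_params[OF rc[OF that(1)] s01[OF that(1)] that(2)])
  ultimately show ?thesis by (auto simp: continuous_map_in_subtopology)
qed

lemma continuous_map_param_point:
  "continuous_map ZI (prod_topology (top_of_set snap_params) (geom_top K d)) (\<lambda>(z, t). (param z t, F z t))"
  using continuous_map_param F by (simp only: continuous_map_pairwise) (simp add: o_def case_prod_unfold)

lemma continuous_map_bent: "continuous_map ZI (geom_top K d) (\<lambda>(z, t). bent K d l (s z) (F z) t)"
  using continuous_map_compose[OF continuous_map_param_point
      continuous_map_phi[OF closed_snap_params continuous_on_snap unit_map_snap]]
  by (simp add: o_def case_prod_unfold bent_def param_def)

lemma continuous_map_blen: "continuous_map ZI euclideanreal (\<lambda>(z, t). blen K d l (s z) (F z) t)"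
proof -
  have "continuous_map ZI euclideanreal (\<lambda>y. excess K d (snap (param (fst y) (snd y))) (F (fst y) (snd y)))"
    using continuous_map_compose[OF continuous_map_param_point
      continuous_map_excess[OF closed_snap_params continuous_on_snap unit_map_snap]]
    by (simp add: o_def case_prod_unfold)
  then show ?thesis
    using continuous_map_len by (auto simp: case_prod_unfold blen_def dlen_def param_def intro!: continuous_map_add)
qed

text \<open>Total lengths vary with z, so lengths are normalized to [0, 1]. The map Q from (z, t) to
  (z, normalized deformed length) is a quotient map, and \<open>bent\<close> factors through it as
  \<open>hat\<close>. Then \<open>hpath\<close> is \<open>hat\<close> after the normalized original
  length.\<close>

lemma continuous_map_hpath: "continuous_map ZI (geom_top K d) (\<lambda>(z, t). hpath K d l (s z) (F z) t)"
proof -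
  let ?n = "\<lambda>z. len K d l (F z) l" and ?b = "\<lambda>z. blen K d l (s z) (F z)"
  define Q where "Q = (\<lambda>(z, t). (z, ?b z t / ?n z))"
  define hat where "hat = (\<lambda>(z, v). bent K d l (s z) (F z) (SOME t'. t' \<in> {0..l} \<and> ?b z t' = v * ?n z))"
  let ?Z1 = "prod_topology Z (interval_top 1)"
  have into: "continuous_map ZI ?Z1 (\<lambda>(z, t). (z, f z t / ?n z))"
    if f: "continuous_map ZI euclideanreal (\<lambda>(z, t). f z t)"
      "\<And>z t. z \<in> topspace Z \<Longrightarrow> t \<in> {0..l} \<Longrightarrow> f z t \<in> {0..?n z}" for f
  proof -
    have "f z t / ?n z \<in> {0..1}" if "z \<in> topspace Z" "t \<in> {0..l}" for z t
      using f(2)[OF that] total_pos[OF that(1)] by (auto simp: divide_simps)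
    then have "continuous_map ZI (interval_top 1) (\<lambda>(z, t). f z t / ?n z)"
      using continuous_map_ratio[OF f(1)] by (auto simp: interval_top_def continuous_map_in_subtopology)
    then show ?thesis
      using continuous_map_fst[of Z "interval_top l"]
      by (simp only: continuous_map_pairwise) (simp add: o_def case_prod_unfold)
  qed
  have b: "fibre_mono (?b z) (bent K d l (s z) (F z)) 0 l" "?b z 0 = 0" "?b z l = ?n z" if "z \<in> topspace Z" for z
    using regular_chain.bent_fibre[OF rc s01, OF that that] regular_chain.bent_ends(3,4)[OF rc s01, OF that that] by auto
  have l: "0 < l" if "z \<in> topspace Z" for z using regular_chain.l[OF rc[OF that]] .
  have b_in: "?b z t \<in> {0..?n z}" if z: "z \<in> topspace Z" and t: "t \<in> {0..l}" for z t
    using fibre_monoD(2)[OF b(1)[OF z], of 0 t] fibre_monoD(2)[OF b(1)[OF z], of t l] b(2,3)[OF z] t by auto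
  have Qc: "continuous_map ZI ?Z1 Q" unfolding Q_def by (rule into[OF continuous_map_blen b_in])
  have "quotient_map ZI ?Z1 Q"
  proof (rule continuous_imp_quotient_map[OF Qc])
    have I: "compact_space (interval_top x)" "Hausdorff_space (interval_top x)" for x
      by (auto simp: interval_top_def compact_space_subtopology Hausdorff_space_subtopology)
    show "compact_space ZI" "Hausdorff_space ?Z1"
      using Z I by (auto simp: compact_space_prod_topology Hausdorff_space_prod_topology)
    show "Q ` topspace ZI = topspace ?Z1"
    proof
      show "Q ` topspace ZI \<subseteq> topspace ?Z1" using continuous_map_image_subset_topspace[OF Qc] .
      show "topspace ?Z1 \<subseteq> Q ` topspace ZI"
      proof
        fix y assume "y \<in> topspace ?Z1"
        then obtain z v where y: "y = (z, v)" "z \<in> topspace Z" "0 \<le> v" "v \<le> 1" by auto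
        note n = total_pos[OF y(2)]
        have "0 \<le> v * ?n z" "v * ?n z \<le> ?n z" using y n by (auto simp: mult_left_le_one_le)
        then obtain t where "0 \<le> t" "t \<le> l" "?b z t = v * ?n z"
          using IVT'[of "?b z" 0 "v * ?n z" l] b(2,3)[OF y(2)] fibre_monoD(1)[OF b(1)[OF y(2)]] l[OF y(2)] by auto
        then have "(z, t) \<in> topspace ZI" "Q (z, t) = y" using y n by (auto simp: Q_def)
        then show "y \<in> Q ` topspace ZI" by (metis imageI)
      qed
    qed
  qed
  moreover have "continuous_map ZI (geom_top K d) (hat \<circ> Q)"
  proof (rule continuous_map_eq[OF continuous_map_bent])
    fix y assume "y \<in> topspace ZI"
    then obtain z t where y: "y = (z, t)" "z \<in> topspace Z" "t \<in> {0..l}" by auto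
    let ?P = "\<lambda>t'. t' \<in> {0..l} \<and> ?b z t' = ?b z t / ?n z * ?n z"
    have e: "?b z t / ?n z * ?n z = ?b z t" using total_pos[OF y(2)] by simp
    have "?P (SOME t'. ?P t')" by (rule someI[of ?P t]) (use y e in simp)
    then have st: "(SOME t'. ?P t') \<in> {0..l}" "?b z (SOME t'. ?P t') = ?b z t" unfolding e by auto
    have "bent K d l (s z) (F z) x = bent K d l (s z) (F z) t" if "x \<in> {0..l}" "?b z x = ?b z t" for x
    proof (cases "x \<le> t")
      case True
      show ?thesis by (rule fibre_monoD(3)[OF b(1)[OF y(2)]]) (use that y True in auto)
    next
      case False
      show ?thesis by (rule fibre_monoD(3)[OF b(1)[OF y(2)], symmetric]) (use that y False in auto)
    qed
    from this[OF st] show "(\<lambda>(z, t). bent K d l (s z) (F z) t) y = (hat \<circ> Q) y"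
      by (simp add: y(1) Q_def hat_def)
  qed
  ultimately have hat: "continuous_map ?Z1 (geom_top K d) hat" by (rule continuous_compose_quotient_map)
  have "continuous_map ZI ?Z1 (\<lambda>(z, t). (z, len K d l (F z) t / ?n z))"
    by (rule into[OF continuous_map_len]) (use regular_chain.L_bounds[OF rc] in auto)
  from continuous_map_compose[OF this hat] show ?thesis
  proof (rule continuous_map_eq)
    fix y assume "y \<in> topspace ZI"
    then obtain z t where y: "y = (z, t)" "z \<in> topspace Z" "t \<in> {0..l}" by auto
    have e: "len K d l (F z) t / ?n z * ?n z = len K d l (F z) t" using total_pos[OF y(2)] by simp
    show "(hat \<circ> (\<lambda>(z, t). (z, len K d l (F z) t / ?n z))) y = (\<lambda>(z, t). hpath K d l (s z) (F z) t) y"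
      using y(3) by (simp only: y(1) hat_def hpath_def o_apply case_prod_conv e restrict_apply if_True)
  qed
qed

end

section \<open>The homotopy equivalence\<close>

definition flow_paths :: "(nat \<Rightarrow> 'c set) \<Rightarrow> (nat \<Rightarrow> nat \<Rightarrow> bool \<Rightarrow> 'c \<Rightarrow> 'c) \<Rightarrow> bool \<Rightarrow> 'c point \<Rightarrow> 'c point \<Rightarrow> real \<Rightarrow> (real \<Rightarrow> 'c point) set" where
  "flow_paths K d tm a b l = {p \<in> extensional {0..l}. regular_chain K d tm l p \<and> p 0 = a \<and> p l = b}"

lemma regular_path_scale:
  assumes r: "regular_path l p" and k: "0 < k" and q: "\<And>t. t \<in> {0..l} \<Longrightarrow> q (t * k) = p t"
  shows "regular_path (l * k) q"
  unfolding regular_path_def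
proof (intro notI, elim exE conjE)
  fix a b assume ab: "0 \<le> a" "a < b" "b \<le> l * k" and const: "\<forall>t\<in>{a..b}. q t = q a"
  have bl: "b / k \<le> l" using ab k by (simp add: divide_simps)
  have "p t = p (a / k)" if t: "t \<in> {a / k..b / k}" for t
  proof -
    have a0: "0 \<le> a / k" using ab k by simp
    have "t * k \<in> {a..b}" using t k by (auto simp: divide_simps)
    then have "q (t * k) = q a" by (rule bspec[OF const])
    moreover have "q (t * k) = p t" by (rule q) (use t a0 bl in auto)
    moreover have "q (a / k * k) = p (a / k)" by (rule q) (use t a0 bl in auto)
    ultimately show ?thesis using k by simp
  qed
  moreover have "0 \<le> a / k" "a / k < b / k" using ab k by (auto simp: divide_strict_right_mono)
  ultimately show False using r bl unfolding regular_path_def by blast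
qed

lemma chain_scale:
  assumes c: "chain K d tm p 0 l" and k: "0 < k" and q: "\<And>t. t \<in> {0..l} \<Longrightarrow> q (t * k) = p t"
  shows "chain K d tm q 0 (l * k)"
proof -
  have "chain K d tm q (0 * k) (l * k)"
    by (rule chain_quot[OF c, of "\<lambda>t. t * k"]) (use k q in \<open>auto intro!: continuous_intros\<close>)
  then show ?thesis by simp
qed

lemma regular_not_constant:
  assumes "0 < l" "regular_path l p"
  shows "\<not> constant_path l p"
proof
  assume "constant_path l p"
  then have "0 \<le> (0::real) \<and> 0 < l \<and> l \<le> l \<and> (\<forall>t\<in>{0..l}. p t = p 0)"
    using assms(1) unfolding constant_path_def by blast
  then show False using assms(2) unfolding regular_path_def by blast
qed

text \<open>Scaling time by l matches execution paths on the unit interval with regular chains on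
  \<open>{0..l}\<close>; nonconstancy is supplied by \<open>regular_not_constant\<close>.\<close>

lemma MG_set_Kreg:
  assumes a: "a \<in> vertex K d ` K 0" and b: "b \<in> vertex K d ` K 0" and l: "0 < l"
  shows "MG_set (Kreg K d tm) a b l = flow_paths K d tm a b l"
proof
  have va: "is_vertex K d a" "is_vertex K d b" using a b is_vertex_vertex by auto
  show "MG_set (Kreg K d tm) a b l \<subseteq> flow_paths K d tm a b l"
  proof
    fix \<gamma> assume "\<gamma> \<in> MG_set (Kreg K d tm) a b l"
    then obtain p where \<gamma>: "\<gamma> = (\<lambda>t\<in>{0..l}. p (t / l))" and p: "dpath K d tm 1 p" "regular_path 1 p" "p 0 = a" "p 1 = b"
      by (auto simp: MG_set_def Kreg_def)
    have q: "\<gamma> (t * l) = p t" if "t \<in> {0..1}" for t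
      using that l by (auto simp: \<gamma> mult_left_le_one_le)
    have "chain K d tm p 0 1" using p(1) by (simp add: dpath_iff_chain)
    then have "chain K d tm \<gamma> 0 (1 * l)" by (rule chain_scale[where q = \<gamma> and k = l and p = p, OF _ l q])
    moreover have "regular_path (1 * l) \<gamma>" by (rule regular_path_scale[where q = \<gamma> and k = l and p = p, OF p(2) l q])
    moreover have "\<gamma> 0 = a" "\<gamma> l = b" using q[of 0] q[of 1] p by auto
    ultimately show "\<gamma> \<in> flow_paths K d tm a b l"
      using l va by (auto simp: flow_paths_def regular_chain_def \<gamma>)
  qed
  show "flow_paths K d tm a b l \<subseteq> MG_set (Kreg K d tm) a b l"
  proof
    fix \<gamma> assume "\<gamma> \<in> flow_paths K d tm a b l"
    then have \<gamma>: "\<gamma> \<in> extensional {0..l}" "chain K d tm \<gamma> 0 l" "regular_path l \<gamma>" "\<gamma> 0 = a" "\<gamma> l = b"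
      by (auto simp: flow_paths_def regular_chain_def)
    define p where "p = (\<lambda>t\<in>{0..1}. \<gamma> (t * l))"
    have il: "0 < inverse l" "l * inverse l = 1" using l by auto
    have q: "p (t * inverse l) = \<gamma> t" if "t \<in> {0..l}" for t
      using that l by (auto simp: p_def divide_simps)
    have "chain K d tm p 0 1" using chain_scale[where q = p and k = "inverse l" and p = \<gamma>, OF \<gamma>(2) il(1) q] il(2) by simp
    moreover have reg: "regular_path 1 p" using regular_path_scale[where q = p and k = "inverse l" and p = \<gamma>, OF \<gamma>(3) il(1) q] il(2) by simp
    moreover have "\<not> constant_path 1 p" by (rule regular_not_constant[OF _ reg]) simp
    moreover have ends: "p 0 = a" "p 1 = b" using \<gamma> by (auto simp: p_def)
    moreover have "p \<in> extensional {0..1}" by (simp add: p_def)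
    ultimately have "p \<in> exec_paths (Kreg K d tm)" using a b by (simp add: Kreg_def dpath_iff_chain)
    moreover have "\<gamma> = (\<lambda>t\<in>{0..l}. p (t / l))"
    proof (rule extensionalityI[OF \<gamma>(1)])
      show "\<gamma> t = (\<lambda>t\<in>{0..l}. p (t / l)) t" if "t \<in> {0..l}" for t
        using q[OF that] that by (simp add: divide_inverse)
    qed simp
    ultimately show "\<gamma> \<in> MG_set (Kreg K d tm) a b l" using ends by (auto simp: MG_set_def)
  qed
qed

lemma chain_forget_tame:
  assumes "chain K d True p a b"
  shows "chain K d tm p a b"
proof (cases tm)
  case False
  \<comment> \<open>Restriction to the whole interval resets the flag and changes nothing
    else.\<close>
  then show ?thesis using chain_restrict[OF assms order_refl chain_le[OF assms] order_refl] by simp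
qed (use assms in simp)

lemma flow_paths_forget_tame: "flow_paths K d True a b l \<subseteq> flow_paths K d tm a b l"
  using chain_forget_tame[of K d _ 0 l tm] by (auto simp: flow_paths_def regular_chain_def)

lemma continuous_map_MG_top_imp:
  assumes "continuous_map Z (MG_top X a b l) f"
  shows "continuous_map Z (compact_open_top (interval_top l) (space X)) f" "f ` topspace Z \<subseteq> MG_set X a b l"
proof -
  have "continuous_map Z (subtopology (map_top (interval_top l) (space X)) (MG_set X a b l)) f"
    using assms unfolding MG_top_def by (rule continuous_map_into_delta_k_imp)
  then have 1: "continuous_map Z (map_top (interval_top l) (space X)) f" "f ` topspace Z \<subseteq> MG_set X a b l"
    by (auto simp: continuous_map_in_subtopology)
  from 1(1) show "continuous_map Z (compact_open_top (interval_top l) (space X)) f"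
    unfolding map_top_def by (rule continuous_map_into_delta_k_imp)
  show "f ` topspace Z \<subseteq> MG_set X a b l" by (rule 1(2))
qed

lemma topspace_MG_top: "topspace (MG_top X a b l) \<subseteq> MG_set X a b l"
  by (auto simp: MG_top_def)

text \<open>\<open>MG_top\<close> kelleyfies twice, once for the mapping space and once for the
  subspace of execution paths; the retraction is used for each.\<close>

lemma continuous_map_into_MG_top:
  fixes \<alpha> \<omega> :: real
  assumes ab: "\<alpha> \<le> \<omega>"
    and f: "continuous_map (prod_topology (top_of_set {\<alpha>..\<omega>}) (simplex_top n)) (compact_open_top (interval_top l) (space X)) f"
    and im: "f ` ({\<alpha>..\<omega>} \<times> standard_simplex n) \<subseteq> MG_set X a b l"
  shows "continuous_map (prod_topology (top_of_set {\<alpha>..\<omega>}) (simplex_top n)) (MG_top X a b l) f"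
proof -
  obtain j q where jq:
    "continuous_map (prod_topology (top_of_set {\<alpha>..\<omega>}) (simplex_top n)) (simplex_top (Suc (2 * n))) j"
    "continuous_map (simplex_top (Suc (2 * n))) (prod_topology (top_of_set {\<alpha>..\<omega>}) (simplex_top n)) q"
    "\<And>z. z \<in> topspace (prod_topology (top_of_set {\<alpha>..\<omega>}) (simplex_top n)) \<Longrightarrow> q (j z) = z"
    by (rule interval_times_simplex_retract[OF ab, of n], rule that; assumption)
  have "continuous_map (prod_topology (top_of_set {\<alpha>..\<omega>}) (simplex_top n)) (map_top (interval_top l) (space X)) f"
    unfolding map_top_def by (rule retract_into_delta_k[OF jq f])
  then have "continuous_map (prod_topology (top_of_set {\<alpha>..\<omega>}) (simplex_top n))
     (subtopology (map_top (interval_top l) (space X)) (MG_set X a b l)) f"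
    using im by (auto simp: continuous_map_in_subtopology)
  from retract_into_delta_k[OF jq this] show ?thesis unfolding MG_top_def .
qed

lemma space_Kreg [simp]: "space (Kreg K d tm) = geom_top K d" and states_Kreg [simp]: "states (Kreg K d tm) = vertex K d ` K 0"
  by (simp_all add: Kreg_def)

lemma hpath_extensional: "hpath K d l s p \<in> extensional {0..l}"
  unfolding hpath_def by (rule restrict_extensional)

text \<open>Continuity is tested on simplices of the path space, each of which yields a
  \<open>path_family\<close>. The interval is left general: [0, 1] gives the homotopies, {0} the
  inclusion, and {1} the taming map.\<close>

lemma continuous_map_homotopy:
  fixes \<alpha> \<omega> :: real
  assumes a: "a \<in> vertex K d ` K 0" and b: "b \<in> vertex K d ` K 0" and l: "0 < l"
    and \<alpha>: "0 \<le> \<alpha>" "\<alpha> \<le> \<omega>" "\<omega> \<le> 1"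
    and into: "\<And>s p. s \<in> {\<alpha>..\<omega>} \<Longrightarrow> p \<in> flow_paths K d tm a b l \<Longrightarrow> hpath K d l s p \<in> flow_paths K d tm' a b l"
  shows "continuous_map (prod_topology (top_of_set {\<alpha>..\<omega>}) (MG_top (Kreg K d tm) a b l))
     (MG_top (Kreg K d tm') a b l) (\<lambda>(s, p). hpath K d l s p)"
proof (rule continuous_map_prod_final[where I = "{(n, \<sigma>). continuous_map (simplex_top n) (MG_top (Kreg K d tm) a b l) \<sigma>}"
      and T = "\<lambda>(n, \<sigma>). simplex_top n" and \<sigma> = "\<lambda>(n, \<sigma>). \<sigma>"])
  let ?X = "MG_top (Kreg K d tm) a b l"
  show "closed {\<alpha>..\<omega>}" by simp
  fix U assume U: "U \<subseteq> topspace ?X"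
    and op: "\<And>i. i \<in> {(n, \<sigma>). continuous_map (simplex_top n) ?X \<sigma>} \<Longrightarrow>
      openin (case i of (n, \<sigma>) \<Rightarrow> simplex_top n) {y \<in> topspace (case i of (n, \<sigma>) \<Rightarrow> simplex_top n). (case i of (n, \<sigma>) \<Rightarrow> \<sigma>) y \<in> U}"
  let ?X' = "subtopology (map_top (interval_top l) (space (Kreg K d tm))) (MG_set (Kreg K d tm) a b l)"
  \<comment> \<open>Probes of the subspace are also probes of its kelleyfication, so the hypothesis
    on the latter covers them.\<close>
  have "openin (simplex_top n) {x \<in> standard_simplex n. \<sigma> x \<in> U}" if "continuous_map (simplex_top n) ?X' \<sigma>" for n \<sigma>
    using op[of "(n, \<sigma>)"] simplex_into_delta_k[OF that] by (simp add: MG_top_def)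
  then show "openin ?X U" using U unfolding MG_top_def openin_delta_k by simp
next
  let ?X = "MG_top (Kreg K d tm) a b l"
  fix i y assume "i \<in> {(n, \<sigma>). continuous_map (simplex_top n) ?X \<sigma>}" "y \<in> topspace (case i of (n, \<sigma>) \<Rightarrow> simplex_top n)"
  then show "(case i of (n, \<sigma>) \<Rightarrow> \<sigma>) y \<in> topspace ?X"
    by (cases i) (auto dest!: continuous_map_image_subset_topspace)
next
  let ?X = "MG_top (Kreg K d tm) a b l"
  fix x assume x: "x \<in> topspace ?X"
  obtain y where y: "y \<in> standard_simplex 0" using nonempty_standard_simplex by blast
  have "continuous_map (simplex_top 0) ?X (\<lambda>_. x)" using x by simp
  then show "\<exists>i\<in>{(n, \<sigma>). continuous_map (simplex_top n) ?X \<sigma>}. \<exists>y\<in>topspace (case i of (n, \<sigma>) \<Rightarrow> simplex_top n). (case i of (n, \<sigma>) \<Rightarrow> \<sigma>) y = x"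
    using y by (intro bexI[of _ "(0, \<lambda>_. x)"]) auto
next
  fix i assume "i \<in> {(n, \<sigma>). continuous_map (simplex_top n) (MG_top (Kreg K d tm) a b l) \<sigma>}"
  then obtain n \<sigma> where i: "i = (n, \<sigma>)" and \<sigma>: "continuous_map (simplex_top n) (MG_top (Kreg K d tm) a b l) \<sigma>" by auto
  let ?Z = "prod_topology (top_of_set {\<alpha>..\<omega>}) (simplex_top n)"
  note MS = MG_set_Kreg[OF a b l]
  have \<sigma>1: "continuous_map (simplex_top n) (compact_open_top (interval_top l) (geom_top K d)) \<sigma>"
    and \<sigma>2: "\<And>x. x \<in> standard_simplex n \<Longrightarrow> \<sigma> x \<in> flow_paths K d tm a b l"
    using continuous_map_MG_top_imp[OF \<sigma>] MS by auto
  interpret path_family K d tm l ?Z fst "\<lambda>z. \<sigma> (snd z)"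
  proof (rule path_family.intro)
    have "compact_space (simplex_top n)"
      using compactin_standard_simplex by (simp add: compact_space_subtopology)
    moreover have "Hausdorff_space (simplex_top n)"
      by (simp add: Hausdorff_space_subtopology Hausdorff_space_product_topology)
    ultimately show "compact_space ?Z" "Hausdorff_space ?Z"
      by (auto simp: compact_space_prod_topology Hausdorff_space_prod_topology Hausdorff_space_subtopology compact_space_subtopology)
    show "continuous_map ?Z euclideanreal fst"
      using continuous_map_fst[of "top_of_set {\<alpha>..\<omega>}"] continuous_map_into_fulltopology by blast
    show "fst z \<in> {0..1}" if "z \<in> topspace ?Z" for z using that \<alpha> by auto
    show "regular_chain K d tm l (\<sigma> (snd z))" if "z \<in> topspace ?Z" for z
      using that \<sigma>2[of "snd z"] by (auto simp: flow_paths_def)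
    show "continuous_map (prod_topology ?Z (interval_top l)) (geom_top K d) (\<lambda>(z, t). \<sigma> (snd z) t)"
      by (rule continuous_map_compact_open_eval) (use continuous_map_compose[OF continuous_map_snd \<sigma>1] in \<open>simp add: o_def\<close>)
  qed
  have "continuous_map ?Z (compact_open_top (interval_top l) (space (Kreg K d tm'))) (\<lambda>z. hpath K d l (fst z) (\<sigma> (snd z)))"
    unfolding space_Kreg
    by (rule continuous_map_into_compact_open[OF continuous_map_hpath]) (rule hpath_extensional)
  then have "continuous_map ?Z (MG_top (Kreg K d tm') a b l) (\<lambda>z. hpath K d l (fst z) (\<sigma> (snd z)))"
    by (rule continuous_map_into_MG_top[OF \<alpha>(2)]) (use into \<sigma>2 MS in auto)
  then show "continuous_map (prod_topology (top_of_set {\<alpha>..\<omega>}) (case i of (n, \<sigma>) \<Rightarrow> simplex_top n)) (MG_top (Kreg K d tm') a b l)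
      (\<lambda>(q, y). (\<lambda>(s, p). hpath K d l s p) (q, (case i of (n, \<sigma>) \<Rightarrow> \<sigma>) y))"
    by (simp add: i case_prod_unfold)
qed

lemma hpath_flow_paths:
  assumes p: "p \<in> flow_paths K d tm a b l" and s: "s \<in> {0..1}"
  shows "hpath K d l s p \<in> flow_paths K d tm a b l"
    "precubical_set K d \<Longrightarrow> hpath K d l 1 p \<in> flow_paths K d True a b l"
proof -
  interpret regular_chain K d tm l p using p by (simp add: flow_paths_def)
  have one: "(1::real) \<in> {0..1}" by simp
  have *: "hpath K d l s p \<in> flow_paths K d tm' a b l"
    if s: "s \<in> {0..1}" and c: "chain K d tm' (bent K d l s p) 0 l" for s tm'
    using hpath_chain[OF s c] hpath_regular[OF s] hpath_ends[OF s] l start stop p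
    by (auto simp: flow_paths_def regular_chain_def hpath_def)
  show "hpath K d l s p \<in> flow_paths K d tm a b l" by (rule *[OF s bent_chain[OF s]])
  show "hpath K d l 1 p \<in> flow_paths K d True a b l" if "precubical_set K d"
    by (rule *[OF one bent_tame[OF that]])
qed

lemma hpath_zero:
  assumes p: "p \<in> flow_paths K d tm a b l"
  shows "hpath K d l 0 p = p"
proof (rule extensionalityI)
  interpret regular_chain K d tm l p using p by (simp add: flow_paths_def)
  show "hpath K d l 0 p t = p t" if "t \<in> {0..l}" for t by (rule hpath_0[OF that])
qed (use p hpath_extensional in \<open>auto simp: flow_paths_def\<close>)

lemma homotopic_hpath:
  assumes a: "a \<in> vertex K d ` K 0" and b: "b \<in> vertex K d ` K 0" and l: "0 < l"
  shows "homotopic_with (\<lambda>_. True) (MG_top (Kreg K d tm) a b l) (MG_top (Kreg K d tm) a b l) (hpath K d l 1) id"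
proof -
  let ?X = "MG_top (Kreg K d tm) a b l"
  have "continuous_map (prod_topology (top_of_set {0..1}) ?X) ?X (\<lambda>(s, p). hpath K d l s p)"
    by (rule continuous_map_homotopy[OF a b l]) (auto intro: hpath_flow_paths)
  moreover have "hpath K d l 0 p = p" if "p \<in> topspace ?X" for p
    using that topspace_MG_top[of "Kreg K d tm" a b l] unfolding MG_set_Kreg[OF a b l]
    by (intro hpath_zero) blast
  ultimately have "homotopic_with (\<lambda>_. True) ?X ?X id (hpath K d l 1)"
    by (subst homotopic_with) (auto intro!: exI[of _ "\<lambda>(s, p). hpath K d l s p"])
  then show ?thesis by (rule homotopic_with_symD)
qed

text \<open>The homotopy inverse is \<open>hpath\<close> at s = 1. On underlying paths the inclusion
  is the identity, so both composites are again \<open>hpath\<close> at s = 1; since the homotopy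
  preserves tameness, it is available on either space.\<close>

lemma homotopy_equivalence_tame:
  assumes pc: "precubical_set K d" and a: "a \<in> vertex K d ` K 0" and b: "b \<in> vertex K d ` K 0" and l: "0 < l"
  shows "homotopy_equivalence_map (MG_top (Kreg K d True) a b l) (MG_top (Kreg K d False) a b l) (MG_map id l)"
proof -
  let ?X = "MG_top (Kreg K d True) a b l" and ?Y = "MG_top (Kreg K d False) a b l"
  have top: "topspace (MG_top (Kreg K d tm) a b l) \<subseteq> flow_paths K d tm a b l" for tm
    using topspace_MG_top[of "Kreg K d tm" a b l] unfolding MG_set_Kreg[OF a b l] .
  have map_id: "MG_map id l p = p" if "p \<in> flow_paths K d tm a b l" for tm p
    using that by (auto simp: flow_paths_def MG_map_def extensional_restrict)
  have Pair: "continuous_map X (prod_topology (top_of_set {s..s}) X) (\<lambda>p. (s, p))" for s :: real and X :: "(real \<Rightarrow> 'a point) topology"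
    by (simp add: continuous_map_pairwise o_def)
  \<comment> \<open>The inclusion is \<open>hpath\<close> at s = 0, so its continuity is the case of
    a one-point interval.\<close>
  have "continuous_map (prod_topology (top_of_set {0..0}) ?X) ?Y (\<lambda>(s, p). hpath K d l s p)"
  proof (rule continuous_map_homotopy[OF a b l])
    fix s p assume s: "s \<in> {0..0::real}" and p: "p \<in> flow_paths K d True a b l"
    have "hpath K d l s p \<in> flow_paths K d True a b l" by (rule hpath_flow_paths(1)[OF p]) (use s in auto)
    then show "hpath K d l s p \<in> flow_paths K d False a b l" by (rule flow_paths_forget_tame[THEN subsetD])
  qed auto
  from continuous_map_compose[OF Pair this] have "continuous_map ?X ?Y (hpath K d l 0)"
    by (simp add: o_def)
  then have f: "continuous_map ?X ?Y (MG_map id l)"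
  proof (rule continuous_map_eq)
    fix p assume "p \<in> topspace ?X"
    then have p: "p \<in> flow_paths K d True a b l" using top[of True] by blast
    show "hpath K d l 0 p = MG_map id l p" unfolding map_id[OF p] hpath_zero[OF p] ..
  qed
  have "continuous_map (prod_topology (top_of_set {1..1}) ?Y) ?X (\<lambda>(s, p). hpath K d l s p)"
  proof (rule continuous_map_homotopy[OF a b l])
    fix s p assume s: "s \<in> {1..1::real}" and p: "p \<in> flow_paths K d False a b l"
    have "hpath K d l 1 p \<in> flow_paths K d True a b l" by (rule hpath_flow_paths(2)[OF p _ pc, of 0]) simp
    then show "hpath K d l s p \<in> flow_paths K d True a b l" using s by simp
  qed auto
  from continuous_map_compose[OF Pair this] have g: "continuous_map ?Y ?X (hpath K d l 1)"
    by (simp add: o_def)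
  have "homotopic_with (\<lambda>_. True) ?X ?X (hpath K d l 1 \<circ> MG_map id l) id"
  proof (rule homotopic_with_eq[OF homotopic_hpath[OF a b l]])
    fix p assume "p \<in> topspace ?X"
    then have p: "p \<in> flow_paths K d True a b l" using top[of True] by blast
    show "(hpath K d l 1 \<circ> MG_map id l) p = hpath K d l 1 p" by (simp add: map_id[OF p])
  qed auto
  moreover have "homotopic_with (\<lambda>_. True) ?Y ?Y (MG_map id l \<circ> hpath K d l 1) id"
  proof (rule homotopic_with_eq[OF homotopic_hpath[OF a b l]])
    fix p assume "p \<in> topspace ?Y"
    then have "hpath K d l 1 p \<in> flow_paths K d False a b l" using top[of False] by (intro hpath_flow_paths) auto
    then show "(MG_map id l \<circ> hpath K d l 1) p = hpath K d l 1 p" using map_id by simp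
  qed auto
  ultimately show ?thesis unfolding homotopy_equivalence_map_def using f g by blast
qed

theorem theorem7p2:
  fixes K :: "nat \<Rightarrow> 'c set" and d :: "nat \<Rightarrow> nat \<Rightarrow> bool \<Rightarrow> 'c \<Rightarrow> 'c"
  assumes "precubical_set K d"
  shows "mdspace_map (Kreg K d True) (Kreg K d False) id \<and>
         MG_h_weak_equivalence (Kreg K d True) (Kreg K d False) id"
proof
  have "(\<lambda>t\<in>{0..1}. id (p t)) \<in> exec_paths (Kreg K d False)" if p: "p \<in> exec_paths (Kreg K d True)" for p
  proof -
    have ext: "p \<in> extensional {0..1}" and "chain K d True p 0 1"
      using p by (auto simp: Kreg_def dpath_iff_chain)
    then have "dpath K d False 1 p" by (simp add: dpath_iff_chain chain_forget_tame)
    moreover have "(\<lambda>t\<in>{0..1}. id (p t)) = p" using extensional_restrict[OF ext] by simp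
    ultimately show ?thesis using p by (simp add: Kreg_def)
  qed
  then show "mdspace_map (Kreg K d True) (Kreg K d False) id"
    unfolding mdspace_map_def space_Kreg states_Kreg by simp
  show "MG_h_weak_equivalence (Kreg K d True) (Kreg K d False) id"
    unfolding MG_h_weak_equivalence_def states_Kreg
    using homotopy_equivalence_tame[OF assms] by simp
qed

end
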